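(* Let $\mathcal H$ be a Hilbert space whose dimension $d$ is a prime number, with orthonormal basis $\{|k\rangle\}_{k=0}^{d-1}$, and let $\mathcal K$ be a finite-dimensional Hilbert space. For $0\le m,n\le d-1$ let $U_{m,n}=\sum_{k=0}^{d-1}e^{\frac{2\pi i}{d}kn}|k\oplus m\rangle\langle k|$, where $\oplus$ is addition modulo $d$. Let $p_n$ ($1\le n\le d-1$) and $r_m$ ($0\le m\le d-1$) be numbers in $[0,1]$ with $d\sum_{n=1}^{d-1}p_n+\sum_{m=0}^{d-1}r_m=1$, and let $$\Phi(\sigma)=\sum_{m=0}^{d-1}r_mU_{m,0}\sigma U_{m,0}^*+\sum_{m=0}^{d-1}\sum_{n=1}^{d-1}p_nU_{m,n}\sigma U_{m,n}^*,\qquad \sigma\in\mathfrak S(\mathcal H).$$ Suppose $\rho\in\mathfrak S(\mathcal H\otimes\mathcal K)$ is such that $\mathrm{Tr}_{\mathcal K}(\rho)$ belongs to the (maximal commutative) algebra generated by the projectors $|k\rangle\langle k|$, $0\le k\le d-1$, i.e. $\mathrm{Tr}_{\mathcal K}(\rho)$ is diagonal in the basis $\{|k\rangle\}$. Then for every quantum channel $\Omega:\mathfrak S(\mathcal K)\to\mathfrak S(\mathcal K)$, $$S((\Phi\otimes\Omega)(\rho))\ge H_\Phi(\mathrm{Tr}_{\mathcal K}(\rho))+H_\Omega(\mathrm{Tr}_{\mathcal H}(\rho)).$$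
   Context: $\mathfrak S(\cdot)$ denotes the set of density operators; a quantum channel is a completely positive trace-preserving linear map; $S(\sigma)=-\mathrm{Tr}(\sigma\log\sigma)$ is the von Neumann entropy. For a channel $\Psi$ with input space $\mathcal L$ and $\sigma\in\mathfrak S(\mathcal L)$, $H_\Psi(\sigma):=\min\sum_{j}\pi_jS(\Psi(\sigma_j))$, the minimum over all finite decompositions $\sigma=\sum_j\pi_j\sigma_j$ with $\{\pi_j\}$ a probability distribution and $\sigma_j\in\mathfrak S(\mathcal L)$. *)

theory Defs
  imports "Jordan_Normal_Form.Char_Poly"
begin

(* Operators on C^n are n x n complex matrices (Jordan_Normal_Form).
   The tensor product C^n1 (x) C^n2 is identified with C^(n1*n2) via
   |i> (x) |a>  <->  basis vector number i*n2 + a. *)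

definition ctrace :: "complex mat \<Rightarrow> complex" where
  "ctrace A = (\<Sum>i<dim_row A. A $$ (i, i))"

definition adj :: "complex mat \<Rightarrow> complex mat" where
  "adj A = mat (dim_col A) (dim_row A) (\<lambda>(i, j). cnj (A $$ (j, i)))"

definition msum :: "nat \<Rightarrow> ('b \<Rightarrow> complex mat) \<Rightarrow> 'b set \<Rightarrow> complex mat" where
  "msum n f I = mat n n (\<lambda>(i, j). \<Sum>x\<in>I. f x $$ (i, j))"

definition psd :: "nat \<Rightarrow> complex mat \<Rightarrow> bool" where
  "psd n A \<longleftrightarrow> A \<in> carrier_mat n n \<and>
     (\<forall>v \<in> carrier_vec n. Im (\<Sum>i<n. cnj (v $ i) * (A *\<^sub>v v) $ i) = 0 \<and>
                            Re (\<Sum>i<n. cnj (v $ i) * (A *\<^sub>v v) $ i) \<ge> 0)"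

definition density :: "nat \<Rightarrow> complex mat \<Rightarrow> bool" where
  "density n A \<longleftrightarrow> psd n A \<and> ctrace A = 1"

definition kron :: "complex mat \<Rightarrow> complex mat \<Rightarrow> complex mat" where
  "kron A B = mat (dim_row A * dim_row B) (dim_col A * dim_col B)
     (\<lambda>(i, j). A $$ (i div dim_row B, j div dim_col B) * B $$ (i mod dim_row B, j mod dim_col B))"

definition munit :: "nat \<Rightarrow> nat \<Rightarrow> nat \<Rightarrow> complex mat" where
  "munit n i j = mat n n (\<lambda>(a, b). if a = i \<and> b = j then 1 else 0)"

(* tensor product (A (x) B) of linear maps A on n1 x n1 and B on n2 x n2 matrices,
   defined on the basis |i><j| (x) |a><b| and extended linearly *)
definition tensor_map :: "nat \<Rightarrow> nat \<Rightarrow> (complex mat \<Rightarrow> complex mat) \<Rightarrow> (complex mat \<Rightarrow> complex mat)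
     \<Rightarrow> complex mat \<Rightarrow> complex mat" where
  "tensor_map n1 n2 A B X = msum (n1 * n2)
     (\<lambda>(i, j, a, b). X $$ (i * n2 + a, j * n2 + b) \<cdot>\<^sub>m kron (A (munit n1 i j)) (B (munit n2 a b)))
     ({..<n1} \<times> {..<n1} \<times> {..<n2} \<times> {..<n2})"

definition linear_map_on :: "nat \<Rightarrow> (complex mat \<Rightarrow> complex mat) \<Rightarrow> bool" where
  "linear_map_on n T \<longleftrightarrow>
     (\<forall>A \<in> carrier_mat n n. T A \<in> carrier_mat n n) \<and>
     (\<forall>A \<in> carrier_mat n n. \<forall>B \<in> carrier_mat n n. T (A + B) = T A + T B) \<and>
     (\<forall>A \<in> carrier_mat n n. \<forall>c. T (c \<cdot>\<^sub>m A) = c \<cdot>\<^sub>m T A)"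

definition completely_positive :: "nat \<Rightarrow> (complex mat \<Rightarrow> complex mat) \<Rightarrow> bool" where
  "completely_positive n T \<longleftrightarrow>
     (\<forall>k > 0. \<forall>X. psd (k * n) X \<longrightarrow> psd (k * n) (tensor_map k n (\<lambda>Y. Y) T X))"

definition trace_preserving :: "nat \<Rightarrow> (complex mat \<Rightarrow> complex mat) \<Rightarrow> bool" where
  "trace_preserving n T \<longleftrightarrow> (\<forall>A \<in> carrier_mat n n. ctrace (T A) = ctrace A)"

definition quantum_channel :: "nat \<Rightarrow> (complex mat \<Rightarrow> complex mat) \<Rightarrow> bool" where
  "quantum_channel n T \<longleftrightarrow> linear_map_on n T \<and> completely_positive n T \<and> trace_preserving n T"

definition eta :: "real \<Rightarrow> real" where
  "eta x = (if x \<le> 0 then 0 else x * ln x)"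

definition vn_entropy :: "complex mat \<Rightarrow> real" where
  "vn_entropy A = - (\<Sum>z\<in>{z. poly (char_poly A) z = 0}.
                        real (order z (char_poly A)) * eta (Re z))"

definition H_chan :: "nat \<Rightarrow> (complex mat \<Rightarrow> complex mat) \<Rightarrow> complex mat \<Rightarrow> real" where
  "H_chan n T \<sigma> = Inf {(\<Sum>j<N. \<pi> j * vn_entropy (T (s j))) | (N::nat) \<pi> s.
       (\<forall>j<N. \<pi> j \<ge> 0 \<and> density n (s j)) \<and> (\<Sum>j<N. \<pi> j) = 1 \<and>
       \<sigma> = msum n (\<lambda>j. complex_of_real (\<pi> j) \<cdot>\<^sub>m s j) {..<N}}"

definition ptrace_K :: "nat \<Rightarrow> nat \<Rightarrow> complex mat \<Rightarrow> complex mat" where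
  "ptrace_K dH dK \<rho> = mat dH dH (\<lambda>(i, j). \<Sum>a<dK. \<rho> $$ (i * dK + a, j * dK + a))"

definition ptrace_H :: "nat \<Rightarrow> nat \<Rightarrow> complex mat \<Rightarrow> complex mat" where
  "ptrace_H dH dK \<rho> = mat dK dK (\<lambda>(a, b). \<Sum>i<dH. \<rho> $$ (i * dK + a, i * dK + b))"

definition weyl :: "nat \<Rightarrow> nat \<Rightarrow> nat \<Rightarrow> complex mat" where
  "weyl d m n = mat d d (\<lambda>(r, k). if r = (k + m) mod d
       then exp (2 * of_real pi * \<i> * of_nat k * of_nat n / of_nat d) else 0)"

definition Phi :: "nat \<Rightarrow> (nat \<Rightarrow> real) \<Rightarrow> (nat \<Rightarrow> real) \<Rightarrow> complex mat \<Rightarrow> complex mat" where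
  "Phi d r p \<sigma> =
     msum d (\<lambda>m. complex_of_real (r m) \<cdot>\<^sub>m (weyl d m 0 * \<sigma> * adj (weyl d m 0))) {..<d} +
     msum d (\<lambda>(m, n). complex_of_real (p n) \<cdot>\<^sub>m (weyl d m n * \<sigma> * adj (weyl d m n)))
        ({..<d} \<times> {1..<d})"

end

theory Submission
  imports Defs "Jordan_Normal_Form.Schur_Decomposition"
begin

text \<open>
  Let \<open>X\<close> be the cyclic shift, \<open>E\<close> the pinching onto its eigenbasis, the Fourier basis, and
  \<open>\<rho>' = (id \<otimes> \<Omega>)(\<rho>)\<close>. Because the marginal of \<open>\<rho>\<close> on \<open>H\<close> is diagonal, all diagonal Fourier
  blocks of \<open>\<rho>'\<close> have trace \<open>1/d\<close>; rescaled, they are \<open>\<Omega>(\<rho>\<^sub>j)\<close> with \<open>Tr\<^sub>H \<rho>\<close> the average of the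
  \<open>\<rho>\<^sub>j\<close>. The output has the form \<open>A + Y\<close> with \<open>A = \<Sum>\<^sub>m r\<^sub>m X\<^sup>m \<rho>' X\<^sup>-\<^sup>m\<close> and \<open>Y\<close> block diagonal, and
  the heart of the proof is the inequality
  \<open>S(A + Y) \<ge> (1/d) \<Sum>\<^sub>m S(d r\<^sub>m E(\<rho>') + Y)\<close>. By Klein's inequality, its right-hand side is
  at least \<open>H(\<lambda>) + (1/d) \<Sum>\<^sub>j S(\<Omega>(\<rho>\<^sub>j))\<close> with \<open>\<lambda>\<^sub>m = r\<^sub>m + \<Sum>\<^sub>n p\<^sub>n\<close>. The decomposition of \<open>Tr\<^sub>K \<rho>\<close>
  into the \<open>|k\<rangle>\<langle>k|\<close> bounds \<open>H\<^sub>\<Phi>\<close> by \<open>H(\<lambda>)\<close>, that of \<open>Tr\<^sub>H \<rho>\<close> into the \<open>\<rho>\<^sub>j\<close> bounds \<open>H\<^sub>\<Omega>\<close>.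

  For the inequality, put \<open>D = E(\<rho>')\<close> and add \<open>s D\<close> to all operators. The difference of the
  two sides is nonincreasing in \<open>s\<close>, because \<open>Tr D ln(A + Y) \<ge> (1/d) \<Sum>\<^sub>m Tr D ln(d r\<^sub>m D + Y)\<close>, and it
  tends to a nonnegative limit by joint convexity of relative entropy. Both facts come from
  variational estimates for resolvents, integrated over the spectral parameter.
\<close>

section \<open>Joint convexity of relative entropy in spectral coordinates\<close>

text \<open>Both sides of the central inequality lie below the entropy of the pinched operator
  \<open>E(A + Y) = R D + Y\<close>, where \<open>R\<close> is the sum of the \<open>r m\<close>:
  the left side because pinching raises entropy, the right side by concavity, since the numbers
  \<open>d * r m\<close> average to \<open>R\<close>. Two upper bounds by the same quantity do not
  compare the sides with each other, so a quantitative argument is required. The direction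
  \<open>D\<close> suits it because adding \<open>s D\<close> merely turns \<open>d * r m\<close>
  into \<open>d * r m + s\<close> on the right, while the ratios
  \<open>(d * r m + s) / (R + s)\<close> tend to 1, which closes the gap between the left side and
  its pinching. Block diagonality of \<open>Y\<close> comes from weights \<open>p n\<close> that do
  not depend on \<open>m\<close>: summing X^m Z^n \<rho>' Z^-n X^-m over \<open>m\<close>, with Z
  the clock operator, gives \<open>d\<close> times the pinching of Z^n \<rho>' Z^-n, and Z only
  permutes the Fourier blocks. Operator logarithms and resolvents occur only as sums over an
  eigenbasis, and derivatives of entropies only as increments in Klein's inequality.\<close>

abbreviation cmod2 :: "complex \<Rightarrow> real" where "cmod2 z \<equiv> (cmod z)\<^sup>2"

lemma sum_swap3: "(\<Sum>x\<in>A. \<Sum>y\<in>B. \<Sum>z\<in>C. F x y z) = (\<Sum>y\<in>B. \<Sum>z\<in>C. \<Sum>x\<in>A. F x y z)"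
  by (subst sum.swap) (intro sum.cong refl sum.swap)

lemma sum_swap22:
  "(\<Sum>x\<in>A. \<Sum>y\<in>B. \<Sum>z\<in>C. \<Sum>w\<in>D. F x y z w) = (\<Sum>z\<in>C. \<Sum>w\<in>D. \<Sum>x\<in>A. \<Sum>y\<in>B. F x y z w)"
  by (subst sum_swap3[symmetric]) (intro sum.cong refl sum_swap3[symmetric])

lemma two_Re_cnj_mult_le:
  fixes a b :: complex and \<theta> :: real
  shows "2 * \<theta> * Re (cnj a * b) \<le> (cmod a)\<^sup>2 + \<theta>\<^sup>2 * (cmod b)\<^sup>2"
proof -
  have "0 \<le> (Re a - \<theta> * Re b)\<^sup>2 + (Im a - \<theta> * Im b)\<^sup>2" by simp
  also have "\<dots> = (cmod a)\<^sup>2 + \<theta>\<^sup>2 * (cmod b)\<^sup>2 - 2 * \<theta> * Re (cnj a * b)"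
    unfolding cmod_power2 by (simp add: power2_eq_square algebra_simps)
  finally show ?thesis by simp
qed

lemma two_Re_sum_cnj_mult_le:
  fixes a b :: "'i \<Rightarrow> complex" and \<theta> :: real
  shows "2 * \<theta> * Re (\<Sum>i\<in>A. cnj (a i) * b i)
    \<le> (\<Sum>i\<in>A. cmod2 (a i)) + \<theta>\<^sup>2 * (\<Sum>i\<in>A. cmod2 (b i))"
proof -
  have "2 * \<theta> * Re (\<Sum>i\<in>A. cnj (a i) * b i) = (\<Sum>i\<in>A. 2 * \<theta> * Re (cnj (a i) * b i))"
    by (simp only: Re_sum sum_distrib_left)
  also have "\<dots> \<le> (\<Sum>i\<in>A. cmod2 (a i) + \<theta>\<^sup>2 * cmod2 (b i))"
    by (intro sum_mono two_Re_cnj_mult_le)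
  finally show ?thesis by (simp add: sum.distrib sum_distrib_left)
qed

text \<open>This is the estimate for one rank-one pair \<open>w |v><v|\<close> and
  \<open>c |v><v|\<close>. The cross term can be read either as a pairing of \<open>p\<close> with
  \<open>y\<close> applied to \<open>q\<close>, or as a pairing of \<open>y\<close> applied to
  \<open>p\<close> with \<open>q\<close>; each reading is controlled by one of the two squares on
  the right.\<close>

lemma rank_one_bound:
  fixes y :: "'l \<Rightarrow> 'i \<Rightarrow> complex" and p :: "'i \<Rightarrow> complex" and q :: "'l \<Rightarrow> complex"
    and c s w nv :: real
  assumes p: "(\<Sum>i\<in>A. cmod2 (p i)) = nv" and q: "(\<Sum>l\<in>B. cmod2 (q l)) = nv"
    and c: "0 \<le> c" and s: "0 \<le> s" and w: "0 \<le> w" and cw: "c = 0 \<Longrightarrow> w = 0"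
  shows "2 * w * Re (\<Sum>l\<in>B. \<Sum>i\<in>A. cnj (y l i) * cnj (p i) * q l)
    \<le> c * (\<Sum>i\<in>A. cmod2 (\<Sum>l\<in>B. cnj (y l i) * q l))
      + s * w * (\<Sum>l\<in>B. cmod2 (\<Sum>i\<in>A. y l i * p i)) + nv * (w\<^sup>2 / (c + s * w))"
proof (cases "c = 0")
  case True then show ?thesis using cw by simp
next
  case False
  then have pos: "c + s * w > 0" using c s w by (simp add: add_pos_nonneg)
  let ?Q = "(\<Sum>i\<in>A. cmod2 (\<Sum>l\<in>B. cnj (y l i) * q l))"
  let ?P = "(\<Sum>l\<in>B. cmod2 (\<Sum>i\<in>A. y l i * p i))"
  \<comment> \<open>With this value the shares \<open>c * \<theta>\<close> and
    \<open>s * w * \<theta>\<close> add up to \<open>w\<close>, so the two readings of the cross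
    term use it up exactly.\<close>
  define \<theta> where "\<theta> = w / (c + s * w)"
  have "w = \<theta> * (c + s * w)" using pos by (simp add: \<theta>_def)
  then have split: "w = c * \<theta> + s * w * \<theta>" by (simp add: algebra_simps)
  let ?r = "\<Sum>l\<in>B. \<Sum>i\<in>A. cnj (y l i) * cnj (p i) * q l"
  have r1: "?r = (\<Sum>i\<in>A. cnj (p i) * (\<Sum>l\<in>B. cnj (y l i) * q l))"
    by (subst sum.swap) (simp add: sum_distrib_left mult_ac)
  have r2: "?r = (\<Sum>l\<in>B. cnj (\<Sum>i\<in>A. y l i * p i) * q l)"
    by (simp add: sum_distrib_left sum_distrib_right mult_ac)
  have Rer1: "Re ?r = Re (\<Sum>i\<in>A. cnj (\<Sum>l\<in>B. cnj (y l i) * q l) * p i)"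
  proof -
    have "Re ?r = Re (cnj ?r)" by (rule cnj.simps(1)[symmetric])
    also have "cnj ?r = (\<Sum>i\<in>A. cnj (\<Sum>l\<in>B. cnj (y l i) * q l) * p i)"
      unfolding r1 by (simp add: mult.commute)
    finally show ?thesis .
  qed
  have b1: "2 * \<theta> * Re ?r \<le> ?Q + \<theta>\<^sup>2 * nv"
    unfolding Rer1 p[symmetric] by (rule two_Re_sum_cnj_mult_le)
  have b2: "2 * \<theta> * Re ?r \<le> ?P + \<theta>\<^sup>2 * nv"
    unfolding r2 q[symmetric] by (rule two_Re_sum_cnj_mult_le)
  have "2 * w * Re ?r = c * (2 * \<theta> * Re ?r) + s * w * (2 * \<theta> * Re ?r)"
  proof -
    have "2 * w * Re ?r = 2 * (c * \<theta> + s * w * \<theta>) * Re ?r" using split by simp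
    then show ?thesis by (simp add: algebra_simps)
  qed
  also have "\<dots> \<le> c * (?Q + \<theta>\<^sup>2 * nv)
     + s * w * (?P + \<theta>\<^sup>2 * nv)"
    by (intro add_mono mult_left_mono b1 b2 c mult_nonneg_nonneg s w)
  also have "\<dots> = c * ?Q
      + s * w * ?P + nv * (\<theta>\<^sup>2 * (c + s * w))"
    by (simp add: algebra_simps)
  also have "\<theta>\<^sup>2 * (c + s * w) = w\<^sup>2 / (c + s * w)"
    using pos by (simp add: \<theta>_def power2_eq_square)
  finally show ?thesis .
qed

text \<open>The hypothesis says that the operator \<open>\<Sum> w x |p x><p x|\<close> is diagonal
  in the coordinates \<open>A\<close>, so in the expanded square only the diagonal terms
  survive.\<close>

lemma sum_cmod_sq_expand:
  fixes w :: "'x \<Rightarrow> real" and p :: "'x \<Rightarrow> 'i \<Rightarrow> complex" and t :: "'i \<Rightarrow> real"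
  assumes A: "finite A"
    and h: "\<And>i i'. i \<in> A \<Longrightarrow> i' \<in> A \<Longrightarrow>
      (\<Sum>x\<in>I. of_real (w x) * p x i * cnj (p x i')) = (if i = i' then of_real (t i) else 0)"
  shows "(\<Sum>x\<in>I. w x * cmod2 (\<Sum>i\<in>A. y i * p x i)) = (\<Sum>i\<in>A. t i * cmod2 (y i))"
proof -
  have "complex_of_real (\<Sum>x\<in>I. w x * cmod2 (\<Sum>i\<in>A. y i * p x i))
    = (\<Sum>x\<in>I. of_real (w x) * ((\<Sum>i\<in>A. y i * p x i) * cnj (\<Sum>i\<in>A. y i * p x i)))"
    by (simp only: of_real_sum of_real_mult complex_norm_square)
  also have "\<dots> = (\<Sum>x\<in>I. \<Sum>i\<in>A. \<Sum>i'\<in>A. y i * cnj (y i') * (of_real (w x) * p x i * cnj (p x i')))"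
  proof (rule sum.cong[OF refl])
    fix x
    show "of_real (w x) * ((\<Sum>i\<in>A. y i * p x i) * cnj (\<Sum>i\<in>A. y i * p x i))
      = (\<Sum>i\<in>A. \<Sum>i'\<in>A. y i * cnj (y i') * (of_real (w x) * p x i * cnj (p x i')))"
      unfolding cnj_sum sum_product by (simp only: sum_distrib_left complex_cnj_mult mult_ac)
  qed
  also have "\<dots> = (\<Sum>i\<in>A. \<Sum>x\<in>I. \<Sum>i'\<in>A. y i * cnj (y i') * (of_real (w x) * p x i * cnj (p x i')))"
    by (rule sum.swap)
  also have "\<dots> = (\<Sum>i\<in>A. \<Sum>i'\<in>A. y i * cnj (y i') * (\<Sum>x\<in>I. of_real (w x) * p x i * cnj (p x i')))"
    by (rule sum.cong[OF refl], subst sum.swap) (simp add: sum_distrib_left)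
  also have "\<dots> = (\<Sum>i\<in>A. \<Sum>i'\<in>A. if i = i' then y i * cnj (y i') * of_real (t i) else 0)"
    by (intro sum.cong refl) (simp add: h)
  also have "\<dots> = (\<Sum>i\<in>A. y i * cnj (y i) * of_real (t i))"
    using A by (intro sum.cong refl) simp
  also have "\<dots> = complex_of_real (\<Sum>i\<in>A. t i * cmod2 (y i))"
    by (simp only: of_real_sum of_real_mult complex_norm_square mult_ac)
  finally show ?thesis by (simp only: of_real_eq_iff)
qed

lemma DERIV_ln_affine:
  fixes k s :: real
  assumes "0 < 1 + s * k"
  shows "((\<lambda>s. ln (1 + s * k)) has_real_derivative k / (1 + s * k)) (at s)"
  using assms by (auto intro!: derivative_eq_intros)

text \<open>Two operators \<open>\<tau> = \<Sum>\<^sub>x w\<^sub>x |v\<^sub>x\<rangle>\<langle>v\<^sub>x|\<close> and \<open>\<omega> = \<Sum>\<^sub>x c\<^sub>x |v\<^sub>x\<rangle>\<langle>v\<^sub>x|\<close> in coordinates: \<open>p x\<close> and \<open>q x\<close> are the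
  coordinates of \<open>v\<^sub>x\<close> in eigenbases of \<open>\<tau>\<close> (eigenvalues \<open>t\<close>) and \<open>\<omega>\<close> (eigenvalues \<open>b\<close>), \<open>nv x\<close> is the
  squared norm of \<open>v\<^sub>x\<close>, and \<open>M\<close> is the transition matrix between the eigenbases.\<close>

locale spectral_coordinates =
  fixes I :: "'x set" and A :: "'i set" and B :: "'l set"
    and w c \<kappa> nv :: "'x \<Rightarrow> real" and p :: "'x \<Rightarrow> 'i \<Rightarrow> complex" and q :: "'x \<Rightarrow> 'l \<Rightarrow> complex"
    and t :: "'i \<Rightarrow> real" and b :: "'l \<Rightarrow> real" and M :: "'l \<Rightarrow> 'i \<Rightarrow> complex"
  assumes I: "finite I" and A: "finite A" and B: "finite B"
    and c: "\<And>x. x \<in> I \<Longrightarrow> 0 \<le> c x" and \<kappa>: "\<And>x. x \<in> I \<Longrightarrow> 0 \<le> \<kappa> x"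
    and w: "\<And>x. x \<in> I \<Longrightarrow> w x = \<kappa> x * c x"
    and p: "\<And>x. x \<in> I \<Longrightarrow> (\<Sum>i\<in>A. cmod2 (p x i)) = nv x"
    and q: "\<And>x. x \<in> I \<Longrightarrow> (\<Sum>l\<in>B. cmod2 (q x l)) = nv x"
    and t: "\<And>i i'. i \<in> A \<Longrightarrow> i' \<in> A \<Longrightarrow>
      (\<Sum>x\<in>I. of_real (w x) * p x i * cnj (p x i')) = (if i = i' then of_real (t i) else 0)"
    and b: "\<And>l l'. l \<in> B \<Longrightarrow> l' \<in> B \<Longrightarrow>
      (\<Sum>x\<in>I. of_real (c x) * q x l * cnj (q x l')) = (if l = l' then of_real (b l) else 0)"
    and M: "\<And>l i. l \<in> B \<Longrightarrow> i \<in> A \<Longrightarrow>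
      (\<Sum>x\<in>I. of_real (w x) * cnj (p x i) * q x l) = of_real (t i) * M l i"
    and Mcol: "\<And>i. i \<in> A \<Longrightarrow> (\<Sum>l\<in>B. cmod2 (M l i)) = 1"
begin

lemma w_nonneg: "x \<in> I \<Longrightarrow> 0 \<le> w x"
  by (simp add: w c \<kappa>)

lemma t_eq: "i \<in> A \<Longrightarrow> t i = (\<Sum>x\<in>I. w x * cmod2 (p x i))"
  using sum_cmod_sq_expand[where A = "{i}" and I = I and w = w and p = p and t = t and y = "\<lambda>_. 1"] t by simp

lemma b_eq: "l \<in> B \<Longrightarrow> b l = (\<Sum>x\<in>I. c x * cmod2 (q x l))"
  using sum_cmod_sq_expand[where A = "{l}" and I = I and w = c and p = q and t = b and y = "\<lambda>_. 1"] b by simp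

lemma t_nonneg: "i \<in> A \<Longrightarrow> 0 \<le> t i"
  by (simp add: t_eq sum_nonneg w_nonneg)

lemma b_nonneg: "l \<in> B \<Longrightarrow> 0 \<le> b l"
  by (simp add: b_eq sum_nonneg c)

text \<open>Because \<open>w\<close> is a multiple of \<open>c\<close>, the kernel of \<omega> is
  contained in that of \<tau>. This and \<open>tM_zero\<close> are what make the quotients by
  \<open>b l\<close> below harmless: wherever the divisor vanishes, the weight does too.\<close>

lemma b_zero:
  assumes "l \<in> B" "b l = 0" "x \<in> I" shows "w x * cmod2 (q x l) = 0"
proof -
  have "(\<Sum>x\<in>I. c x * cmod2 (q x l)) = 0" using assms b_eq by simp
  then have "c x * cmod2 (q x l) = 0" using assms I c
    by (subst (asm) sum_nonneg_eq_0_iff) auto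
  then show ?thesis using w[OF assms(3)] by auto
qed

lemma tM_zero:
  assumes "l \<in> B" "b l = 0" "i \<in> A" shows "t i * cmod2 (M l i) = 0"
proof -
  have "(\<Sum>x\<in>I. of_real (w x) * cnj (p x i) * q x l) = 0"
    using b_zero[OF assms(1,2)] by (intro sum.neutral) auto
  then have "of_real (t i) * M l i = 0" using M assms by simp
  then show ?thesis by auto
qed

text \<open>The resolvent form of \<open>\<omega>\<close> and \<open>\<tau>\<close> is a supremum over operators \<open>y\<close> of functionals that
  are linear in the pair; the summands below are bounded separately at the maximiser.\<close>

lemma resolvent_bound:
  assumes s: "0 \<le> s"
  shows "(\<Sum>l\<in>B. \<Sum>i\<in>A. (t i)\<^sup>2 * cmod2 (M l i) / (b l + s * t i))
    \<le> (\<Sum>x\<in>I. nv x * ((w x)\<^sup>2 / (c x + s * w x)))"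
proof -
  \<comment> \<open>The stationary point of
    \<open>2 * Re (cnj y * (t i * M l i)) - (b l + s * t i) * |y|^2\<close>, taken separately for
    each pair \<open>l\<close>, \<open>i\<close>.\<close>
  define y where "y l i = (t i / (b l + s * t i)) *\<^sub>R M l i" for l i
  let ?Q = "\<lambda>x. (\<Sum>i\<in>A. cmod2 (\<Sum>l\<in>B. cnj (y l i) * q x l))"
  let ?P = "\<lambda>x. (\<Sum>l\<in>B. cmod2 (\<Sum>i\<in>A. y l i * p x i))"
  let ?r = "\<lambda>x. Re (\<Sum>l\<in>B. \<Sum>i\<in>A. cnj (y l i) * cnj (p x i) * q x l)"
  have R: "Re (\<Sum>l\<in>B. \<Sum>i\<in>A. cnj (y l i) * (of_real (t i) * M l i))
    = (\<Sum>x\<in>I. w x * ?r x)"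
  proof -
    have "(\<Sum>l\<in>B. \<Sum>i\<in>A. cnj (y l i) * (of_real (t i) * M l i))
      = (\<Sum>l\<in>B. \<Sum>i\<in>A. \<Sum>x\<in>I. of_real (w x) * (cnj (y l i) * cnj (p x i) * q x l))"
      by (intro sum.cong refl, subst M[symmetric]) (auto simp: sum_distrib_left mult_ac)
    also have "\<dots> = (\<Sum>x\<in>I. \<Sum>l\<in>B. \<Sum>i\<in>A. of_real (w x) * (cnj (y l i) * cnj (p x i) * q x l))"
      by (rule sum_swap3[symmetric])
    also have "\<dots> = (\<Sum>x\<in>I. of_real (w x) * (\<Sum>l\<in>B. \<Sum>i\<in>A. cnj (y l i) * cnj (p x i) * q x l))"
      by (simp add: sum_distrib_left)
    finally show ?thesis by (simp only: Re_sum Re_complex_of_real) (simp add: Re_sum)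
  qed
  have W: "(\<Sum>x\<in>I. w x * ?P x)
      = (\<Sum>l\<in>B. \<Sum>i\<in>A. t i * cmod2 (y l i))"
    by (subst sum_cmod_sq_expand[OF A t, symmetric]; (assumption | simp add: sum_distrib_left))
       (rule sum.swap)
  have C: "(\<Sum>x\<in>I. c x * ?Q x)
      = (\<Sum>i\<in>A. \<Sum>l\<in>B. b l * cmod2 (y l i))"
  proof -
    have "(\<Sum>l\<in>B. b l * cmod2 (y l i)) = (\<Sum>x\<in>I. c x * cmod2 (\<Sum>l\<in>B. cnj (y l i) * q x l))" for i
      using sum_cmod_sq_expand[OF B b, of "\<lambda>l. cnj (y l i)"] by simp
    then show ?thesis by (simp add: sum_distrib_left) (rule sum.swap)
  qed
  have summand: "(t i)\<^sup>2 * cmod2 (M l i) / (b l + s * t i)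
     = 2 * Re (cnj (y l i) * (of_real (t i) * M l i)) - b l * cmod2 (y l i) - s * (t i * cmod2 (y l i))"
    if l: "l \<in> B" and i: "i \<in> A" for l i
  proof (cases "b l = 0 \<or> b l + s * t i = 0")
    case True
    then have "b l = 0" using b_nonneg[OF l] t_nonneg[OF i] s by (auto simp: add_nonneg_eq_0_iff)
    then have "t i * cmod2 (M l i) = 0" using tM_zero l i by blast
    then show ?thesis by (auto simp: y_def)
  next
    case False
    define D where "D = b l + s * t i"
    have D: "D \<noteq> 0" using False by (simp add: D_def)
    have y: "y l i = of_real (t i / D) * M l i" by (simp add: y_def D_def scaleR_conv_of_real)
    have 1: "Re (cnj (y l i) * (of_real (t i) * M l i)) = (t i)\<^sup>2 / D * cmod2 (M l i)"
      unfolding y cmod_power2 using D by (simp add: power2_eq_square field_simps)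
    have 2: "cmod2 (y l i) = (t i / D)\<^sup>2 * cmod2 (M l i)"
      unfolding y by (simp add: norm_mult power_mult_distrib norm_divide power_divide)
    have "2 * ((t i)\<^sup>2 / D * cmod2 (M l i)) - b l * ((t i / D)\<^sup>2 * cmod2 (M l i))
        - s * (t i * ((t i / D)\<^sup>2 * cmod2 (M l i)))
      = 2 * ((t i)\<^sup>2 / D * cmod2 (M l i)) - D * ((t i / D)\<^sup>2 * cmod2 (M l i))"
      unfolding D_def by (simp add: algebra_simps)
    also have "\<dots> = (t i)\<^sup>2 * cmod2 (M l i) / D"
      using D by (simp add: power2_eq_square field_simps)
    finally show ?thesis unfolding 1 2 D_def[symmetric] by simp
  qed
  have "(\<Sum>l\<in>B. \<Sum>i\<in>A. (t i)\<^sup>2 * cmod2 (M l i) / (b l + s * t i))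
    = (\<Sum>l\<in>B. \<Sum>i\<in>A. 2 * Re (cnj (y l i) * (of_real (t i) * M l i)) - b l * cmod2 (y l i) - s * (t i * cmod2 (y l i)))"
    by (intro sum.cong refl summand)
  also have "\<dots> = 2 * Re (\<Sum>l\<in>B. \<Sum>i\<in>A. cnj (y l i) * (of_real (t i) * M l i))
     - (\<Sum>i\<in>A. \<Sum>l\<in>B. b l * cmod2 (y l i)) - s * (\<Sum>l\<in>B. \<Sum>i\<in>A. t i * cmod2 (y l i))"
    by (subst (2) sum.swap) (simp only: sum_subtractf Re_sum sum_distrib_left)
  also have "\<dots> = (\<Sum>x\<in>I. 2 * w x * ?r x
       - c x * ?Q x
       - s * w x * ?P x)"
    unfolding R W[symmetric] C[symmetric]
    by (simp only: sum_subtractf sum_distrib_left mult.assoc)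
  also have "\<dots> \<le> (\<Sum>x\<in>I. nv x * ((w x)\<^sup>2 / (c x + s * w x)))"
  proof (rule sum_mono)
    fix x assume x: "x \<in> I"
    show "2 * w x * ?r x
       - c x * ?Q x
       - s * w x * ?P x \<le> nv x * ((w x)\<^sup>2 / (c x + s * w x))"
      using rank_one_bound[OF p[OF x] q[OF x] c[OF x] s w_nonneg[OF x], of y] w[OF x] by simp
  qed
  finally show ?thesis .
qed

text \<open>Integral of \<open>resolvent_bound\<close> over \<open>s\<close> from 0 to
  \<open>T\<close>, phrased as monotonicity of the difference \<open>g\<close> of the two
  sides.\<close>

lemma log_bound:
  assumes T: "0 \<le> T"
  shows "(\<Sum>l\<in>B. \<Sum>i\<in>A. t i * cmod2 (M l i) * ln (1 + T * (t i / b l)))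
    \<le> (\<Sum>x\<in>I. nv x * w x * ln (1 + T * \<kappa> x))"
proof -
  define g where "g s = (\<Sum>x\<in>I. nv x * w x * ln (1 + s * \<kappa> x))
     - (\<Sum>l\<in>B. \<Sum>i\<in>A. t i * cmod2 (M l i) * ln (1 + s * (t i / b l)))" for s
  have "g 0 \<le> g T"
  proof (rule DERIV_nonneg_imp_nondecreasing[OF T])
    fix s :: real assume s: "0 \<le> s" "s \<le> T"
    have pos1: "0 < 1 + s * \<kappa> x" if "x \<in> I" for x
      using \<kappa>[OF that] s by (simp add: add_pos_nonneg)
    have pos2: "0 < 1 + s * (t i / b l)" if "i \<in> A" "l \<in> B" for i l
      using t_nonneg b_nonneg that s by (simp add: add_pos_nonneg)
    let ?D = "(\<Sum>x\<in>I. nv x * w x * (\<kappa> x / (1 + s * \<kappa> x)))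
        - (\<Sum>l\<in>B. \<Sum>i\<in>A. t i * cmod2 (M l i) * ((t i / b l) / (1 + s * (t i / b l))))"
    have "(g has_real_derivative ?D) (at s)"
      unfolding g_def
      by (intro DERIV_diff DERIV_sum DERIV_cmult DERIV_ln_affine pos1 pos2)
    moreover have "?D \<ge> 0"
    proof -
      have "(\<Sum>x\<in>I. nv x * w x * (\<kappa> x / (1 + s * \<kappa> x))) = (\<Sum>x\<in>I. nv x * ((w x)\<^sup>2 / (c x + s * w x)))"
      proof (rule sum.cong[OF refl])
        fix x assume x: "x \<in> I"
        have "w x * (\<kappa> x / (1 + s * \<kappa> x)) = (w x)\<^sup>2 / (c x + s * w x)"
        proof (cases "c x = 0")
          case False
          have e: "c x + s * w x = c x * (1 + s * \<kappa> x)" using w[OF x] by (simp add: algebra_simps)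
          show ?thesis unfolding e using False pos1[OF x] w[OF x] by (simp add: power2_eq_square)
        qed (simp add: w[OF x])
        then show "nv x * w x * (\<kappa> x / (1 + s * \<kappa> x)) = nv x * ((w x)\<^sup>2 / (c x + s * w x))"
          by (simp only: mult.assoc)
      qed
      moreover have "(\<Sum>l\<in>B. \<Sum>i\<in>A. t i * cmod2 (M l i) * ((t i / b l) / (1 + s * (t i / b l))))
        = (\<Sum>l\<in>B. \<Sum>i\<in>A. (t i)\<^sup>2 * cmod2 (M l i) / (b l + s * t i))"
      proof (intro sum.cong refl)
        fix l i assume l: "l \<in> B" and i: "i \<in> A"
        show "t i * cmod2 (M l i) * ((t i / b l) / (1 + s * (t i / b l)))
          = (t i)\<^sup>2 * cmod2 (M l i) / (b l + s * t i)"
        proof (cases "b l = 0")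
          case True
          then show ?thesis using tM_zero[OF l True i] by auto
        next
          case False
          then have "b l + s * t i = b l * (1 + s * (t i / b l))" by (simp add: algebra_simps)
          then show ?thesis by (simp add: power2_eq_square)
        qed
      qed
      ultimately show ?thesis using resolvent_bound[OF s(1)] by simp
    qed
    ultimately show "\<exists>y. (g has_real_derivative y) (at s) \<and> 0 \<le> y" by blast
  qed
  then show ?thesis by (simp add: g_def)
qed

lemma sum_t: "(\<Sum>i\<in>A. t i) = (\<Sum>x\<in>I. nv x * w x)"
proof -
  have "(\<Sum>i\<in>A. t i) = (\<Sum>i\<in>A. \<Sum>x\<in>I. w x * cmod2 (p x i))" by (simp add: t_eq)
  also have "\<dots> = (\<Sum>x\<in>I. \<Sum>i\<in>A. w x * cmod2 (p x i))" by (rule sum.swap)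
  also have "\<dots> = (\<Sum>x\<in>I. nv x * w x)"
    by (intro sum.cong refl) (simp add: sum_distrib_left[symmetric] p mult.commute)
  finally show ?thesis .
qed

text \<open>The left side is the relative entropy of \<tau> with respect to \<omega>. In
  \<open>log_bound\<close> one writes \<open>ln (1 + T * x)\<close> as
  \<open>ln T + ln (1 / T + x)\<close>; both sides carry the same total weight, the trace of \<tau>,
  so the terms \<open>ln T\<close> cancel and \<open>T\<close> can tend to infinity.\<close>

lemma relative_entropy_bound:
  "(\<Sum>l\<in>B. \<Sum>i\<in>A. t i * cmod2 (M l i) * (ln (t i) - ln (b l))) \<le> (\<Sum>x\<in>I. nv x * w x * ln (\<kappa> x))"
proof -
  let ?L = "\<Sum>l\<in>B. \<Sum>i\<in>A. t i * cmod2 (M l i) * (ln (t i) - ln (b l))"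
  have tr: "(\<Sum>l\<in>B. \<Sum>i\<in>A. t i * cmod2 (M l i)) = (\<Sum>x\<in>I. nv x * w x)"
    unfolding sum_t[symmetric]
    by (subst sum.swap) (simp add: sum_distrib_left[symmetric] Mcol)
  have bound: "?L \<le> (\<Sum>x\<in>I. nv x * w x * ln (inverse (real (Suc n)) + \<kappa> x))" for n
  proof -
    let ?T = "real (Suc n)"
    have "(\<Sum>l\<in>B. \<Sum>i\<in>A. t i * cmod2 (M l i) * (ln ?T + (ln (t i) - ln (b l))))
      \<le> (\<Sum>l\<in>B. \<Sum>i\<in>A. t i * cmod2 (M l i) * ln (1 + ?T * (t i / b l)))"
    proof (intro sum_mono)
      fix l i assume l: "l \<in> B" and i: "i \<in> A"
      show "t i * cmod2 (M l i) * (ln ?T + (ln (t i) - ln (b l)))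
          \<le> t i * cmod2 (M l i) * ln (1 + ?T * (t i / b l))"
      proof (cases "t i * cmod2 (M l i) = 0")
        case False
        then have "t i > 0" "b l > 0"
          using t_nonneg[OF i] b_nonneg[OF l] tM_zero[OF l _ i] by (auto simp: less_le)
        then have "ln ?T + (ln (t i) - ln (b l)) = ln (?T * (t i / b l))"
          by (simp add: ln_mult_pos ln_div)
        also have "\<dots> \<le> ln (1 + ?T * (t i / b l))"
          using \<open>t i > 0\<close> \<open>b l > 0\<close> by (subst ln_le_cancel_iff) (auto intro: add_pos_pos)
        finally show ?thesis using t_nonneg[OF i] by (intro mult_left_mono) auto
      qed (simp only: mult_zero_left order.refl)
    qed
    also have "\<dots> \<le> (\<Sum>x\<in>I. nv x * w x * ln (1 + ?T * \<kappa> x))" by (rule log_bound) simp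
    also have "\<dots> = (\<Sum>x\<in>I. nv x * w x * (ln ?T + ln (inverse ?T + \<kappa> x)))"
    proof (intro sum.cong refl)
      fix x assume x: "x \<in> I"
      have "1 + ?T * \<kappa> x = ?T * (inverse ?T + \<kappa> x)" by (simp add: field_simps)
      moreover have "ln (?T * (inverse ?T + \<kappa> x)) = ln ?T + ln (inverse ?T + \<kappa> x)"
        using \<kappa>[OF x] by (intro ln_mult_pos) (auto intro: add_pos_nonneg)
      ultimately show "nv x * w x * ln (1 + ?T * \<kappa> x) = nv x * w x * (ln ?T + ln (inverse ?T + \<kappa> x))"
        by simp
    qed
    finally have "ln ?T * (\<Sum>l\<in>B. \<Sum>i\<in>A. t i * cmod2 (M l i)) + ?L
      \<le> ln ?T * (\<Sum>x\<in>I. nv x * w x) + (\<Sum>x\<in>I. nv x * w x * ln (inverse ?T + \<kappa> x))"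
      by (simp only: ring_distribs sum.distrib sum_distrib_left mult.commute[of "ln ?T"] sum_subtractf)
    then show ?thesis unfolding tr by simp
  qed
  have "(\<lambda>n. \<Sum>x\<in>I. nv x * w x * ln (inverse (real (Suc n)) + \<kappa> x)) \<longlonglongrightarrow> (\<Sum>x\<in>I. nv x * w x * ln (\<kappa> x))"
  proof (rule tendsto_sum)
    fix x assume x: "x \<in> I"
    show "(\<lambda>n. nv x * w x * ln (inverse (real (Suc n)) + \<kappa> x)) \<longlonglongrightarrow> nv x * w x * ln (\<kappa> x)"
    \<comment> \<open>Where \<open>\<kappa> x\<close> vanishes, so does \<open>w x\<close>, and the
      diverging logarithm has weight zero.\<close>
    proof (cases "\<kappa> x = 0")
      case False
      have "(\<lambda>n. inverse (real (Suc n)) + \<kappa> x) \<longlonglongrightarrow> 0 + \<kappa> x"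
        by (intro tendsto_add LIMSEQ_inverse_real_of_nat tendsto_const)
      then show ?thesis using False by (intro tendsto_mult tendsto_const tendsto_ln) auto
    qed (simp add: w[OF x])
  qed
  then show ?thesis using bound by (intro LIMSEQ_le_const) auto
qed

end

section \<open>Spectral theorem for positive matrices\<close>

lemma mat_mult_entry:
  assumes "A \<in> carrier_mat n k" "B \<in> carrier_mat k m" "i < n" "j < m"
  shows "(A * B) $$ (i, j) = (\<Sum>l<k. A $$ (i, l) * B $$ (l, j))"
  using assms by (simp add: scalar_prod_def atLeast0LessThan)

text \<open>Vectors and matrices are plain functions of which only the values below \<open>n\<close>
  matter. This avoids carrier conditions, and vectors can be given by index formulas such as
  \<open>i * K + a\<close>.\<close>

definition ip :: "nat \<Rightarrow> (nat \<Rightarrow> complex) \<Rightarrow> (nat \<Rightarrow> complex) \<Rightarrow> complex" where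
  "ip n f g = (\<Sum>x<n. cnj (f x) * g x)"

definition mform :: "nat \<Rightarrow> (nat \<Rightarrow> nat \<Rightarrow> complex) \<Rightarrow> (nat \<Rightarrow> complex) \<Rightarrow> (nat \<Rightarrow> complex) \<Rightarrow> complex" where
  "mform n M f g = (\<Sum>x<n. \<Sum>y<n. cnj (f x) * M x y * g y)"

abbreviation (input) entry :: "complex mat \<Rightarrow> nat \<Rightarrow> nat \<Rightarrow> complex" where
  "entry A \<equiv> \<lambda>x y. A $$ (x, y)"

lemma psd_iff:
  "psd n A \<longleftrightarrow> A \<in> carrier_mat n n \<and> (\<forall>f. Im (mform n (entry A) f f) = 0 \<and> 0 \<le> Re (mform n (entry A) f f))"
proof -
  have q: "(\<Sum>i<n. cnj (v $ i) * (A *\<^sub>v v) $ i) = mform n (entry A) (\<lambda>i. v $ i) (\<lambda>i. v $ i)"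
    if "A \<in> carrier_mat n n" "v \<in> carrier_vec n" for v
    unfolding mform_def
  proof (rule sum.cong[OF refl])
    fix i assume "i \<in> {..<n}"
    then have "(A *\<^sub>v v) $ i = (\<Sum>j<n. A $$ (i, j) * v $ j)"
      using that by (simp add: scalar_prod_def atLeast0LessThan)
    then show "cnj (v $ i) * (A *\<^sub>v v) $ i = (\<Sum>j<n. cnj (v $ i) * A $$ (i, j) * v $ j)"
      by (simp only: sum_distrib_left mult.assoc)
  qed
  have qf: "mform n (entry A) (\<lambda>i. vec n f $ i) (\<lambda>i. vec n f $ i) = mform n (entry A) f f" for f
    unfolding mform_def by (intro sum.cong refl) simp
  show ?thesis
  proof (cases "A \<in> carrier_mat n n")
    case A: True
    show ?thesis
    proof
      assume h: "psd n A"
      have "Im (mform n (entry A) f f) = 0 \<and> 0 \<le> Re (mform n (entry A) f f)" for f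
        unfolding qf[of f, symmetric] q[OF A vec_carrier, symmetric]
        using h vec_carrier[of n f] unfolding psd_def by blast
      with A show "A \<in> carrier_mat n n \<and> (\<forall>f. Im (mform n (entry A) f f) = 0 \<and> 0 \<le> Re (mform n (entry A) f f))"
        by blast
    next
      assume h: "A \<in> carrier_mat n n \<and> (\<forall>f. Im (mform n (entry A) f f) = 0 \<and> 0 \<le> Re (mform n (entry A) f f))"
      then show "psd n A" unfolding psd_def using q[OF A] by simp
    qed
  qed (simp add: psd_def)
qed

lemma psd_carrier: "psd n A \<Longrightarrow> A \<in> carrier_mat n n"
  by (simp add: psd_def)

lemma quadratic_form_two_points:
  fixes h :: "nat \<Rightarrow> nat \<Rightarrow> complex" and z :: complex
  assumes "x < n" "y < n"
  defines "f \<equiv> \<lambda>k. (if k = x then 1 else 0) + z * (if k = y then 1 else 0)"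
  shows "(\<Sum>i<n. \<Sum>j<n. cnj (f i) * h i j * f j) = h x x + z * h x y + cnj z * h y x + cnj z * z * h y y"
proof -
  have d: "(\<Sum>j<n. g j * f j) = g x + z * g y" for g
  proof -
    have "(\<Sum>j<n. g j * f j) = (\<Sum>j<n. if j = x then g j else 0) + (\<Sum>j<n. if j = y then z * g j else 0)"
      unfolding sum.distrib[symmetric] by (intro sum.cong refl) (auto simp: f_def algebra_simps)
    then show ?thesis using assms by simp
  qed
  have d': "(\<Sum>j<n. cnj (f j) * g j) = g x + cnj z * g y" for g
  proof -
    have "cnj (\<Sum>j<n. cnj (g j) * f j) = cnj (cnj (g x) + z * cnj (g y))" unfolding d ..
    then show ?thesis by (simp add: mult.commute)
  qed
  have "(\<Sum>i<n. \<Sum>j<n. cnj (f i) * h i j * f j) = (\<Sum>i<n. cnj (f i) * (h i x + z * h i y))"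
    by (intro sum.cong refl, subst d) (simp add: algebra_simps)
  also have "\<dots> = h x x + z * h x y + cnj z * (h y x + z * h y y)"
    by (rule d')
  finally show ?thesis by (simp add: algebra_simps)
qed

text \<open>The skew part \<open>h\<close> has vanishing quadratic form because the form of
  \<open>A\<close> is real. Testing it on a basis vector plus 0, 1 or \<open>\<i>\<close> times
  another one isolates the entries of \<open>h\<close>.\<close>

lemma psd_hermitian:
  assumes "psd n A" "x < n" "y < n"
  shows "A $$ (y, x) = cnj (A $$ (x, y))"
proof -
  define h where "h i j = A $$ (i, j) - cnj (A $$ (j, i))" for i j
  have zero: "(\<Sum>i<n. \<Sum>j<n. cnj (f i) * h i j * f j) = 0" for f
  proof -
    let ?q = "\<Sum>i<n. \<Sum>j<n. cnj (f i) * A $$ (i, j) * f j"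
    have "(\<Sum>i<n. \<Sum>j<n. cnj (f i) * cnj (A $$ (j, i)) * f j) = cnj ?q"
      unfolding cnj_sum by (subst sum.swap) (simp add: mult_ac)
    then have "(\<Sum>i<n. \<Sum>j<n. cnj (f i) * h i j * f j) = ?q - cnj ?q"
      by (simp only: h_def right_diff_distrib left_diff_distrib sum_subtractf)
    moreover have "Im ?q = 0" using assms(1) unfolding psd_iff mform_def by blast
    moreover have "q - cnj q = 0" if "Im q = 0" for q using that by (simp add: complex_eq_iff)
    ultimately show ?thesis by (simp only:)
  qed
  note two = quadratic_form_two_points[OF assms(3) assms(2), of _ h, unfolded zero]
  have yy: "h y y = 0" using two[of 0] by simp
  have xx: "h x x = 0" using quadratic_form_two_points[OF assms(2) assms(3), of 0 h, unfolded zero] by simp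
  have "h y x + h x y = 0" "\<i> * h y x - \<i> * h x y = 0" using two[of 1] two[of \<i>] xx yy by simp_all
  then have "h y x = 0" by (simp add: algebra_simps)
  then show ?thesis by (simp add: h_def)
qed

lemma ctrace_mult_commute:
  assumes "A \<in> carrier_mat n k" "B \<in> carrier_mat k n"
  shows "ctrace (A * B) = ctrace (B * A)"
proof -
  have "ctrace (A * B) = (\<Sum>i<n. \<Sum>l<k. A $$ (i, l) * B $$ (l, i))"
    using assms by (simp add: ctrace_def scalar_prod_def atLeast0LessThan)
  also have "\<dots> = (\<Sum>l<k. \<Sum>i<n. B $$ (l, i) * A $$ (i, l))"
    by (subst sum.swap) (simp add: mult.commute)
  also have "\<dots> = ctrace (B * A)"
    using assms by (simp add: ctrace_def scalar_prod_def atLeast0LessThan)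
  finally show ?thesis .
qed

lemma ctrace_eq_sum_list_roots:
  fixes A :: "complex mat"
  assumes A: "A \<in> carrier_mat n n" and cp: "char_poly A = (\<Prod>a\<leftarrow>as. [:- a, 1:])"
  shows "ctrace A = sum_list as"
proof -
  obtain U P Q where S: "schur_decomposition A as = (U, P, Q)" by (cases "schur_decomposition A as")
  from schur_decomposition[OF A cp S] have wit: "similar_mat_wit A U P Q" and diag: "diag_mat U = as"
    by auto
  from similar_mat_witD2[OF A wit]
  have c: "U \<in> carrier_mat n n" "P \<in> carrier_mat n n" "Q \<in> carrier_mat n n"
    and QP: "Q * P = 1\<^sub>m n" and AU: "A = P * U * Q" by auto
  have "ctrace A = ctrace (Q * (P * U))" unfolding AU using c by (intro ctrace_mult_commute[of _ n n]) auto
  also have "Q * (P * U) = U" using c QP by (simp add: assoc_mult_mat[symmetric, of _ n n _ n _ n])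
  also have "ctrace U = sum_list (diag_mat U)"
    by (simp add: ctrace_def diag_mat_def sum_list_sum_nth atLeast0LessThan)
  finally show ?thesis using diag by simp
qed

text \<open>The length \<open>k\<close> is kept apart from the dimension \<open>n\<close> because
  eigenbases are built one vector at a time.\<close>

definition orthonormal_upto :: "nat \<Rightarrow> nat \<Rightarrow> (nat \<Rightarrow> nat \<Rightarrow> complex) \<Rightarrow> bool" where
  "orthonormal_upto n k e \<longleftrightarrow>
    (\<forall>i<k. \<forall>j<k. (\<Sum>x<n. cnj (e i x) * e j x) = (if i = j then 1 else 0))"

lemma orthonormal_uptoD:
  "orthonormal_upto n k e \<Longrightarrow> i < k \<Longrightarrow> j < k \<Longrightarrow>
    (\<Sum>x<n. cnj (e i x) * e j x) = (if i = j then 1 else 0)"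
  by (simp add: orthonormal_upto_def)

lemma hermitian_move:
  assumes "\<And>x y. x < n \<Longrightarrow> y < n \<Longrightarrow> A $$ (y, x) = cnj (A $$ (x, y))"
  shows "(\<Sum>x<n. cnj (u x) * (\<Sum>y<n. A $$ (x, y) * v y)) = (\<Sum>y<n. cnj (\<Sum>x<n. A $$ (y, x) * u x) * v y)"
proof -
  have "(\<Sum>x<n. cnj (u x) * (\<Sum>y<n. A $$ (x, y) * v y)) = (\<Sum>x<n. \<Sum>y<n. cnj (u x) * A $$ (x, y) * v y)"
    by (simp add: sum_distrib_left mult.assoc)
  also have "\<dots> = (\<Sum>y<n. \<Sum>x<n. cnj (u x) * A $$ (x, y) * v y)" by (rule sum.swap)
  also have "\<dots> = (\<Sum>y<n. cnj (\<Sum>x<n. A $$ (y, x) * u x) * v y)"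
  proof (intro sum.cong refl)
    fix y assume "y \<in> {..<n}"
    then have "cnj (A $$ (y, x)) = A $$ (x, y)" if "x < n" for x using assms[of x y] that by simp
    then show "(\<Sum>x<n. cnj (u x) * A $$ (x, y) * v y) = cnj (\<Sum>x<n. A $$ (y, x) * u x) * v y"
      unfolding cnj_sum sum_distrib_right by (intro sum.cong refl) (simp add: mult_ac)
  qed
  finally show ?thesis .
qed

text \<open>Shifting the eigenvalues of the known eigenvectors to a real number \<open>c\<close> that is
  incompatible with the trace forces an eigenvalue different from \<open>c\<close>, and its eigenvectors are
  orthogonal to the known ones.\<close>

lemma hermitian_next_eigenvector:
  fixes a :: "nat \<Rightarrow> real"
  assumes A: "A \<in> carrier_mat n n"
    and herm: "\<And>x y. x < n \<Longrightarrow> y < n \<Longrightarrow> A $$ (y, x) = cnj (A $$ (x, y))"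
    and k: "k < n" and on: "orthonormal_upto n k e"
    and ev: "\<And>i x. i < k \<Longrightarrow> x < n \<Longrightarrow> (\<Sum>y<n. A $$ (x, y) * e i y) = of_real (a i) * e i x"
  shows "\<exists>v (\<alpha> :: real). (\<Sum>x<n. cnj (v x) * v x) = 1 \<and>
    (\<forall>i<k. (\<Sum>x<n. cnj (e i x) * v x) = 0) \<and>
    (\<forall>x<n. (\<Sum>y<n. A $$ (x, y) * v y) = of_real \<alpha> * v x)"
proof -
  define S where "S = ctrace A - (\<Sum>i<k. of_real (a i))"
  \<comment> \<open>If \<open>c\<close> were the only eigenvalue of \<open>B\<close>, comparing
    traces would give \<open>S = (n - k) * c\<close>; the added 1 makes this impossible.\<close>
  define c where "c = Re S / real (n - k) + 1"
  define B where "B = mat n n (\<lambda>(x, y). A $$ (x, y) + (\<Sum>i<k. of_real (c - a i) * e i x * cnj (e i y)))"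
  have B: "B \<in> carrier_mat n n" by (simp add: B_def)
  have Bherm: "B $$ (y, x) = cnj (B $$ (x, y))" if "x < n" "y < n" for x y
    using that herm[OF that] by (simp add: B_def mult_ac)
  have Bv: "(\<Sum>y<n. B $$ (x, y) * v y) = (\<Sum>y<n. A $$ (x, y) * v y)
      + (\<Sum>i<k. of_real (c - a i) * e i x * (\<Sum>y<n. cnj (e i y) * v y))" if "x < n" for x v
  proof -
    have "(\<Sum>y<n. B $$ (x, y) * v y) = (\<Sum>y<n. A $$ (x, y) * v y)
      + (\<Sum>y<n. \<Sum>i<k. of_real (c - a i) * e i x * (cnj (e i y) * v y))"
      unfolding sum.distrib[symmetric]
      by (intro sum.cong refl) (use that in \<open>simp add: B_def ring_distribs sum_distrib_right mult.assoc\<close>)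
    also have "(\<Sum>y<n. \<Sum>i<k. of_real (c - a i) * e i x * (cnj (e i y) * v y))
      = (\<Sum>i<k. of_real (c - a i) * e i x * (\<Sum>y<n. cnj (e i y) * v y))"
      by (subst sum.swap) (simp add: sum_distrib_left)
    finally show ?thesis .
  qed
  have Be: "(\<Sum>y<n. B $$ (x, y) * e i y) = of_real c * e i x" if "x < n" "i < k" for x i
  proof -
    have "(\<Sum>j<k. of_real (c - a j) * e j x * (\<Sum>y<n. cnj (e j y) * e i y))
      = (\<Sum>j<k. if j = i then of_real (c - a j) * e j x else 0)"
      by (intro sum.cong refl) (use on that in \<open>simp add: orthonormal_upto_def\<close>)
    then show ?thesis unfolding Bv[OF that(1)] ev[OF that(2,1)] using that by (simp add: algebra_simps)
  qed
  have trB: "ctrace B = S + of_real (real k * c)"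
  proof -
    have "ctrace B = ctrace A + (\<Sum>x<n. \<Sum>i<k. of_real (c - a i) * (cnj (e i x) * e i x))"
      using A by (simp add: ctrace_def B_def sum.distrib mult_ac)
    also have "(\<Sum>x<n. \<Sum>i<k. of_real (c - a i) * (cnj (e i x) * e i x))
       = (\<Sum>i<k. of_real (c - a i) * (\<Sum>x<n. cnj (e i x) * e i x))"
      by (subst sum.swap) (simp add: sum_distrib_left)
    also have "\<dots> = (\<Sum>i<k. of_real (c - a i))"
      by (intro sum.cong refl) (use on in \<open>simp add: orthonormal_upto_def\<close>)
    finally show ?thesis by (simp add: S_def sum_subtractf)
  qed
  obtain as where cp: "char_poly B = (\<Prod>a\<leftarrow>as. [:- a, 1:])" and len: "length as = n"
    using char_poly_factorized[OF B] by blast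
  have "\<exists>z\<in>set as. z \<noteq> of_real c"
  proof (rule ccontr)
    assume "\<not> ?thesis"
    then have "as = replicate n (of_real c)" using len by (intro replicate_eqI) auto
    then have "ctrace B = of_real (real n * c)"
      using ctrace_eq_sum_list_roots[OF B cp] by (simp add: sum_list_replicate)
    with trB have "S = of_real (real (n - k) * c)"
      using k by (simp add: of_nat_diff algebra_simps)
    then have "Re S = real (n - k) * c" by simp
    moreover have "real (n - k) * c = Re S + real (n - k)" using k by (simp add: c_def distrib_left)
    ultimately show False using k by simp
  qed
  then obtain z where z: "z \<in> set as" "z \<noteq> of_real c" by blast
  have "poly (char_poly B) z = 0" unfolding cp using z(1) by (simp add: poly_prod_list prod_list_zero_iff image_iff)
  then have "eigenvalue B z" using eigenvalue_root_char_poly[OF B] by simp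
  then obtain vv where vv: "vv \<in> carrier_vec n" "vv \<noteq> 0\<^sub>v n" "B *\<^sub>v vv = z \<cdot>\<^sub>v vv"
    using B unfolding eigenvalue_def eigenvector_def by auto
  define v where "v x = vv $ x" for x
  have Bvz: "(\<Sum>y<n. B $$ (x, y) * v y) = z * v x" if "x < n" for x
  proof -
    have "(\<Sum>y<n. B $$ (x, y) * v y) = (B *\<^sub>v vv) $ x"
      using that B vv(1) by (simp add: scalar_prod_def atLeast0LessThan v_def)
    then show ?thesis using vv that by (simp add: v_def)
  qed
  define nn where "nn = (\<Sum>x<n. cmod2 (v x))"
  have nnc: "(\<Sum>x<n. cnj (v x) * v x) = of_real nn"
    unfolding nn_def of_real_sum complex_norm_square by (simp add: mult.commute)
  have nn: "nn > 0"
  proof -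
    obtain x where "x < n" "v x \<noteq> 0" using vv(1,2) by (auto simp: v_def vec_eq_iff)
    then show ?thesis unfolding nn_def by (intro sum_pos2[of _ x]) auto
  qed
  have zr: "z = cnj z"
  proof -
    have "(\<Sum>x<n. cnj (v x) * (\<Sum>y<n. B $$ (x, y) * v y)) = (\<Sum>x<n. cnj (v x) * (z * v x))"
      by (intro sum.cong refl) (simp add: Bvz)
    then have "(\<Sum>x<n. cnj (v x) * (\<Sum>y<n. B $$ (x, y) * v y)) = z * of_real nn"
      unfolding nnc[symmetric] by (simp add: sum_distrib_left mult_ac)
    moreover have "(\<Sum>y<n. cnj (\<Sum>x<n. B $$ (y, x) * v x) * v y) = cnj z * of_real nn"
    proof -
      have "(\<Sum>y<n. cnj (\<Sum>x<n. B $$ (y, x) * v x) * v y) = (\<Sum>y<n. cnj (z * v y) * v y)"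
        by (intro sum.cong refl) (simp only: Bvz lessThan_iff)
      then show ?thesis unfolding nnc[symmetric] by (simp add: sum_distrib_left mult_ac)
    qed
    ultimately show ?thesis using hermitian_move[OF Bherm, of n v v] nn by simp
  qed
  have orth: "(\<Sum>x<n. cnj (e i x) * v x) = 0" if "i < k" for i
  proof -
    have "(\<Sum>x<n. cnj (e i x) * (\<Sum>y<n. B $$ (x, y) * v y)) = (\<Sum>x<n. cnj (e i x) * (z * v x))"
      by (intro sum.cong refl) (simp add: Bvz)
    then have "(\<Sum>x<n. cnj (e i x) * (\<Sum>y<n. B $$ (x, y) * v y)) = z * (\<Sum>x<n. cnj (e i x) * v x)"
      by (simp add: sum_distrib_left mult_ac)
    moreover have "(\<Sum>y<n. cnj (\<Sum>x<n. B $$ (y, x) * e i x) * v y) = of_real c * (\<Sum>x<n. cnj (e i x) * v x)"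
    proof -
      have "(\<Sum>y<n. cnj (\<Sum>x<n. B $$ (y, x) * e i x) * v y) = (\<Sum>y<n. cnj (of_real c * e i y) * v y)"
        by (intro sum.cong refl) (simp only: Be that lessThan_iff)
      then show ?thesis by (simp add: sum_distrib_left mult_ac)
    qed
    ultimately have "z * (\<Sum>x<n. cnj (e i x) * v x) = of_real c * (\<Sum>x<n. cnj (e i x) * v x)"
      using hermitian_move[OF Bherm, of n "e i" v] by simp
    then show ?thesis using z(2) by simp
  qed
  have Av: "(\<Sum>y<n. A $$ (x, y) * v y) = of_real (Re z) * v x" if "x < n" for x
  proof -
    have "z = of_real (Re z)" using zr by (auto simp: complex_eq_iff)
    then show ?thesis using Bv[OF that, of v] orth Bvz[OF that] by simp
  qed
  define u where "u x = of_real (1 / sqrt nn) * v x" for x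
  show ?thesis
  proof (intro exI[of _ u] exI[of _ "Re z"] conjI allI impI)
    have "(\<Sum>x<n. cnj (u x) * u x) = of_real (1 / sqrt nn) * of_real (1 / sqrt nn) * (\<Sum>x<n. cnj (v x) * v x)"
      unfolding u_def sum_distrib_left by (intro sum.cong refl) (simp add: mult_ac)
    also have "\<dots> = of_real (1 / sqrt nn * (1 / sqrt nn) * nn)" unfolding nnc of_real_mult ..
    also have "1 / sqrt nn * (1 / sqrt nn) * nn = 1" using nn by (simp add: field_simps)
    finally show "(\<Sum>x<n. cnj (u x) * u x) = 1" by simp
  next
    fix i assume i: "i < k"
    have "(\<Sum>x<n. cnj (e i x) * u x) = of_real (1 / sqrt nn) * (\<Sum>x<n. cnj (e i x) * v x)"
      unfolding u_def sum_distrib_left by (simp add: mult_ac)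
    then show "(\<Sum>x<n. cnj (e i x) * u x) = 0" using orth[OF i] by simp
  next
    fix x assume x: "x < n"
    have "(\<Sum>y<n. A $$ (x, y) * u y) = of_real (1 / sqrt nn) * (\<Sum>y<n. A $$ (x, y) * v y)"
      unfolding u_def sum_distrib_left by (simp add: mult_ac)
    then show "(\<Sum>y<n. A $$ (x, y) * u y) = of_real (Re z) * u x" using Av[OF x] by (simp add: u_def)
  qed
qed

lemma hermitian_orthonormal_eigenvectors:
  assumes A: "A \<in> carrier_mat n n"
    and herm: "\<And>x y. x < n \<Longrightarrow> y < n \<Longrightarrow> A $$ (y, x) = cnj (A $$ (x, y))"
    and "k \<le> n"
  shows "\<exists>e (a :: nat \<Rightarrow> real). orthonormal_upto n k e \<and>
    (\<forall>i<k. \<forall>x<n. (\<Sum>y<n. A $$ (x, y) * e i y) = of_real (a i) * e i x)"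
  using \<open>k \<le> n\<close>
proof (induction k)
  case 0 show ?case by (simp add: orthonormal_upto_def)
next
  case (Suc k)
  then obtain e and a :: "nat \<Rightarrow> real" where on: "orthonormal_upto n k e"
    and ev: "\<And>i x. i < k \<Longrightarrow> x < n \<Longrightarrow> (\<Sum>y<n. A $$ (x, y) * e i y) = of_real (a i) * e i x" by auto
  have "k < n" using Suc by simp
  obtain v and \<alpha> :: real where v: "(\<Sum>x<n. cnj (v x) * v x) = 1"
    and vo: "\<And>i. i < k \<Longrightarrow> (\<Sum>x<n. cnj (e i x) * v x) = 0"
    and vev: "\<And>x. x < n \<Longrightarrow> (\<Sum>y<n. A $$ (x, y) * v y) = of_real \<alpha> * v x"
    using hermitian_next_eigenvector[OF A herm \<open>k < n\<close> on ev] by blast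
  have vo': "(\<Sum>x<n. cnj (v x) * e i x) = 0" if "i < k" for i
  proof -
    have "(\<Sum>x<n. cnj (v x) * e i x) = cnj (\<Sum>x<n. cnj (e i x) * v x)" by (simp add: mult.commute)
    then show ?thesis using vo[OF that] by simp
  qed
  have "orthonormal_upto n (Suc k) (e(k := v))"
    unfolding orthonormal_upto_def less_Suc_eq
    using on v vo vo' by (auto simp: orthonormal_upto_def)
  moreover have "\<forall>i<Suc k. \<forall>x<n. (\<Sum>y<n. A $$ (x, y) * (e(k := v)) i y) = of_real ((a(k := \<alpha>)) i) * (e(k := v)) i x"
    unfolding less_Suc_eq using ev vev by auto
  ultimately show ?case by blast
qed

lemma orthonormal_complete:
  assumes "orthonormal_upto n n e" "x < n" "y < n"
  shows "(\<Sum>i<n. e i x * cnj (e i y)) = (if x = y then 1 else 0)"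
proof -
  define E where "E = mat n n (\<lambda>(x, i). e i x)"
  define F where "F = mat n n (\<lambda>(i, x). cnj (e i x))"
  have EF: "E \<in> carrier_mat n n" "F \<in> carrier_mat n n" by (auto simp: E_def F_def)
  have "F * E = 1\<^sub>m n"
    using assms(1) by (intro eq_matI)
      (auto simp: E_def F_def scalar_prod_def atLeast0LessThan orthonormal_upto_def)
  then have "E * F = 1\<^sub>m n" using mat_mult_left_right_inverse[OF EF(2,1)] by simp
  then have "(E * F) $$ (x, y) = (if x = y then 1 else 0)" using assms by simp
  then show ?thesis using assms by (simp add: E_def F_def scalar_prod_def atLeast0LessThan)
qed

section \<open>Von Neumann entropy through eigenvalues\<close>

lemma order_prod_list_linear:
  "Polynomial.order z (\<Prod>a\<leftarrow>as. [:- a, 1:]) = count_list as (z::complex)"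
proof (induction as)
  case (Cons a as)
  have nz: "(\<Prod>a\<leftarrow>as. [:- a, 1:]) \<noteq> 0" by (auto simp: prod_list_zero_iff)
  have "Polynomial.order z [:- a, 1:] = (if a = z then 1 else 0)"
    using order_power_n_n[of z 1] by (auto simp: order_0I)
  then show ?case using Cons nz by (simp add: order_mult del: mult_pCons_left mult_pCons_right)
qed simp

lemma sum_count_list_real:
  "(\<Sum>z\<in>set as. real (count_list as z) * f z) = (\<Sum>a\<leftarrow>as. f a)"
proof (induction as)
  case (Cons a as)
  have "(\<Sum>z\<in>set (a # as). real (count_list (a # as) z) * f z)
    = (\<Sum>z\<in>set (a # as). if z = a then f z else 0) + (\<Sum>z\<in>set (a # as). real (count_list as z) * f z)"
    unfolding sum.distrib[symmetric] by (intro sum.cong refl) (auto simp: algebra_simps)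
  also have "(\<Sum>z\<in>set (a # as). real (count_list as z) * f z) = (\<Sum>z\<in>set as. real (count_list as z) * f z)"
    by (rule sum.mono_neutral_right) (auto simp: count_list_0_iff)
  finally show ?case using Cons by simp
qed simp

lemma vn_entropy_char_poly:
  assumes "char_poly A = (\<Prod>a\<leftarrow>as. [:- a, 1:])"
  shows "vn_entropy A = - (\<Sum>a\<leftarrow>as. eta (Re a))"
proof -
  have roots: "{z. poly (char_poly A) z = 0} = set as"
    unfolding assms by (auto simp: poly_prod_list prod_list_zero_iff image_iff)
  show ?thesis
    unfolding vn_entropy_def roots unfolding assms order_prod_list_linear
    using sum_count_list_real by simp
qed

text \<open>The matrix of eigenvectors is invertible and conjugates \<open>A\<close> to a diagonal
  matrix, which has the same characteristic polynomial. Hence the entropy, defined by roots with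
  multiplicity, can be read off any orthonormal eigendecomposition.\<close>

lemma vn_entropy_spectral:
  fixes a :: "nat \<Rightarrow> real"
  assumes A: "A \<in> carrier_mat n n" and on: "orthonormal_upto n n e"
    and sp: "\<And>x y. x < n \<Longrightarrow> y < n \<Longrightarrow> A $$ (x, y) = (\<Sum>i<n. of_real (a i) * e i x * cnj (e i y))"
  shows "vn_entropy A = - (\<Sum>i<n. eta (a i))"
proof -
  define E where "E = mat n n (\<lambda>(x, i). e i x)"
  define F where "F = mat n n (\<lambda>(i, x). cnj (e i x))"
  define D where "D = mat n n (\<lambda>(i, j). if i = j then complex_of_real (a i) else 0)"
  have c: "E \<in> carrier_mat n n" "F \<in> carrier_mat n n" "D \<in> carrier_mat n n" by (auto simp: E_def F_def D_def)
  have FE: "F * E = 1\<^sub>m n"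
    using on by (intro eq_matI)
      (auto simp: E_def F_def scalar_prod_def atLeast0LessThan orthonormal_upto_def)
  then have EF: "E * F = 1\<^sub>m n" using mat_mult_left_right_inverse[OF c(2,1)] by simp
  have ED: "(E * D) $$ (x, i) = of_real (a i) * e i x" if "x < n" "i < n" for x i
  proof -
    have "(E * D) $$ (x, i) = (\<Sum>l<n. if l = i then of_real (a i) * e i x else 0)"
      unfolding mat_mult_entry[OF c(1,3) that]
      by (intro sum.cong refl) (use that in \<open>auto simp: E_def D_def\<close>)
    then show ?thesis using that by simp
  qed
  have "A = E * D * F"
  proof (rule eq_matI)
    fix x y assume "x < dim_row (E * D * F)" "y < dim_col (E * D * F)"
    then have xy: "x < n" "y < n" using c by auto
    show "A $$ (x, y) = (E * D * F) $$ (x, y)"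
      unfolding sp[OF xy] mat_mult_entry[OF mult_carrier_mat[OF c(1,3)] c(2) xy]
      by (intro sum.cong refl) (use xy in \<open>simp add: ED F_def\<close>)
  qed (use A c in auto)
  then have "similar_mat A D"
    unfolding similar_mat_def using A c EF FE
    by (intro exI[of _ E] exI[of _ F] similar_mat_witI[of _ _ n]) auto
  then have "char_poly A = char_poly D" by (rule char_poly_similar)
  also have "\<dots> = (\<Prod>a\<leftarrow>diag_mat D. [:- a, 1:])"
    by (rule char_poly_upper_triangular[OF c(3)]) (auto simp: D_def)
  finally have "vn_entropy A = - (\<Sum>z\<leftarrow>diag_mat D. eta (Re z))" by (rule vn_entropy_char_poly)
  also have "(\<Sum>z\<leftarrow>diag_mat D. eta (Re z)) = (\<Sum>i<n. eta (a i))"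
    by (simp add: diag_mat_def sum_list_sum_nth atLeast0LessThan D_def)
  finally show ?thesis .
qed

lemma psd_spectral:
  assumes psd: "psd n A"
  obtains e and a :: "nat \<Rightarrow> real" where "orthonormal_upto n n e" "\<And>i. i < n \<Longrightarrow> 0 \<le> a i"
    "\<And>x y. x < n \<Longrightarrow> y < n \<Longrightarrow> A $$ (x, y) = (\<Sum>i<n. of_real (a i) * e i x * cnj (e i y))"
    "vn_entropy A = - (\<Sum>i<n. eta (a i))"
proof -
  note A = psd_carrier[OF psd]
  obtain e and a :: "nat \<Rightarrow> real" where on: "orthonormal_upto n n e"
    and ev: "\<And>i x. i < n \<Longrightarrow> x < n \<Longrightarrow> (\<Sum>y<n. A $$ (x, y) * e i y) = of_real (a i) * e i x"
    using hermitian_orthonormal_eigenvectors[OF A psd_hermitian[OF psd] order.refl] by blast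
  have pos: "0 \<le> a i" if i: "i < n" for i
  proof -
    have "(\<Sum>x<n. \<Sum>y<n. cnj (e i x) * A $$ (x, y) * e i y) = (\<Sum>x<n. of_real (a i) * (cnj (e i x) * e i x))"
      by (intro sum.cong refl) (simp add: mult.assoc sum_distrib_left[symmetric] ev i)
    also have "\<dots> = of_real (a i)"
      unfolding sum_distrib_left[symmetric] using orthonormal_uptoD[OF on i i] by simp
    finally have "(\<Sum>x<n. \<Sum>y<n. cnj (e i x) * A $$ (x, y) * e i y) = of_real (a i)" .
    moreover have "0 \<le> Re (\<Sum>x<n. \<Sum>y<n. cnj (e i x) * A $$ (x, y) * e i y)"
      using psd unfolding psd_iff mform_def by blast
    ultimately show ?thesis by simp
  qed
  have sp: "A $$ (x, y) = (\<Sum>i<n. of_real (a i) * e i x * cnj (e i y))" if xy: "x < n" "y < n" for x y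
  proof -
    have "(\<Sum>i<n. of_real (a i) * e i x * cnj (e i y)) = (\<Sum>i<n. \<Sum>z<n. A $$ (x, z) * (e i z * cnj (e i y)))"
      by (intro sum.cong refl) (simp add: ev[symmetric] xy sum_distrib_right mult.assoc)
    also have "\<dots> = (\<Sum>z<n. A $$ (x, z) * (\<Sum>i<n. e i z * cnj (e i y)))"
      by (subst sum.swap) (simp add: sum_distrib_left)
    also have "\<dots> = (\<Sum>z<n. if z = y then A $$ (x, z) else 0)"
      by (intro sum.cong refl) (simp add: orthonormal_complete[OF on] xy)
    finally show ?thesis using xy by simp
  qed
  from that[OF on pos sp vn_entropy_spectral[OF A on sp]] show ?thesis by blast
qed

section \<open>Sesquilinear forms and Klein's inequality\<close>

definition spec :: "nat \<Rightarrow> (nat \<Rightarrow> nat \<Rightarrow> complex) \<Rightarrow> (nat \<Rightarrow> nat \<Rightarrow> complex) \<Rightarrow> (nat \<Rightarrow> real) \<Rightarrow> bool" where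
  "spec n M e a \<longleftrightarrow> orthonormal_upto n n e \<and>
    (\<forall>x<n. \<forall>y<n. M x y = (\<Sum>i<n. of_real (a i) * e i x * cnj (e i y)))"

definition ent :: "nat \<Rightarrow> (nat \<Rightarrow> nat \<Rightarrow> complex) \<Rightarrow> real" where
  "ent n M = vn_entropy (mat n n (\<lambda>(x, y). M x y))"

lemma cnj_ip: "cnj (ip n f g) = ip n g f"
  by (simp add: ip_def mult.commute)

lemma cmod_ip_commute: "cmod (ip n f g) = cmod (ip n g f)"
  unfolding cnj_ip[symmetric, of n g f] by simp

lemma ip_self: "ip n f f = of_real (\<Sum>x<n. cmod2 (f x))"
  unfolding ip_def of_real_sum complex_norm_square by (simp add: mult.commute)

lemma ip_sum_right: "ip n f (\<lambda>x. \<Sum>i\<in>I. c i * h i x) = (\<Sum>i\<in>I. c i * ip n f (h i))"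
  unfolding ip_def sum_distrib_left by (subst sum.swap) (simp add: mult_ac)

lemma orthonormal_ip:
  "orthonormal_upto n k e \<Longrightarrow> i < k \<Longrightarrow> j < k \<Longrightarrow> ip n (e i) (e j) = (if i = j then 1 else 0)"
  unfolding ip_def by (rule orthonormal_uptoD)

lemma mform_rank_one_sum:
  assumes "\<And>x y. x < n \<Longrightarrow> y < n \<Longrightarrow> M x y = (\<Sum>z\<in>I. c z * V z x * cnj (V z y))"
  shows "mform n M f g = (\<Sum>z\<in>I. c z * ip n f (V z) * cnj (ip n g (V z)))"
proof -
  let ?t = "\<lambda>z x y. c z * ((cnj (f x) * V z x) * (g y * cnj (V z y)))"
  have "mform n M f g = (\<Sum>x<n. \<Sum>y<n. \<Sum>z\<in>I. ?t z x y)"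
    unfolding mform_def
    by (intro sum.cong refl) (simp add: assms sum_distrib_left sum_distrib_right mult_ac)
  also have "\<dots> = (\<Sum>z\<in>I. \<Sum>x<n. \<Sum>y<n. ?t z x y)"
    by (rule sum_swap3[symmetric])
  also have "\<dots> = (\<Sum>z\<in>I. c z * (ip n f (V z) * cnj (ip n g (V z))))"
    unfolding ip_def cnj_sum sum_product by (simp add: sum_distrib_left mult_ac)
  finally show ?thesis by (simp add: mult.assoc)
qed

lemma mform_add: "mform n (\<lambda>x y. M x y + M' x y) f g = mform n M f g + mform n M' f g"
  by (simp add: mform_def ring_distribs sum.distrib)

lemma mform_scale: "mform n (\<lambda>x y. c * M x y) f g = c * mform n M f g"
  by (simp add: mform_def sum_distrib_left mult_ac)

lemma mform_cong: "(\<And>x y. x < n \<Longrightarrow> y < n \<Longrightarrow> M x y = M' x y) \<Longrightarrow> mform n M f g = mform n M' f g"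
  unfolding mform_def by (intro sum.cong refl) simp

lemma spec_onb: "spec n M e a \<Longrightarrow> orthonormal_upto n n e"
  by (simp add: spec_def)

lemma spec_form:
  "spec n M e a \<Longrightarrow> mform n M f g = (\<Sum>i<n. of_real (a i) * ip n f (e i) * cnj (ip n g (e i)))"
  by (rule mform_rank_one_sum) (simp add: spec_def)

lemma spec_diag:
  assumes s: "spec n M e a" and "i < n" "j < n"
  shows "mform n M (e i) (e j) = (if i = j then of_real (a i) else 0)"
proof -
  have "mform n M (e i) (e j) = (\<Sum>l<n. if l = i then (if i = j then of_real (a i) else 0) else 0)"
    unfolding spec_form[OF s]
    by (intro sum.cong refl) (use assms spec_onb[OF s] in \<open>auto simp: orthonormal_ip\<close>)
  then show ?thesis using assms by simp
qed

lemma parseval: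
  assumes "orthonormal_upto n n e"
  shows "ip n f g = (\<Sum>i<n. ip n f (e i) * cnj (ip n g (e i)))"
proof -
  have "mform n (\<lambda>x y. if x = y then 1 else 0) f g = (\<Sum>i<n. 1 * ip n f (e i) * cnj (ip n g (e i)))"
    by (rule mform_rank_one_sum) (simp add: orthonormal_complete[OF assms])
  moreover have "mform n (\<lambda>x y. if x = y then 1 else 0) f g = ip n f g"
    unfolding mform_def ip_def
    by (intro sum.cong refl) (simp add: if_distrib[of "\<lambda>c. _ * c"] if_distrib[of "\<lambda>c. c * _"] cong: if_cong)
  ultimately show ?thesis by simp
qed

lemma parseval_norm:
  assumes "orthonormal_upto n n e"
  shows "(\<Sum>i<n. cmod2 (ip n (e i) f)) = (\<Sum>x<n. cmod2 (f x))"
proof -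
  have "complex_of_real (\<Sum>x<n. cmod2 (f x)) = (\<Sum>i<n. ip n f (e i) * cnj (ip n f (e i)))"
    unfolding ip_self[symmetric] by (rule parseval[OF assms])
  also have "\<dots> = complex_of_real (\<Sum>i<n. cmod2 (ip n (e i) f))"
    unfolding of_real_sum by (subst cmod_ip_commute) (simp only: complex_norm_square)
  finally show ?thesis by (simp only: of_real_eq_iff)
qed

lemma orthonormal_norm:
  "orthonormal_upto n n e \<Longrightarrow> i < n \<Longrightarrow> (\<Sum>x<n. cmod2 (e i x)) = 1"
  using ip_self[of n "e i"] orthonormal_ip[of n n e i i] by (simp flip: of_real_power of_real_sum)

lemma trace_onb:
  assumes "orthonormal_upto n n e"
  shows "(\<Sum>l<n. mform n M (e l) (e l)) = (\<Sum>x<n. M x x)"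
proof -
  have "(\<Sum>l<n. mform n M (e l) (e l)) = (\<Sum>l<n. \<Sum>x<n. \<Sum>y<n. M x y * (e l y * cnj (e l x)))"
    unfolding mform_def by (simp add: mult_ac)
  also have "\<dots> = (\<Sum>x<n. \<Sum>l<n. \<Sum>y<n. M x y * (e l y * cnj (e l x)))"
    by (rule sum.swap)
  also have "\<dots> = (\<Sum>x<n. \<Sum>y<n. M x y * (\<Sum>l<n. e l y * cnj (e l x)))"
    by (rule sum.cong[OF refl], subst sum.swap) (simp add: sum_distrib_left)
  also have "\<dots> = (\<Sum>x<n. \<Sum>y<n. if y = x then M x y else 0)"
    by (intro sum.cong refl) (simp add: orthonormal_complete[OF assms])
  finally show ?thesis by simp
qed

lemma spec_trace:
  assumes "spec n M e a"
  shows "of_real (\<Sum>i<n. a i) = (\<Sum>x<n. M x x)"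
  using trace_onb[OF spec_onb[OF assms], of M] spec_diag[OF assms] by simp

lemma ent_spec: "spec n M e a \<Longrightarrow> ent n M = - (\<Sum>i<n. eta (a i))"
  unfolding ent_def spec_def by (rule vn_entropy_spectral[where e = e]) auto

lemma ex_spec:
  assumes "\<And>f. Im (mform n M f f) = 0" "\<And>f. 0 \<le> Re (mform n M f f)"
  shows "\<exists>e a. spec n M e a \<and> (\<forall>i<n. 0 \<le> a i)"
proof -
  have "psd n (mat n n (\<lambda>(x, y). M x y))"
    unfolding psd_iff using assms by (simp add: mform_def)
  then obtain e and a :: "nat \<Rightarrow> real" where "orthonormal_upto n n e" "\<And>i. i < n \<Longrightarrow> 0 \<le> a i"
    "\<And>x y. x < n \<Longrightarrow> y < n \<Longrightarrow>
      mat n n (\<lambda>(x, y). M x y) $$ (x, y) = (\<Sum>i<n. of_real (a i) * e i x * cnj (e i y))"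
    by (rule psd_spectral) blast
  then have "spec n M e a \<and> (\<forall>i<n. 0 \<le> a i)" by (simp add: spec_def)
  then show ?thesis by blast
qed

lemma spec_form_re:
  assumes "spec n M e a"
  shows "mform n M f f = of_real (\<Sum>i<n. a i * cmod2 (ip n (e i) f))"
proof -
  have "mform n M f f = (\<Sum>i<n. of_real (a i) * (ip n f (e i) * cnj (ip n f (e i))))"
    unfolding spec_form[OF assms] by (simp add: mult.assoc)
  also have "\<dots> = of_real (\<Sum>i<n. a i * cmod2 (ip n (e i) f))"
    unfolding of_real_sum of_real_mult
    by (subst cmod_ip_commute) (simp only: complex_norm_square)
  finally show ?thesis .
qed

lemma eta_eq: "0 \<le> x \<Longrightarrow> eta x = x * ln x"
  by (cases "x = 0") (auto simp: eta_def)

lemma klein_scalar: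
  assumes "0 \<le> a" "0 < (b::real)"
  shows "a - b \<le> eta a - a * ln b"
proof (cases "a = 0")
  case False
  then have "0 < a" using assms by simp
  then have "ln (b / a) \<le> b / a - 1" using assms by (intro ln_le_minus_one) simp
  then have "a * (ln b - ln a) \<le> a * (b / a - 1)" using \<open>0 < a\<close> assms by (simp add: ln_div)
  then show ?thesis using \<open>0 < a\<close> by (simp add: eta_eq algebra_simps)
qed (use assms in \<open>simp add: eta_def\<close>)

text \<open>Klein's inequality for \<open>M1\<close> and the operator with eigenbasis
  \<open>g\<close> and eigenvalues \<open>b\<close>. The squared overlaps of the two eigenbases form
  a doubly stochastic array, so the claim is an average of the scalar inequality.\<close>

lemma klein:
  assumes s1: "spec n M1 e a" and a: "\<And>i. i < n \<Longrightarrow> 0 \<le> a i"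
    and g: "orthonormal_upto n n g" and b: "\<And>l. l < n \<Longrightarrow> 0 < b l"
  shows "ent n M1 \<le> - (\<Sum>l<n. Re (mform n M1 (g l) (g l)) * ln (b l)) - (\<Sum>i<n. a i) + (\<Sum>l<n. b l)"
proof -
  define m where "m i l = cmod2 (ip n (e i) (g l))" for i l
  have c1: "(\<Sum>i<n. m i l) = 1" if "l < n" for l
    unfolding m_def parseval_norm[OF spec_onb[OF s1]] using orthonormal_norm[OF g that] .
  have c2: "(\<Sum>l<n. m i l) = 1" if "i < n" for i
    unfolding m_def cmod_ip_commute[of n "e i"] parseval_norm[OF g]
    using orthonormal_norm[OF spec_onb[OF s1] that] .
  have f: "Re (mform n M1 (g l) (g l)) = (\<Sum>i<n. a i * m i l)" for l
    unfolding spec_form_re[OF s1] m_def by simp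
  have "(\<Sum>i<n. \<Sum>l<n. m i l * (a i - b l)) \<le> (\<Sum>i<n. \<Sum>l<n. m i l * (eta (a i) - a i * ln (b l)))"
    by (intro sum_mono mult_left_mono klein_scalar a b) (auto simp: m_def)
  moreover have "(\<Sum>i<n. \<Sum>l<n. m i l * (a i - b l)) = (\<Sum>i<n. a i) - (\<Sum>l<n. b l)"
  proof -
    have "(\<Sum>i<n. \<Sum>l<n. m i l * (a i - b l)) = (\<Sum>i<n. \<Sum>l<n. m i l * a i) - (\<Sum>i<n. \<Sum>l<n. m i l * b l)"
      by (simp add: right_diff_distrib sum_subtractf)
    also have "(\<Sum>i<n. \<Sum>l<n. m i l * b l) = (\<Sum>l<n. \<Sum>i<n. m i l * b l)" by (rule sum.swap)
    finally show ?thesis by (simp add: sum_distrib_right[symmetric] c1 c2)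
  qed
  moreover have "(\<Sum>i<n. \<Sum>l<n. m i l * (eta (a i) - a i * ln (b l)))
    = (\<Sum>i<n. eta (a i)) - (\<Sum>l<n. Re (mform n M1 (g l) (g l)) * ln (b l))"
  proof -
    have "(\<Sum>i<n. \<Sum>l<n. m i l * (eta (a i) - a i * ln (b l)))
      = (\<Sum>i<n. \<Sum>l<n. m i l * eta (a i)) - (\<Sum>i<n. \<Sum>l<n. a i * m i l * ln (b l))"
      by (simp add: right_diff_distrib sum_subtractf mult_ac)
    also have "(\<Sum>i<n. \<Sum>l<n. a i * m i l * ln (b l)) = (\<Sum>l<n. \<Sum>i<n. a i * m i l * ln (b l))" by (rule sum.swap)
    finally show ?thesis by (simp add: sum_distrib_right[symmetric] c2 f)
  qed
  ultimately show ?thesis unfolding ent_spec[OF s1] by simp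
qed

lemma ent_ref:
  assumes s: "spec n M e a" and a: "\<And>i. i < n \<Longrightarrow> 0 \<le> a i"
  shows "ent n M = - (\<Sum>i<n. a i * ln (a i))"
  unfolding ent_spec[OF s] using a by (simp add: eta_eq)

section \<open>Entropy of a phase mixture plus a pinched operator\<close>

lemma mform_expand:
  "mform n M (\<lambda>x. \<Sum>i\<in>I. c i * h i x) (\<lambda>x. \<Sum>j\<in>J. c' j * h' j x)
    = (\<Sum>i\<in>I. \<Sum>j\<in>J. cnj (c i) * c' j * mform n M (h i) (h' j))"
proof -
  let ?t = "\<lambda>i j x y. cnj (c i) * c' j * (cnj (h i x) * M x y * h' j y)"
  have "mform n M (\<lambda>x. \<Sum>i\<in>I. c i * h i x) (\<lambda>x. \<Sum>j\<in>J. c' j * h' j x)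
    = (\<Sum>x<n. \<Sum>y<n. \<Sum>i\<in>I. \<Sum>j\<in>J. ?t i j x y)"
    unfolding mform_def
  proof (intro sum.cong refl)
    fix x y
    have "cnj (\<Sum>i\<in>I. c i * h i x) * M x y * (\<Sum>j\<in>J. c' j * h' j y)
      = M x y * ((\<Sum>i\<in>I. cnj (c i * h i x)) * (\<Sum>j\<in>J. c' j * h' j y))"
      by (simp only: cnj_sum mult_ac)
    also have "\<dots> = (\<Sum>i\<in>I. \<Sum>j\<in>J. ?t i j x y)"
      unfolding sum_product by (simp add: sum_distrib_left mult_ac)
    finally show "cnj (\<Sum>i\<in>I. c i * h i x) * M x y * (\<Sum>j\<in>J. c' j * h' j y)
      = (\<Sum>i\<in>I. \<Sum>j\<in>J. ?t i j x y)" .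
  qed
  also have "\<dots> = (\<Sum>i\<in>I. \<Sum>j\<in>J. \<Sum>x<n. \<Sum>y<n. ?t i j x y)" by (rule sum_swap22)
  finally show ?thesis by (simp add: mform_def sum_distrib_left)
qed

text \<open>The right side is the form of the inverse of \<open>M\<close> at \<open>v\<close>. In
  the eigenbasis the bound is a completed square for each coordinate, with multiplier
  \<open>1 / e l\<close>.\<close>

lemma spec_inverse_bound:
  assumes s: "spec n M g e" and e: "\<And>l. l < n \<Longrightarrow> 0 < e l"
  shows "2 * Re (ip n v z) - Re (mform n M z z) \<le> (\<Sum>l<n. cmod2 (ip n (g l) v) / e l)"
proof -
  have "2 * Re (ip n v z) - Re (mform n M z z)
    = (\<Sum>l<n. 2 * Re (ip n v (g l) * cnj (ip n z (g l))) - e l * cmod2 (ip n (g l) z))"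
    unfolding parseval[OF spec_onb[OF s], of v z] spec_form_re[OF s, of z]
    by (simp add: sum_subtractf sum_distrib_left)
  also have "\<dots> \<le> (\<Sum>l<n. cmod2 (ip n (g l) v) / e l)"
  proof (rule sum_mono)
    fix l assume "l \<in> {..<n}"
    then have el: "0 < e l" using e by simp
    have "2 * (1 / e l) * Re (cnj (ip n (g l) z) * ip n (g l) v)
      \<le> cmod2 (ip n (g l) z) + (1 / e l)\<^sup>2 * cmod2 (ip n (g l) v)"
      by (rule two_Re_cnj_mult_le)
    then have "e l * (2 * (1 / e l) * Re (cnj (ip n (g l) z) * ip n (g l) v))
      \<le> e l * (cmod2 (ip n (g l) z) + (1 / e l)\<^sup>2 * cmod2 (ip n (g l) v))"
      using el by (intro mult_left_mono) auto
    then have "2 * Re (cnj (ip n (g l) z) * ip n (g l) v)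
      \<le> e l * cmod2 (ip n (g l) z) + cmod2 (ip n (g l) v) / e l"
      using el by (simp add: distrib_left power2_eq_square)
    moreover have "Re (ip n v (g l) * cnj (ip n z (g l))) = Re (cnj (ip n (g l) z) * ip n (g l) v)"
    proof -
      have "ip n v (g l) * cnj (ip n z (g l)) = cnj (cnj (ip n (g l) z) * ip n (g l) v)"
        by (simp add: cnj_ip)
      then show ?thesis by (simp only: cnj.simps(1))
    qed
    ultimately show "2 * Re (ip n v (g l) * cnj (ip n z (g l))) - e l * cmod2 (ip n (g l) z)
      \<le> cmod2 (ip n (g l) v) / e l" by simp
  qed
  finally show ?thesis .
qed

text \<open>With \<open>\<rho>' = \<Sum>\<^sub>k \<alpha>\<^sub>k |u\<^sub>k\<rangle>\<langle>u\<^sub>k|\<close> and \<open>v m k = X\<^sup>m u\<^sub>k\<close>, the operators \<open>DD\<close> and \<open>AA\<close> below are \<open>E(\<rho>')\<close> and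
  \<open>\<Sum>\<^sub>m r\<^sub>m X\<^sup>m \<rho>' X\<^sup>-\<^sup>m\<close>. Adapted vectors stand for eigenvectors of \<open>X\<close>, whose expectation in
  \<open>X\<^sup>m \<rho>' X\<^sup>-\<^sup>m\<close> does not depend on \<open>m\<close>.\<close>

lemma spec_shift:
  assumes "spec n M E t"
  shows "spec n (\<lambda>x y. M x y + (if x = y then of_real s else 0)) E (\<lambda>i. t i + s)"
proof -
  have "M x y + (if x = y then of_real s else 0) = (\<Sum>i<n. of_real (t i + s) * E i x * cnj (E i y))"
    if "x < n" "y < n" for x y
  proof -
    have "(if x = y then of_real s else 0) = of_real s * (\<Sum>i<n. E i x * cnj (E i y))"
      unfolding orthonormal_complete[OF spec_onb[OF assms] that] by simp
    then show ?thesis using assms that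
      by (simp add: spec_def ring_distribs sum.distrib sum_distrib_left mult.assoc)
  qed
  then show ?thesis using assms by (simp add: spec_def)
qed

lemma nonneg_if_ge_inverse:
  fixes x C :: real
  assumes "\<And>n. - C * inverse (real (Suc n)) \<le> x"
  shows "0 \<le> x"
proof -
  have "(\<lambda>n. - C * inverse (real (Suc n))) \<longlonglongrightarrow> - C * 0"
    by (intro tendsto_mult tendsto_const LIMSEQ_inverse_real_of_nat)
  then show ?thesis using assms by (intro LIMSEQ_le_const2) auto
qed

locale vector_mixture =
  fixes N d :: nat and \<alpha> :: "nat \<Rightarrow> real" and v :: "nat \<Rightarrow> nat \<Rightarrow> nat \<Rightarrow> complex" and r :: "nat \<Rightarrow> real"
  assumes d: "0 < d" and \<alpha>: "\<And>k. k < N \<Longrightarrow> 0 \<le> \<alpha> k" and r: "\<And>m. m < d \<Longrightarrow> 0 \<le> r m"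
begin

definition idx where "idx = {..<d} \<times> {..<N}"
definition V where "V z = v (fst z) (snd z)"
definition DD where "DD x y = (\<Sum>z\<in>idx. of_real (\<alpha> (snd z) / d) * V z x * cnj (V z y))"
definition AA where "AA x y = (\<Sum>z\<in>idx. of_real (r (fst z) * \<alpha> (snd z)) * V z x * cnj (V z y))"
text \<open>\<open>P m f\<close> is the expectation of \<open>f\<close> in X^m \<rho>' X^-m. Its
  average over \<open>m\<close> is the expectation in \<open>DD\<close>, and its
  \<open>r\<close>-weighted sum is the one in \<open>AA\<close>.\<close>

definition P where "P m f = (\<Sum>k<N. \<alpha> k * cmod2 (ip N f (v m k)))"
definition adapted where "adapted f \<longleftrightarrow> (\<forall>m<d. P m f = Re (mform N DD f f))"

lemma form_DD: "mform N DD f g = (\<Sum>z\<in>idx. of_real (\<alpha> (snd z) / d) * ip N f (V z) * cnj (ip N g (V z)))"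
  by (rule mform_rank_one_sum) (simp add: DD_def)

lemma form_AA: "mform N AA f g = (\<Sum>z\<in>idx. of_real (r (fst z) * \<alpha> (snd z)) * ip N f (V z) * cnj (ip N g (V z)))"
  by (rule mform_rank_one_sum) (simp add: AA_def)

lemma sum_idx: "(\<Sum>z\<in>idx. F z) = (\<Sum>m<d. \<Sum>k<N. F (m, k))"
  unfolding idx_def by (simp add: sum.cartesian_product)

lemma form_DD_self: "mform N DD f f = of_real ((\<Sum>m<d. P m f) / d)"
proof -
  have "mform N DD f f = (\<Sum>m<d. \<Sum>k<N. of_real (\<alpha> k / d * cmod2 (ip N f (v m k))))"
    unfolding form_DD sum_idx
    by (intro sum.cong refl) (simp only: V_def fst_conv snd_conv of_real_mult complex_norm_square mult.assoc)
  then show ?thesis by (simp add: P_def sum_divide_distrib)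
qed

lemma form_AA_self: "mform N AA f f = of_real (\<Sum>m<d. r m * P m f)"
proof -
  have "mform N AA f f = (\<Sum>m<d. \<Sum>k<N. of_real (r m * \<alpha> k * cmod2 (ip N f (v m k))))"
    unfolding form_AA sum_idx
    by (intro sum.cong refl) (simp only: V_def fst_conv snd_conv of_real_mult complex_norm_square mult.assoc)
  then show ?thesis by (simp add: P_def sum_distrib_left mult.assoc)
qed

lemma P_nonneg: "0 \<le> P m f"
  unfolding P_def by (intro sum_nonneg) (simp add: \<alpha>)

text \<open>The bound \<open>\<langle>v, N\<^sup>-\<^sup>1 v\<rangle> \<ge> 2 Re \<langle>v, z\<rangle> - \<langle>z, N z\<rangle>\<close> is applied to \<open>N = d r\<^sub>m DD + B\<close> and
  \<open>z = (AA + B)\<^sup>-\<^sup>1 v\<close>; averaged over all \<open>v = v m k\<close>, its right-hand side is exactly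
  \<open>Tr DD (AA + B)\<^sup>-\<^sup>1\<close>.\<close>

lemma resolvent_trace_bound:
  fixes B :: "nat \<Rightarrow> nat \<Rightarrow> complex"
  assumes sE: "spec N (\<lambda>x y. AA x y + B x y) E t" and t: "\<And>i. i < N \<Longrightarrow> 0 < t i"
    and sG: "\<And>m. m < d \<Longrightarrow> spec N (\<lambda>x y. of_real (d * r m) * DD x y + B x y) (G m) (e m)"
    and e: "\<And>m l. m < d \<Longrightarrow> l < N \<Longrightarrow> 0 < e m l"
    and ad: "\<And>m l. m < d \<Longrightarrow> l < N \<Longrightarrow> adapted (G m l)"
  shows "(\<Sum>i<N. Re (mform N DD (E i) (E i)) / t i)
    \<le> (\<Sum>m<d. \<Sum>l<N. Re (mform N DD (G m l) (G m l)) / e m l) / d"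
proof -
  define p where "p z i = ip N (E i) (V z)" for z i
  define c where "c z i = p z i / of_real (t i)" for z i
  \<comment> \<open>\<open>u z\<close> is the inverse of \<open>AA + B\<close> applied to
    \<open>V z\<close>, written in the eigenbasis \<open>E\<close>.\<close>
  define u where "u z = (\<lambda>x. \<Sum>i<N. c z i * E i x)" for z
  let ?D = "\<lambda>i j. mform N DD (E i) (E j)"
  let ?A = "\<lambda>i j. mform N AA (E i) (E j)"
  let ?B = "\<lambda>i j. mform N B (E i) (E j)"
  have vz: "ip N (V z) (u z) = of_real (\<Sum>i<N. cmod2 (p z i) / t i)" for z
  proof -
    have "ip N (V z) (u z) = (\<Sum>i<N. c z i * ip N (V z) (E i))" unfolding u_def by (rule ip_sum_right)
    also have "\<dots> = (\<Sum>i<N. of_real (cmod2 (p z i) / t i))"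
    proof (intro sum.cong refl)
      fix i
      have "c z i * ip N (V z) (E i) = p z i * cnj (p z i) / of_real (t i)"
        by (simp add: c_def p_def cnj_ip)
      then show "c z i * ip N (V z) (E i) = of_real (cmod2 (p z i) / t i)"
        by (simp only: of_real_divide complex_norm_square)
    qed
    finally show ?thesis by simp
  qed
  have uu: "mform N M (u z) (u z) = (\<Sum>i<N. \<Sum>j<N. cnj (c z i) * c z j * mform N M (E i) (E j))" for M z
    unfolding u_def by (rule mform_expand)
  have AB: "?A i j + ?B i j = (if i = j then of_real (t i) else 0)" if "i < N" "j < N" for i j
    using spec_diag[OF sE that] by (simp add: mform_add)
  \<comment> \<open>With K the inverse of \<open>AA + B\<close>, the right side is the trace of M K
    M' K. Choosing the weights \<open>w\<close> selects \<open>M'\<close>, either \<open>AA\<close>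
    or \<open>DD\<close>.\<close>
  have exch: "(\<Sum>z\<in>idx. of_real (w z) * mform N M (u z) (u z))
     = (\<Sum>i<N. \<Sum>j<N. mform N M (E i) (E j) * mform N M' (E j) (E i) / (of_real (t i) * of_real (t j)))"
    if M': "\<And>f g. mform N M' f g = (\<Sum>z\<in>idx. of_real (w z) * ip N f (V z) * cnj (ip N g (V z)))"
    for M M' w
  proof -
    let ?t = "\<lambda>z i j. mform N M (E i) (E j) * (of_real (w z) * p z j * cnj (p z i)) / (of_real (t i) * of_real (t j))"
    have "(\<Sum>z\<in>idx. of_real (w z) * mform N M (u z) (u z))
      = (\<Sum>z\<in>idx. \<Sum>i<N. \<Sum>j<N. ?t z i j)"
      unfolding uu c_def by (simp add: sum_distrib_left mult_ac)
    also have "\<dots> = (\<Sum>i<N. \<Sum>j<N. \<Sum>z\<in>idx. ?t z i j)"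
      by (rule sum_swap3)
    also have "\<dots> = (\<Sum>i<N. \<Sum>j<N. mform N M (E i) (E j) * mform N M' (E j) (E i) / (of_real (t i) * of_real (t j)))"
      unfolding M' p_def by (simp add: sum_distrib_left sum_divide_distrib)
    finally show ?thesis .
  qed
  \<comment> \<open>The factor \<open>d * r m\<close> turns the weights of \<open>DD\<close> into
    those of \<open>AA\<close>. The sum becomes Tr DD K AA K + Tr B K DD K, that is Tr DD K (AA + B)
    K, which collapses to Tr DD K.\<close>
  have quad: "(\<Sum>z\<in>idx. of_real (\<alpha> (snd z) / d) *
       mform N (\<lambda>x y. of_real (d * r (fst z)) * DD x y + B x y) (u z) (u z)) = (\<Sum>i<N. ?D i i / of_real (t i))"
  proof -
    have "(\<Sum>z\<in>idx. of_real (\<alpha> (snd z) / d) *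
       mform N (\<lambda>x y. of_real (d * r (fst z)) * DD x y + B x y) (u z) (u z))
      = (\<Sum>z\<in>idx. of_real (r (fst z) * \<alpha> (snd z)) * mform N DD (u z) (u z))
        + (\<Sum>z\<in>idx. of_real (\<alpha> (snd z) / d) * mform N B (u z) (u z))"
      unfolding sum.distrib[symmetric] using d
      by (intro sum.cong refl) (simp add: mform_add mform_scale ring_distribs)
    also have "\<dots> = (\<Sum>i<N. \<Sum>j<N. ?D i j * ?A j i / (of_real (t i) * of_real (t j)))
        + (\<Sum>i<N. \<Sum>j<N. ?B i j * ?D j i / (of_real (t i) * of_real (t j)))"
      by (simp only: exch[OF form_AA] exch[OF form_DD])
    also have "(\<Sum>i<N. \<Sum>j<N. ?D i j * ?A j i / (of_real (t i) * of_real (t j)))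
      = (\<Sum>i<N. \<Sum>j<N. ?D j i * ?A i j / (of_real (t j) * of_real (t i)))"
      by (rule sum.swap)
    also have "\<dots> + (\<Sum>i<N. \<Sum>j<N. ?B i j * ?D j i / (of_real (t i) * of_real (t j)))
      = (\<Sum>i<N. \<Sum>j<N. (?A i j + ?B i j) * ?D j i / (of_real (t i) * of_real (t j)))"
      unfolding sum.distrib[symmetric]
      by (intro sum.cong refl) (simp add: ring_distribs add_divide_distrib mult_ac)
    also have "\<dots> = (\<Sum>i<N. \<Sum>j<N. if j = i then ?D i i / of_real (t i) else 0)"
    proof (intro sum.cong refl)
      fix i j assume "i \<in> {..<N}" "j \<in> {..<N}"
      then show "(?A i j + ?B i j) * ?D j i / (of_real (t i) * of_real (t j))
        = (if j = i then ?D i i / of_real (t i) else 0)"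
        using AB[of i j] t[of i] by auto
    qed
    finally show ?thesis by simp
  qed
  have lin: "(\<Sum>z\<in>idx. \<alpha> (snd z) / d * (\<Sum>i<N. cmod2 (p z i) / t i)) = (\<Sum>i<N. Re (?D i i) / t i)"
  proof -
    have "Re (?D i i) = (\<Sum>z\<in>idx. \<alpha> (snd z) / d * cmod2 (p z i))" for i
      unfolding form_DD_self sum_idx P_def p_def V_def by (simp add: sum_divide_distrib)
    then have "(\<Sum>i<N. Re (?D i i) / t i) = (\<Sum>i<N. \<Sum>z\<in>idx. \<alpha> (snd z) / d * (cmod2 (p z i) / t i))"
      by (simp add: sum_divide_distrib)
    also have "\<dots> = (\<Sum>z\<in>idx. \<Sum>i<N. \<alpha> (snd z) / d * (cmod2 (p z i) / t i))" by (rule sum.swap)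
    finally show ?thesis by (simp add: sum_distrib_left)
  qed
  have "(\<Sum>i<N. Re (?D i i) / t i) = 2 * (\<Sum>i<N. Re (?D i i) / t i) - Re (\<Sum>i<N. ?D i i / of_real (t i))"
    by simp
  also have "\<dots> = (\<Sum>z\<in>idx. \<alpha> (snd z) / d * (2 * Re (ip N (V z) (u z))
      - Re (mform N (\<lambda>x y. of_real (d * r (fst z)) * DD x y + B x y) (u z) (u z))))"
    unfolding quad[symmetric] lin[symmetric] vz
    by (simp add: right_diff_distrib sum_subtractf sum_distrib_left mult_ac)
  also have "\<dots> \<le> (\<Sum>z\<in>idx. \<alpha> (snd z) / d * (\<Sum>l<N. cmod2 (ip N (G (fst z) l) (V z)) / e (fst z) l))"
    by (intro sum_mono mult_left_mono spec_inverse_bound sG e) (auto simp: idx_def \<alpha>)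
  also have "\<dots> = (\<Sum>m<d. \<Sum>l<N. P m (G m l) / e m l) / d"
  proof -
    have "(\<Sum>k<N. \<alpha> k / d * (\<Sum>l<N. cmod2 (ip N (G m l) (v m k)) / e m l)) = (\<Sum>l<N. P m (G m l) / e m l) / d" for m
    proof -
      have "(\<Sum>k<N. \<alpha> k / d * (\<Sum>l<N. cmod2 (ip N (G m l) (v m k)) / e m l))
        = (\<Sum>k<N. \<Sum>l<N. \<alpha> k * cmod2 (ip N (G m l) (v m k)) / e m l / d)"
        by (simp add: sum_distrib_left mult_ac)
      also have "\<dots> = (\<Sum>l<N. \<Sum>k<N. \<alpha> k * cmod2 (ip N (G m l) (v m k)) / e m l / d)" by (rule sum.swap)
      finally show ?thesis by (simp add: P_def sum_divide_distrib)
    qed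
    then show ?thesis unfolding sum_idx V_def by (simp add: sum_divide_distrib)
  qed
  \<comment> \<open>Adaptedness replaces the expectation belonging to the index \<open>m\<close> by
    the one in \<open>DD\<close>.\<close>
  also have "\<dots> = (\<Sum>m<d. \<Sum>l<N. Re (mform N DD (G m l) (G m l)) / e m l) / d"
    using ad by (simp add: adapted_def)
  finally show ?thesis .
qed

text \<open>Integrated form of \<open>resolvent_trace_bound\<close>. Let \<open>F s\<close> be the
  difference of the two sides after adding \<open>s\<close> times the identity to all operators, a
  shift that \<open>B\<close> absorbs. Then \<open>F\<close> is nonincreasing, and its limit at
  infinity is nonnegative.\<close>

lemma log_trace_bound:
  fixes B :: "nat \<Rightarrow> nat \<Rightarrow> complex"
  assumes sE: "spec N (\<lambda>x y. AA x y + B x y) E t" and t: "\<And>i. i < N \<Longrightarrow> 0 < t i"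
    and sG: "\<And>m. m < d \<Longrightarrow> spec N (\<lambda>x y. of_real (d * r m) * DD x y + B x y) (G m) (e m)"
    and e: "\<And>m l. m < d \<Longrightarrow> l < N \<Longrightarrow> 0 < e m l"
    and ad: "\<And>m l. m < d \<Longrightarrow> l < N \<Longrightarrow> adapted (G m l)"
  shows "(\<Sum>m<d. \<Sum>l<N. Re (mform N DD (G m l) (G m l)) * ln (e m l)) / d
    \<le> (\<Sum>i<N. Re (mform N DD (E i) (E i)) * ln (t i))"
proof -
  define De where "De i = Re (mform N DD (E i) (E i))" for i
  define Dg where "Dg m l = Re (mform N DD (G m l) (G m l))" for m l
  have De0: "0 \<le> De i" and Dg0: "0 \<le> Dg m l" for i m l
    by (simp_all add: De_def Dg_def form_DD_self sum_nonneg P_nonneg)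
  have tr: "(\<Sum>l<N. Dg m l) = (\<Sum>i<N. De i)" if "m < d" for m
    unfolding De_def Dg_def Re_sum[symmetric] trace_onb[OF spec_onb[OF sE]] trace_onb[OF spec_onb[OF sG[OF that]]] ..
  define F where "F s = (\<Sum>i<N. De i * ln (t i + s)) - (\<Sum>m<d. \<Sum>l<N. Dg m l * ln (e m l + s)) / d" for s
  have mono: "F T \<le> F 0" if T: "0 \<le> T" for T
  proof (rule DERIV_nonpos_imp_nonincreasing[OF T])
    fix s :: real assume s: "0 \<le> s" "s \<le> T"
    have ts: "0 < t i + s" if "i < N" for i using t[OF that] s by simp
    have es: "0 < e m l + s" if "m < d" "l < N" for m l using e[OF that] s by simp
    let ?F' = "(\<Sum>i<N. De i * (1 / (t i + s))) - (\<Sum>m<d. \<Sum>l<N. Dg m l * (1 / (e m l + s))) / d"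
    have ln': "((\<lambda>s. ln (c + s)) has_real_derivative 1 / (c + s)) (at s)" if "0 < c + s" for c
      using that by (auto intro!: derivative_eq_intros)
    have "(F has_real_derivative ?F') (at s)"
      unfolding F_def
      by (intro DERIV_diff DERIV_cdivide DERIV_sum DERIV_cmult ln') (auto simp: ts es)
    moreover have "?F' \<le> 0"
    proof -
      let ?B = "\<lambda>x y. B x y + (if x = y then of_real s else 0)"
      have "spec N (\<lambda>x y. AA x y + ?B x y) E (\<lambda>i. t i + s)"
        using spec_shift[OF sE, of s] by (simp add: add.assoc)
      moreover have "spec N (\<lambda>x y. of_real (d * r m) * DD x y + ?B x y) (G m) (\<lambda>l. e m l + s)" if "m < d" for m
        using spec_shift[OF sG[OF that], of s] by (simp add: add.assoc)
      ultimately have "(\<Sum>i<N. De i / (t i + s)) \<le> (\<Sum>m<d. \<Sum>l<N. Dg m l / (e m l + s)) / d"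
        unfolding De_def Dg_def
        by (intro resolvent_trace_bound[where B = ?B and e = "\<lambda>m l. e m l + s"] ts es ad)
      then show ?thesis by simp
    qed
    ultimately show "\<exists>y. (F has_real_derivative y) (at s) \<and> y \<le> 0" by blast
  qed
  let ?C = "(\<Sum>m<d. \<Sum>l<N. Dg m l * e m l) / d"
  \<comment> \<open>The traces of \<open>DD\<close> in all the eigenbases agree, so the two terms
    \<open>ln T\<close> have the same coefficient and only the correction of order
    \<open>1 / T\<close> remains.\<close>
  have low: "- ?C * inverse T \<le> F T" if T: "0 < T" for T
  proof -
    have "(\<Sum>i<N. De i) * ln T \<le> (\<Sum>i<N. De i * ln (t i + T))"
      unfolding sum_distrib_right
    proof (intro sum_mono mult_left_mono De0)
      fix i assume "i \<in> {..<N}"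
      then have "0 < t i" using t by simp
      then show "ln T \<le> ln (t i + T)" using T by (subst ln_le_cancel_iff) auto
    qed
    moreover have "(\<Sum>m<d. \<Sum>l<N. Dg m l * ln (e m l + T)) \<le> (\<Sum>m<d. \<Sum>l<N. Dg m l * (ln T + e m l / T))"
    proof (intro sum_mono mult_left_mono Dg0)
      fix m l assume "m \<in> {..<d}" "l \<in> {..<N}"
      then have "0 < e m l" using e by simp
      then have "ln (e m l + T) = ln T + ln (1 + e m l / T)"
        using T by (subst ln_mult_pos[symmetric]) (auto simp: field_simps add_pos_pos)
      also have "ln (1 + e m l / T) \<le> e m l / T"
        using \<open>0 < e m l\<close> T by (intro ln_add_one_self_le_self) simp
      finally show "ln (e m l + T) \<le> ln T + e m l / T" by simp
    qed
    moreover have "(\<Sum>m<d. \<Sum>l<N. Dg m l * (ln T + e m l / T)) = d * ((\<Sum>i<N. De i) * ln T) + (\<Sum>m<d. \<Sum>l<N. Dg m l * e m l) / T"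
    proof -
      have "(\<Sum>m<d. \<Sum>l<N. Dg m l * (ln T + e m l / T)) = (\<Sum>m<d. (\<Sum>l<N. Dg m l) * ln T + (\<Sum>l<N. Dg m l * e m l) / T)"
        by (simp add: distrib_left sum.distrib sum_distrib_right sum_divide_distrib)
      also have "\<dots> = (\<Sum>m<d. (\<Sum>i<N. De i) * ln T + (\<Sum>l<N. Dg m l * e m l) / T)"
        by (intro sum.cong refl) (simp add: tr)
      finally show ?thesis by (simp add: sum.distrib sum_divide_distrib)
    qed
    ultimately have "(\<Sum>m<d. \<Sum>l<N. Dg m l * ln (e m l + T)) / d
       \<le> (d * ((\<Sum>i<N. De i) * ln T) + (\<Sum>m<d. \<Sum>l<N. Dg m l * e m l) / T) / d"
      using d by (intro divide_right_mono) auto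
    also have "\<dots> = (\<Sum>i<N. De i) * ln T + ?C * inverse T"
      using d by (simp add: add_divide_distrib) (simp add: divide_inverse mult_ac)
    finally show ?thesis
      using \<open>(\<Sum>i<N. De i) * ln T \<le> (\<Sum>i<N. De i * ln (t i + T))\<close> by (simp add: F_def)
  qed
  have "0 \<le> F 0"
    by (rule nonneg_if_ge_inverse[of ?C], rule order.trans[OF low mono]) auto
  then show ?thesis by (simp add: F_def De_def Dg_def)
qed

end

text \<open>The block structure enters only through \<open>ex_adapted\<close>: every
  \<open>\<kappa> DD + Y\<close> has an eigenbasis of adapted vectors. The lower bound \<epsilon> on
  \<open>Y\<close> keeps all eigenvalues positive, and \<open>tr\<close> gives \<open>DD\<close>
  trace 1.\<close>

locale phase_mixture = vector_mixture +
  fixes Y :: "nat \<Rightarrow> nat \<Rightarrow> complex" and \<epsilon> :: real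
  assumes \<epsilon>: "0 < \<epsilon>"
    and Y_im: "\<And>f. Im (mform N Y f f) = 0"
    and Y_re: "\<And>f. \<epsilon> * (\<Sum>x<N. cmod2 (f x)) \<le> Re (mform N Y f f)"
    and tr: "\<And>m. m < d \<Longrightarrow> (\<Sum>k<N. \<alpha> k * (\<Sum>x<N. cmod2 (v m k x))) = 1"
    and ex_adapted: "\<And>\<kappa>. 0 \<le> \<kappa> \<Longrightarrow>
      \<exists>G e. spec N (\<lambda>x y. of_real \<kappa> * DD x y + Y x y) G e \<and> (\<forall>l<N. adapted (G l))"
begin

definition R where "R = (\<Sum>m<d. r m)"
definition tau where "tau s = (\<lambda>x y. AA x y + (of_real s * DD x y + Y x y))"
definition et where "et \<kappa> = (\<lambda>x y. of_real \<kappa> * DD x y + Y x y)"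

lemma Y_nonneg: "0 \<le> Re (mform N Y f f)"
  using Y_re[of f] \<epsilon> by (intro order.trans[OF _ Y_re]) (simp add: sum_nonneg)

lemma form_tau: "mform N (tau s) f g = mform N AA f g + (of_real s * mform N DD f g + mform N Y f g)"
  by (simp add: tau_def mform_add mform_scale)

lemma form_et: "mform N (et \<kappa>) f g = of_real \<kappa> * mform N DD f g + mform N Y f g"
  by (simp add: et_def mform_add mform_scale)

lemma form_DD_nonneg: "0 \<le> Re (mform N DD f f)"
  by (simp add: form_DD_self sum_nonneg P_nonneg)

lemma form_AA_nonneg: "0 \<le> Re (mform N AA f f)"
  unfolding form_AA_self Re_complex_of_real by (intro sum_nonneg mult_nonneg_nonneg P_nonneg) (simp add: r)

lemma ex_tau:
  assumes "0 \<le> s" shows "\<exists>E t. spec N (tau s) E t"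
proof -
  have "Im (mform N (tau s) f f) = 0" "0 \<le> Re (mform N (tau s) f f)" for f
    using assms Y_im[of f] Y_nonneg[of f] form_AA_nonneg[of f] form_DD_nonneg[of f]
    by (simp_all add: form_tau) (simp add: form_AA_self form_DD_self)
  from ex_spec[OF this] show ?thesis by blast
qed

lemma eig_ge:
  assumes s: "spec N M E t" and M: "\<And>f. Re (mform N Y f f) \<le> Re (mform N M f f)" and i: "i < N"
  shows "\<epsilon> \<le> t i"
proof -
  have "\<epsilon> = \<epsilon> * (\<Sum>x<N. cmod2 (E i x))" using orthonormal_norm[OF spec_onb[OF s] i] by simp
  also have "\<dots> \<le> Re (mform N M (E i) (E i))" using Y_re M by (rule order.trans)
  also have "\<dots> = t i" using spec_diag[OF s i i] by simp
  finally show ?thesis .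
qed

lemma tau_eig_pos: "spec N (tau s) E t \<Longrightarrow> 0 \<le> s \<Longrightarrow> i < N \<Longrightarrow> 0 < t i"
  by (rule less_le_trans[OF \<epsilon>], rule eig_ge)
     (auto simp: form_tau form_AA_nonneg form_DD_nonneg)

lemma et_eig_pos: "spec N (et \<kappa>) E t \<Longrightarrow> 0 \<le> \<kappa> \<Longrightarrow> i < N \<Longrightarrow> 0 < t i"
  by (rule less_le_trans[OF \<epsilon>], rule eig_ge)
     (auto simp: form_et form_DD_nonneg)

lemma trace_DD: "(\<Sum>x<N. DD x x) = 1"
proof -
  have "(\<Sum>x<N. DD x x) = (\<Sum>z\<in>idx. \<Sum>x<N. of_real (\<alpha> (snd z) / d * cmod2 (V z x)))"
    unfolding DD_def by (subst sum.swap) (simp only: of_real_mult complex_norm_square mult.assoc)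
  also have "\<dots> = of_real (\<Sum>m<d. (\<Sum>k<N. \<alpha> k * (\<Sum>x<N. cmod2 (v m k x))) / d)"
    unfolding sum_idx V_def by (simp add: sum_distrib_left sum_divide_distrib mult_ac)
  also have "\<dots> = 1" using d by (simp add: tr)
  finally show ?thesis .
qed

lemma trace_DD_onb: "orthonormal_upto N N E \<Longrightarrow> (\<Sum>i<N. Re (mform N DD (E i) (E i))) = 1"
  unfolding Re_sum[symmetric] by (simp add: trace_onb trace_DD)

text \<open>The tangent bound for the concave entropy at \<open>M\<close> in direction
  \<open>DD\<close>, from Klein's inequality in the eigenbasis of \<open>M\<close>. The final
  \<open>- h\<close> is the trace of the increment; \<open>h\<close> may have either sign.\<close>

lemma klein_step:
  assumes s: "spec N M E t" and t: "\<And>i. i < N \<Longrightarrow> 0 < t i"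
    and s': "spec N M' E' t'" and t': "\<And>i. i < N \<Longrightarrow> 0 < t' i"
    and M': "\<And>f. mform N M' f f = mform N M f f + of_real h * mform N DD f f"
  shows "ent N M' \<le> ent N M - h * (\<Sum>i<N. Re (mform N DD (E i) (E i)) * ln (t i)) - h"
proof -
  let ?D = "\<lambda>i. Re (mform N DD (E i) (E i))"
  have form: "Re (mform N M' (E i) (E i)) = t i + h * ?D i" if "i < N" for i
    using spec_diag[OF s that that] by (simp add: M')
  have "(\<Sum>i<N. t' i) = Re (\<Sum>i<N. mform N M' (E i) (E i))"
    unfolding trace_onb[OF spec_onb[OF s]] spec_trace[OF s', symmetric] by simp
  also have "\<dots> = (\<Sum>i<N. t i) + h"
    using trace_DD_onb[OF spec_onb[OF s]] by (simp add: form sum.distrib sum_distrib_left[symmetric])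
  finally have tr': "(\<Sum>i<N. t' i) = (\<Sum>i<N. t i) + h" .
  have "ent N M' \<le> - (\<Sum>i<N. Re (mform N M' (E i) (E i)) * ln (t i)) - (\<Sum>i<N. t' i) + (\<Sum>i<N. t i)"
    using t' t by (intro klein[OF s' _ spec_onb[OF s]]) (auto intro: less_imp_le)
  also have "(\<Sum>i<N. Re (mform N M' (E i) (E i)) * ln (t i)) = (\<Sum>i<N. t i * ln (t i)) + h * (\<Sum>i<N. ?D i * ln (t i))"
    unfolding sum_distrib_left sum.distrib[symmetric]
    by (intro sum.cong refl) (simp only: form lessThan_iff ring_distribs mult.assoc)
  finally show ?thesis using ent_ref[OF s] t tr' by (simp add: less_imp_le)
qed

lemma tau_step:
  assumes s: "0 \<le> s" and h: "0 \<le> h" and sp: "spec N (tau s) E t"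
  shows "h * (\<Sum>i<N. Re (mform N DD (E i) (E i)) * ln (t i)) + h \<le> ent N (tau s) - ent N (tau (s + h))"
proof -
  obtain E' t' where sp': "spec N (tau (s + h)) E' t'" using ex_tau s h by force
  have "ent N (tau (s + h)) \<le> ent N (tau s) - h * (\<Sum>i<N. Re (mform N DD (E i) (E i)) * ln (t i)) - h"
    using s h by (intro klein_step[OF sp _ sp'] tau_eig_pos[OF sp] tau_eig_pos[OF sp']) (simp_all add: form_tau algebra_simps)
  then show ?thesis by simp
qed

lemma et_step:
  assumes \<kappa>: "0 \<le> \<kappa>" "0 \<le> \<kappa>'" and sp: "spec N (et \<kappa>') G e"
  shows "ent N (et \<kappa>) \<le> ent N (et \<kappa>') - (\<kappa> - \<kappa>') * (\<Sum>i<N. Re (mform N DD (G i) (G i)) * ln (e i)) - (\<kappa> - \<kappa>')"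
proof -
  obtain G' e' where sp': "spec N (et \<kappa>) G' e'" using ex_adapted[OF \<kappa>(1)] unfolding et_def by blast
  show ?thesis
    using \<kappa> by (intro klein_step[OF sp _ sp'] et_eig_pos[OF sp] et_eig_pos[OF sp']) (simp_all add: form_et algebra_simps)
qed

section \<open>Behaviour of the entropy gap along the direction \<open>DD\<close>\<close>

definition gap where "gap s = ent N (tau s) - (\<Sum>m<d. ent N (et (d * r m + s))) / d"

text \<open>Klein's inequality bounds the increments of the two entropies over a step \<open>h\<close> from
  opposite sides, at opposite ends of the step; the resulting error telescopes to \<open>O(h)\<close>.\<close>

lemma gap_antimono:
  assumes b: "0 \<le> b" shows "gap b \<le> gap 0"
proof -
  have "\<forall>\<kappa>. \<exists>G e. 0 \<le> \<kappa> \<longrightarrow> spec N (et \<kappa>) G e \<and> (\<forall>l<N. adapted (G l))"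
    using ex_adapted unfolding et_def by blast
  then obtain G e where Ge: "\<And>\<kappa>. 0 \<le> \<kappa> \<Longrightarrow> spec N (et \<kappa>) (G \<kappa>) (e \<kappa>)"
    "\<And>\<kappa> l. 0 \<le> \<kappa> \<Longrightarrow> l < N \<Longrightarrow> adapted (G \<kappa> l)" by metis
  define L where "L \<kappa> = (\<Sum>l<N. Re (mform N DD (G \<kappa> l) (G \<kappa> l)) * ln (e \<kappa> l))" for \<kappa>
  define LL where "LL s = (\<Sum>m<d. L (d * r m + s)) / d" for s
  have step: "h * (LL s - LL (s + h)) \<le> gap s - gap (s + h)" if s: "0 \<le> s" and h: "0 \<le> h" for s h
  proof -
    obtain E t where sp: "spec N (tau s) E t" using ex_tau[OF s] by blast
    let ?T = "\<Sum>i<N. Re (mform N DD (E i) (E i)) * ln (t i)"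
    have \<kappa>0: "0 \<le> d * r m + s" if "m < d" for m using r[OF that] s by simp
    \<comment> \<open>The term \<open>s * DD\<close> is put into the operator \<open>B\<close> of
      \<open>log_trace_bound\<close>: then \<open>AA + B\<close> is \<open>tau s\<close> and
      \<open>d * r m * DD + B\<close> is \<open>et (d * r m + s)\<close>.\<close>
    have "LL s \<le> ?T"
      unfolding LL_def L_def
    proof (rule log_trace_bound[where B = "\<lambda>x y. of_real s * DD x y + Y x y"])
      show "spec N (\<lambda>x y. AA x y + (of_real s * DD x y + Y x y)) E t" using sp unfolding tau_def .
      show "0 < t i" if "i < N" for i using tau_eig_pos[OF sp s that] .
      show "spec N (\<lambda>x y. of_real (d * r m) * DD x y + (of_real s * DD x y + Y x y)) (G (d * r m + s)) (e (d * r m + s))"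
        if "m < d" for m
        using Ge(1)[OF \<kappa>0[OF that]] unfolding et_def by (simp add: ring_distribs add.assoc)
      show "0 < e (d * r m + s) l" if "m < d" "l < N" for m l
        using et_eig_pos[OF Ge(1)] \<kappa>0 that by simp
      show "adapted (G (d * r m + s) l)" if "m < d" "l < N" for m l using Ge(2) \<kappa>0 that by simp
    qed
    then have "h * LL s \<le> h * ?T" using h by (rule mult_left_mono)
    moreover have "h * ?T + h \<le> ent N (tau s) - ent N (tau (s + h))" by (rule tau_step[OF s h sp])
    moreover have "(\<Sum>m<d. ent N (et (d * r m + s)) - ent N (et (d * r m + (s + h)))) / d \<le> h * LL (s + h) + h"
    proof -
      have "(\<Sum>m<d. ent N (et (d * r m + s)) - ent N (et (d * r m + (s + h)))) / d
        \<le> (\<Sum>m<d. h * L (d * r m + (s + h)) + h) / d"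
      proof (intro divide_right_mono sum_mono)
        fix m assume "m \<in> {..<d}"
        then have k: "0 \<le> d * r m + s" using \<kappa>0 by simp
        then have "0 \<le> d * r m + s + h" using h by simp
        from et_step[OF k this Ge(1)[OF this]]
        show "ent N (et (d * r m + s)) - ent N (et (d * r m + (s + h))) \<le> h * L (d * r m + (s + h)) + h"
          by (simp add: L_def add.assoc)
      qed simp
      also have "\<dots> = h * LL (s + h) + h"
        using d by (simp add: LL_def sum.distrib sum_distrib_left add_divide_distrib)
      finally show ?thesis .
    qed
    ultimately show ?thesis by (simp add: gap_def sum_subtractf diff_divide_distrib algebra_simps)
  qed
  have tel: "h * (LL 0 - LL (real n * h)) \<le> gap 0 - gap (real n * h)" if h: "0 \<le> h" for h n
  proof (induction n)
    case (Suc n)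
    have "h * (LL (real n * h) - LL (real n * h + h)) \<le> gap (real n * h) - gap (real n * h + h)"
      using h by (intro step) auto
    with Suc show ?case by (simp add: algebra_simps)
  qed simp
  have "0 \<le> gap 0 - gap b"
  proof (rule nonneg_if_ge_inverse[of "- (b * (LL 0 - LL b))"])
    fix n
    have e: "real (Suc n) * (b / real (Suc n)) = b" by simp
    show "- (- (b * (LL 0 - LL b))) * inverse (real (Suc n)) \<le> gap 0 - gap b"
      using tel[of "b / real (Suc n)" "Suc n"] b unfolding e by (simp add: divide_inverse mult_ac)
  qed
  then show ?thesis by simp
qed

text \<open>The relative entropy of \<open>tau b\<close> with respect to its pinching equals the
  difference of their entropies. Joint convexity bounds it by the relative entropy of scalar
  weights, which is of order \<open>1 / b\<close>. The pinched entropy in turn dominates the average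
  of the \<open>ent N (et (d * r m + b))\<close> by tangent bounds at \<open>c0\<close>, whose
  linear terms cancel because the \<open>d * r m\<close> average to \<open>R\<close>.\<close>

lemma gap_lower_bound:
  assumes b: "0 < b"
  shows "- ((\<Sum>m<d. (d * r m - R)\<^sup>2) / d) / b \<le> gap b"
proof -
  let ?q = "(\<Sum>m<d. (d * r m - R)\<^sup>2) / d"
  have R0: "0 \<le> R" unfolding R_def by (intro sum_nonneg) (simp add: r)
  \<comment> \<open>\<open>et c0\<close> is the pinching of \<open>tau b\<close>: each X^m \<rho>'
    X^-m is pinched to \<open>DD\<close>, so \<open>AA\<close> contributes \<open>R\<close> and
    \<open>b * DD + Y\<close> stays unchanged.\<close>
  define c0 where "c0 = R + b"
  have c0: "0 < c0" using R0 b by (simp add: c0_def)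
  obtain G e where sG: "spec N (et c0) G e" and ad: "\<And>l. l < N \<Longrightarrow> adapted (G l)"
    using ex_adapted[of c0] c0 unfolding et_def by auto
  obtain E t where sE: "spec N (tau b) E t" using ex_tau[of b] b by auto
  obtain U y where sU: "spec N Y U y" and y: "\<And>i. i < N \<Longrightarrow> 0 \<le> y i"
    using ex_spec[OF Y_im Y_nonneg] by auto
  have e: "\<And>l. l < N \<Longrightarrow> 0 < e l" using et_eig_pos[OF sG] c0 by simp
  have t: "\<And>l. l < N \<Longrightarrow> 0 < t l" using tau_eig_pos[OF sE] b by simp
  \<comment> \<open>\<open>tau b\<close> and \<open>et c0\<close> are written over one family of
    vectors: the \<open>V z\<close> and, for the common summand \<open>Y\<close>, its eigenvectors
    \<open>U\<close>. There the ratio \<kappa> of the weights is 1, so \<open>Y\<close> contributes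
    nothing to the bound.\<close>
  define I where "I = idx <+> {..<N}"
  define V' where "V' = case_sum V U"
  define w where "w = case_sum (\<lambda>z :: nat \<times> nat. (r (fst z) + b / d) * \<alpha> (snd z)) y"
  define c where "c = case_sum (\<lambda>z :: nat \<times> nat. c0 / d * \<alpha> (snd z)) y"
  define \<kappa> where "\<kappa> = case_sum (\<lambda>z :: nat \<times> nat. (d * r (fst z) + b) / c0) (\<lambda>_::nat. 1)"
  have fin: "finite idx" by (simp add: idx_def)
  have tau_V: "tau b x1 y1 = (\<Sum>z\<in>I. of_real (w z) * V' z x1 * cnj (V' z y1))" if "x1 < N" "y1 < N" for x1 y1
  proof -
    have "(\<Sum>z\<in>I. of_real (w z) * V' z x1 * cnj (V' z y1))
      = (\<Sum>z\<in>idx. of_real ((r (fst z) + b / d) * \<alpha> (snd z)) * V z x1 * cnj (V z y1)) + Y x1 y1"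
      unfolding I_def using fin sU that by (simp add: sum.Plus w_def V'_def spec_def)
    also have "(\<Sum>z\<in>idx. of_real ((r (fst z) + b / d) * \<alpha> (snd z)) * V z x1 * cnj (V z y1))
      = AA x1 y1 + of_real b * DD x1 y1"
      unfolding AA_def DD_def sum_distrib_left sum.distrib[symmetric]
      by (intro sum.cong refl) (simp add: algebra_simps)
    finally show ?thesis by (simp add: tau_def add.assoc)
  qed
  have et_V: "et c0 x1 y1 = (\<Sum>z\<in>I. of_real (c z) * V' z x1 * cnj (V' z y1))" if "x1 < N" "y1 < N" for x1 y1
  proof -
    have "(\<Sum>z\<in>I. of_real (c z) * V' z x1 * cnj (V' z y1))
      = (\<Sum>z\<in>idx. of_real (c0 / d * \<alpha> (snd z)) * V z x1 * cnj (V z y1)) + Y x1 y1"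
      unfolding I_def using fin sU that by (simp add: sum.Plus c_def V'_def spec_def)
    also have "(\<Sum>z\<in>idx. of_real (c0 / d * \<alpha> (snd z)) * V z x1 * cnj (V z y1)) = of_real c0 * DD x1 y1"
      unfolding DD_def sum_distrib_left by (intro sum.cong refl) (simp add: algebra_simps)
    finally show ?thesis by (simp add: et_def)
  qed
  define nv where "nv z = (\<Sum>x<N. cmod2 (V' z x))" for z
  interpret C: spectral_coordinates I "{..<N}" "{..<N}" w c \<kappa> nv
    "\<lambda>z i. ip N (E i) (V' z)" "\<lambda>z l. ip N (G l) (V' z)" t e "\<lambda>l i. ip N (G l) (E i)"
  proof
    show "finite I" using fin by (simp add: I_def)
    show "0 \<le> c z" if "z \<in> I" for z
      using that c0 \<alpha> y by (auto simp: I_def idx_def c_def)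
    show "0 \<le> \<kappa> z" if "z \<in> I" for z
      using that c0 r b by (auto simp: I_def idx_def \<kappa>_def)
    show "w z = \<kappa> z * c z" if "z \<in> I" for z
      using that c0 d by (auto simp: I_def idx_def w_def c_def \<kappa>_def field_simps)
    show "(\<Sum>i<N. cmod2 (ip N (E i) (V' z))) = nv z" for z
      unfolding nv_def by (rule parseval_norm[OF spec_onb[OF sE]])
    show "(\<Sum>i<N. cmod2 (ip N (G i) (V' z))) = nv z" for z
      unfolding nv_def by (rule parseval_norm[OF spec_onb[OF sG]])
    show "(\<Sum>z\<in>I. of_real (w z) * ip N (E i) (V' z) * cnj (ip N (E i') (V' z))) = (if i = i' then of_real (t i) else 0)"
      if "i \<in> {..<N}" "i' \<in> {..<N}" for i i'
      using spec_diag[OF sE] that by (simp flip: mform_rank_one_sum[OF tau_V])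
    show "(\<Sum>z\<in>I. of_real (c z) * ip N (G i) (V' z) * cnj (ip N (G i') (V' z))) = (if i = i' then of_real (e i) else 0)"
      if "i \<in> {..<N}" "i' \<in> {..<N}" for i i'
      using spec_diag[OF sG] that by (simp flip: mform_rank_one_sum[OF et_V])
    show "(\<Sum>z\<in>I. of_real (w z) * cnj (ip N (E i) (V' z)) * ip N (G l) (V' z)) = of_real (t i) * ip N (G l) (E i)"
      if "l \<in> {..<N}" "i \<in> {..<N}" for l i
    proof -
      have "(\<Sum>z\<in>I. of_real (w z) * cnj (ip N (E i) (V' z)) * ip N (G l) (V' z)) = mform N (tau b) (G l) (E i)"
        by (subst mform_rank_one_sum[where M = "tau b", OF tau_V]) (simp_all add: mult_ac)
      also have "\<dots> = (\<Sum>j<N. if j = i then of_real (t i) * ip N (G l) (E i) else 0)"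
        unfolding spec_form[OF sE]
        by (intro sum.cong refl) (use that orthonormal_ip[OF spec_onb[OF sE]] in auto)
      finally show ?thesis using that by simp
    qed
    show "(\<Sum>l<N. cmod2 (ip N (G l) (E i))) = 1" if "i \<in> {..<N}" for i
      unfolding parseval_norm[OF spec_onb[OF sG]] using orthonormal_norm[OF spec_onb[OF sE]] that by simp
  qed auto
  \<comment> \<open>In an adapted basis \<open>tau b\<close> and its pinching have the same
    diagonal. This makes the trace of \<open>tau b\<close> against the logarithm of
    \<open>et c0\<close> equal to minus the entropy of \<open>et c0\<close>.\<close>
  have diag: "Re (mform N (tau b) (G l) (G l)) = e l" if l: "l < N" for l
  proof -
    have "(\<Sum>m<d. r m * P m (G l)) = R * Re (mform N DD (G l) (G l))"
      using ad[OF l] by (simp add: adapted_def R_def sum_distrib_right)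
    then have "Re (mform N (tau b) (G l) (G l)) = Re (mform N (et c0) (G l) (G l))"
      by (simp add: form_tau form_et form_AA_self c0_def algebra_simps)
    then show ?thesis using spec_diag[OF sG l l] by simp
  qed
  let ?c = "\<lambda>l i. cmod2 (ip N (G l) (E i))"
  have lhs: "(\<Sum>l<N. \<Sum>i<N. t i * ?c l i * (ln (t i) - ln (e l)))
     = - ent N (tau b) + ent N (et c0)"
  proof -
    have "(\<Sum>l<N. \<Sum>i<N. t i * ?c l i * (ln (t i) - ln (e l)))
      = (\<Sum>l<N. \<Sum>i<N. t i * ln (t i) * ?c l i)
       - (\<Sum>l<N. (\<Sum>i<N. t i * ?c l i) * ln (e l))"
      unfolding sum_distrib_right sum_subtractf[symmetric]
      by (intro sum.cong refl) (simp add: algebra_simps)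
    also have "(\<Sum>l<N. \<Sum>i<N. t i * ln (t i) * ?c l i) = (\<Sum>i<N. t i * ln (t i))"
      by (subst sum.swap) (simp add: sum_distrib_left[symmetric] C.Mcol)
    also have "(\<Sum>l<N. (\<Sum>i<N. t i * ?c l i) * ln (e l)) = (\<Sum>l<N. e l * ln (e l))"
    proof (intro sum.cong refl)
      fix l assume "l \<in> {..<N}"
      then have "(\<Sum>i<N. t i * ?c l i) = e l"
        using diag[of l] spec_form_re[OF sE, of "G l"] by (simp add: cmod_ip_commute[of N "G l"])
      then show "(\<Sum>i<N. t i * ?c l i) * ln (e l) = e l * ln (e l)" by simp
    qed
    finally show ?thesis using ent_ref[OF sE] ent_ref[OF sG] t e by (simp add: less_imp_le)
  qed
  have rhs: "(\<Sum>z\<in>I. nv z * w z * ln (\<kappa> z)) = (\<Sum>m<d. (r m + b / d) * ln ((d * r m + b) / c0))"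
  proof -
    have "(\<Sum>z\<in>I. nv z * w z * ln (\<kappa> z))
      = (\<Sum>m<d. \<Sum>k<N. \<alpha> k * (\<Sum>x<N. cmod2 (v m k x)) * ((r m + b / d) * ln ((d * r m + b) / c0)))"
      unfolding I_def using fin
      by (simp add: sum.Plus w_def \<kappa>_def nv_def V'_def sum_idx V_def mult_ac)
    then show ?thesis by (simp add: sum_distrib_right[symmetric] tr)
  qed
  have "(\<Sum>m<d. (r m + b / d) * ln ((d * r m + b) / c0)) \<le> (\<Sum>m<d. (r m + b / d) * ((d * r m + b) / c0 - 1))"
  proof (intro sum_mono mult_left_mono ln_le_minus_one)
    fix m assume "m \<in> {..<d}"
    then have "0 \<le> r m" using r by simp
    then show "0 < (d * r m + b) / c0" "0 \<le> r m + b / d" using b c0 by (simp_all add: add_nonneg_pos)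
  qed
  \<comment> \<open>The deviations of the \<open>d * r m\<close> from their mean \<open>R\<close>
    sum to zero, so only their squares remain.\<close>
  also have "\<dots> = ?q / c0"
  proof -
    have "(r m + b / d) * ((d * r m + b) / c0 - 1) = (d * r m - R)\<^sup>2 / d / c0 + (r m - R / d)" for m
    proof -
      have 1: "r m + b / d = (d * r m - R + c0) / d" using d by (simp add: c0_def field_simps)
      have 2: "(d * r m + b) / c0 - 1 = (d * r m - R) / c0" using c0 by (simp add: c0_def field_simps)
      show ?thesis unfolding 1 2 using d c0 by (simp add: power2_eq_square field_simps)
    qed
    moreover have "(\<Sum>m<d. r m - R / d) = 0" using d by (simp add: sum_subtractf R_def)
    ultimately show ?thesis by (simp add: sum.distrib sum_divide_distrib)
  qed
  also have "\<dots> \<le> ?q / b"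
    using R0 b by (intro divide_left_mono) (auto simp: c0_def sum_nonneg intro!: mult_pos_pos add_nonneg_pos)
  finally have low: "ent N (et c0) - ?q / b \<le> ent N (tau b)"
    using C.relative_entropy_bound unfolding lhs rhs by simp
  have "(\<Sum>m<d. ent N (et (d * r m + b))) \<le> (\<Sum>m<d. ent N (et c0)
     - (d * r m - R) * (\<Sum>l<N. Re (mform N DD (G l) (G l)) * ln (e l)) - (d * r m - R))"
  proof (rule sum_mono)
    fix m assume "m \<in> {..<d}"
    then have k0: "0 \<le> d * r m + b" using r b by simp
    show "ent N (et (d * r m + b)) \<le> ent N (et c0)
      - (d * r m - R) * (\<Sum>l<N. Re (mform N DD (G l) (G l)) * ln (e l)) - (d * r m - R)"
      using et_step[OF k0 less_imp_le[OF c0] sG] by (simp add: c0_def)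
  qed
  also have "\<dots> = d * ent N (et c0)"
  proof -
    have "(\<Sum>m<d. d * r m - R) = 0" using d by (simp add: sum_subtractf R_def sum_distrib_left)
    then show ?thesis by (simp add: sum_subtractf sum_distrib_right[symmetric])
  qed
  finally have "(\<Sum>m<d. ent N (et (d * r m + b))) / d \<le> ent N (et c0)"
    using d by (simp add: divide_le_eq mult.commute)
  then show ?thesis using low by (simp add: gap_def)
qed

lemma entropy_phase_mixture:
  "(\<Sum>m<d. ent N (\<lambda>x y. of_real (d * r m) * DD x y + Y x y)) / d \<le> ent N (\<lambda>x y. AA x y + Y x y)"
proof -
  have "0 \<le> gap 0"
  proof (rule nonneg_if_ge_inverse[of "(\<Sum>m<d. (d * r m - R)\<^sup>2) / d"])
    fix n
    show "- ((\<Sum>m<d. (d * r m - R)\<^sup>2) / d) * inverse (real (Suc n)) \<le> gap 0"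
      using gap_lower_bound[of "real (Suc n)"] gap_antimono[of "real (Suc n)"] by (simp add: divide_inverse)
  qed
  then show ?thesis by (simp add: gap_def tau_def et_def)
qed

end

section \<open>Discrete Fourier transform\<close>

lemma sum_div_mod:
  fixes F :: "nat \<Rightarrow> nat \<Rightarrow> 'a :: comm_monoid_add"
  shows "(\<Sum>x<d * K. F (x div K) (x mod K)) = (\<Sum>i<d. \<Sum>a<K. F i a)"
proof (cases "K = 0")
  case False
  have "(\<Sum>i<d. \<Sum>a<K. F i a) = (\<Sum>z\<in>{..<d} \<times> {..<K}. F (fst z) (snd z))"
    by (simp add: sum.cartesian_product case_prod_unfold)
  also have "\<dots> = (\<Sum>x<d * K. F (x div K) (x mod K))"
  proof (rule sum.reindex_bij_witness[of _ "\<lambda>x. (x div K, x mod K)" "\<lambda>z. fst z * K + snd z"])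
    fix z assume z: "z \<in> {..<d} \<times> {..<K}"
    then show "(\<lambda>x. (x div K, x mod K)) (fst z * K + snd z) = z" by auto
    from z have "fst z * K + snd z < fst z * K + K" by auto
    also have "\<dots> = Suc (fst z) * K" by simp
    also have "\<dots> \<le> d * K" using z by (intro mult_right_mono) auto
    finally show "fst z * K + snd z \<in> {..<d * K}" by simp
    show "F ((fst z * K + snd z) div K) ((fst z * K + snd z) mod K) = F (fst z) (snd z)" using z by auto
  qed (use False in \<open>auto simp: less_mult_imp_div_less\<close>)
  finally show ?thesis by simp
qed simp

text \<open>By completeness of \<open>G\<close>, unit vectors are combinations of the
  \<open>G l\<close>, so the matrix elements in this basis determine every entry of
  \<open>M\<close>.\<close>

lemma spec_from_forms:
  assumes on: "orthonormal_upto n n G"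
    and form: "\<And>l l'. l < n \<Longrightarrow> l' < n \<Longrightarrow> mform n M (G l) (G l') = (if l = l' then of_real (e l) else 0)"
  shows "spec n M G e"
proof -
  have "M x y = (\<Sum>i<n. of_real (e i) * G i x * cnj (G i y))" if xy: "x < n" "y < n" for x y
  proof -
    let ?s = "\<lambda>x (a::nat). \<Sum>l<n. cnj (G l x) * G l a"
    have s: "?s x a = (if a = x then 1 else 0)" if "a < n" "x < n" for a x
      using orthonormal_complete[OF on that] by (simp add: mult.commute)
    have "mform n M (\<lambda>a. ?s x a) (\<lambda>a. ?s y a) = (\<Sum>a<n. \<Sum>b<n. if b = y then (if a = x then M a b else 0) else 0)"
      unfolding mform_def using xy by (intro sum.cong refl) (simp add: s)
    also have "\<dots> = M x y" using xy by simp
    finally have "M x y = mform n M (\<lambda>a. ?s x a) (\<lambda>a. ?s y a)" by simp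
    also have "\<dots> = (\<Sum>l<n. \<Sum>l'<n. cnj (cnj (G l x)) * cnj (G l' y) * mform n M (G l) (G l'))"
      by (rule mform_expand)
    also have "\<dots> = (\<Sum>l<n. \<Sum>l'<n. if l' = l then of_real (e l) * G l x * cnj (G l y) else 0)"
      by (intro sum.cong refl) (auto simp: form)
    finally show ?thesis by simp
  qed
  then show ?thesis using on by (simp add: spec_def)
qed

section \<open>Roots of unity and the Fourier basis\<close>

definition root1 :: "nat \<Rightarrow> complex" where "root1 d = cis (2 * pi / d)"

lemma root1_power_self: "0 < d \<Longrightarrow> root1 d ^ d = 1"
  by (simp add: root1_def DeMoivre)

lemma root1_power_mod: assumes "0 < d" shows "root1 d ^ (a mod d) = root1 d ^ a"
proof -
  have "root1 d ^ a = root1 d ^ (d * (a div d) + a mod d)" by simp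
  also have "\<dots> = root1 d ^ (a mod d)" by (simp only: power_add power_mult root1_power_self[OF assms] power_one mult_1_left)
  finally show ?thesis by simp
qed

lemma root1_cnj: "cnj (root1 d) * root1 d = 1"
  by (simp add: root1_def cis_cnj cis_mult)

lemma root1_cnj_power: "cnj (root1 d) ^ a * root1 d ^ a = 1"
  by (simp add: power_mult_distrib[symmetric] root1_cnj)

lemma root1_power_neq: assumes "0 < a" "a < d" shows "root1 d ^ a \<noteq> 1"
proof
  assume "root1 d ^ a = 1"
  then have "Re (cis (real a * (2 * pi / real d))) = 1" by (simp add: root1_def DeMoivre)
  then have "cos (real a * (2 * pi / real d)) = 1" by simp
  then obtain n :: int where "real a * (2 * pi / real d) = n * 2 * pi" using cos_one_2pi_int by auto
  then have "real a = of_int n * real d" using assms by (simp add: field_simps)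
  then have "of_int (int a) = (of_int (n * int d) :: real)" by simp
  then have "int a = n * int d" by (simp only: of_int_eq_iff)
  then show False using assms by (metis dvd_triv_right int_dvd_int_iff nat_dvd_not_less)
qed

lemma root1_sum:
  assumes "j < d" "j' < d"
  shows "(\<Sum>m<d. cnj (root1 d) ^ (j * m) * root1 d ^ (j' * m)) = (if j = j' then of_nat d else 0)"
proof (cases "j = j'")
  case True then show ?thesis by (simp add: root1_cnj_power)
next
  case False
  define z where "z = cnj (root1 d) ^ j * root1 d ^ j'"
  have d: "0 < d" using assms by simp
  have "z \<noteq> 1"
  proof
    assume z: "z = 1"
    show False
    proof (cases "j < j'")
      case True
      then have "z = cnj (root1 d) ^ j * root1 d ^ j * root1 d ^ (j' - j)"
        by (simp add: z_def mult.assoc power_add[symmetric])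
      then show False using z root1_power_neq[of "j' - j" d] True assms by (simp add: root1_cnj_power)
    next
      case False
      then have lt: "j' < j" using \<open>j \<noteq> j'\<close> by simp
      then have "z = cnj (root1 d) ^ (j - j') * (cnj (root1 d) ^ j' * root1 d ^ j')"
        by (simp add: z_def mult.assoc[symmetric] power_add[symmetric])
      then have "cnj (root1 d ^ (j - j')) = 1" using z by (simp add: root1_cnj_power)
      then have "root1 d ^ (j - j') = 1" by (metis complex_cnj_cnj complex_cnj_one)
      then show False using root1_power_neq[of "j - j'" d] lt assms by simp
    qed
  qed
  have "z ^ d = cnj (root1 d ^ d) ^ j * (root1 d ^ d) ^ j'"
    unfolding z_def power_mult_distrib complex_cnj_power
    by (simp add: power_mult[symmetric] mult.commute)
  then have zd: "z ^ d = 1" by (simp add: root1_power_self[OF d])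
  have "(\<Sum>m<d. cnj (root1 d) ^ (j * m) * root1 d ^ (j' * m)) = (\<Sum>m<d. z ^ m)"
    by (simp add: z_def power_mult_distrib power_mult)
  also have "\<dots> = 0" using \<open>z \<noteq> 1\<close> zd by (simp add: geometric_sum)
  finally show ?thesis using False by simp
qed

text \<open>\<open>fourier d j\<close> is the eigenvector of the cyclic shift
  \<open>|k> -> |k + 1>\<close> for the eigenvalue \<open>cnj (root1 d) ^ j\<close>.\<close>

definition fourier :: "nat \<Rightarrow> nat \<Rightarrow> nat \<Rightarrow> complex" where
  "fourier d j k = root1 d ^ (j * k) / of_real (sqrt d)"

lemma fourier_orthonormal: "orthonormal_upto d d (fourier d)"
  unfolding orthonormal_upto_def
proof (intro allI impI)
  fix i j assume ij: "i < d" "j < d"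
  have "complex_of_real (sqrt d) * complex_of_real (sqrt d) = of_nat d"
    by (simp flip: of_real_mult)
  then have "(\<Sum>x<d. cnj (fourier d i x) * fourier d j x)
    = (\<Sum>x<d. cnj (root1 d) ^ (i * x) * root1 d ^ (j * x)) / of_nat d"
    by (simp add: fourier_def sum_divide_distrib)
  then show "(\<Sum>x<d. cnj (fourier d i x) * fourier d j x) = (if i = j then 1 else 0)"
    using root1_sum[OF ij] ij by simp
qed

lemma fourier_cmod: "cmod2 (fourier d j k) = 1 / d"
  by (simp add: fourier_def root1_def norm_divide norm_power power_divide)

text \<open>For \<open>n \<le> d\<close> this is \<open>j - n\<close> modulo \<open>d\<close>;
  adding \<open>d - n\<close> avoids truncated subtraction.\<close>

definition shift :: "nat \<Rightarrow> nat \<Rightarrow> nat \<Rightarrow> nat" where "shift d n j = (j + (d - n)) mod d"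

lemma shift_less: "0 < d \<Longrightarrow> shift d n j < d"
  by (simp add: shift_def)

lemma shift_0: "j < d \<Longrightarrow> shift d 0 j = j"
  by (simp add: shift_def)

lemma sum_shift:
  fixes F :: "nat \<Rightarrow> 'a :: comm_monoid_add"
  assumes "n < d"
  shows "(\<Sum>j<d. F (shift d n j)) = (\<Sum>j<d. F j)"
proof (rule sum.reindex_bij_witness[of _ "\<lambda>j. (j + n) mod d" "shift d n"])
  fix a assume "a \<in> {..<d}"
  then have a: "a < d" by simp
  have "(shift d n a + n) mod d = (a + (d - n) + n) mod d" unfolding shift_def by (rule mod_add_left_eq)
  also have "\<dots> = a" using a assms by simp
  finally show "(shift d n a + n) mod d = a" .
  have "shift d n ((a + n) mod d) = (a + n + (d - n)) mod d" unfolding shift_def by (rule mod_add_left_eq)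
  also have "\<dots> = a" using a assms by simp
  finally show "shift d n ((a + n) mod d) = a" .
  show "(a + n) mod d \<in> {..<d}" "shift d n a \<in> {..<d}" using a by (auto simp: shift_def)
qed simp

lemma weyl_entry:
  assumes "i < d" "k < d"
  shows "weyl d m n $$ (i, k) = (if i = (k + m) mod d then root1 d ^ (k * n) else 0)"
proof -
  have "root1 d ^ (k * n) = exp (of_nat (k * n) * (\<i> * of_real (2 * pi / d)))"
    unfolding root1_def cis_conv_exp by (rule exp_of_nat_mult[symmetric])
  also have "of_nat (k * n) * (\<i> * of_real (2 * pi / d)) = 2 * of_real pi * \<i> * of_nat k * of_nat n / (of_nat d :: complex)"
    by simp
  finally show ?thesis using assms by (simp add: weyl_def)
qed

text \<open>\<open>weyl d m n\<close> is the \<open>m\<close>-th power of the shift after the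
  \<open>n\<close>-th power of the clock operator. The shift multiplies a Fourier vector by a phase,
  the clock moves it to another Fourier vector; the equation is component \<open>i\<close> of this
  action on the bra of \<open>fourier d j\<close>.\<close>

lemma fourier_shift:
  assumes "n < d"
  shows "cnj (fourier d j ((i + m) mod d)) * root1 d ^ (i * n) = cnj (root1 d) ^ (j * m) * cnj (fourier d (shift d n j) i)"
proof -
  have d: "0 < d" using assms by simp
  let ?w = "root1 d"
  have 1: "cnj ?w ^ (j * ((i + m) mod d)) = cnj ?w ^ (j * m) * cnj ?w ^ (j * i)"
  proof -
    have "?w ^ (j * ((i + m) mod d)) = ?w ^ (j * (i + m))"
      by (metis d mod_mult_right_eq root1_power_mod)
    then have "cnj (?w ^ (j * ((i + m) mod d))) = cnj (?w ^ (j * (i + m)))" by simp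
    then show ?thesis by (simp add: power_add[symmetric] algebra_simps)
  qed
  have 2: "?w ^ (shift d n j * i) * ?w ^ (i * n) = ?w ^ (j * i)"
  proof -
    have "?w ^ (shift d n j * i) = ?w ^ ((j + (d - n)) * i)"
      unfolding shift_def by (metis d mod_mult_left_eq root1_power_mod)
    then have "?w ^ (shift d n j * i) * ?w ^ (i * n) = ?w ^ ((j + (d - n)) * i + i * n)"
      by (simp add: power_add)
    also have "(j + (d - n)) * i + i * n = d * i + j * i"
    proof -
      obtain c where "d = n + c" using assms less_imp_add_positive by blast
      then show ?thesis by (simp add: algebra_simps)
    qed
    finally show ?thesis by (simp add: power_add power_mult root1_power_self[OF d])
  qed
  have 3: "cnj ?w ^ (j * i) * ?w ^ (i * n) = cnj ?w ^ (shift d n j * i)"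
  proof -
    have "cnj (?w ^ (j * i)) * ?w ^ (i * n) = cnj (?w ^ (shift d n j * i)) * (cnj ?w ^ (i * n) * ?w ^ (i * n))"
      unfolding 2[symmetric] by simp
    then show ?thesis by (simp add: root1_cnj_power)
  qed
  have "cnj (fourier d j ((i + m) mod d)) * ?w ^ (i * n) = cnj ?w ^ (j * m) * (cnj ?w ^ (j * i) * ?w ^ (i * n)) / of_real (sqrt d)"
    by (simp add: fourier_def 1)
  then show ?thesis unfolding 3 by (simp add: fourier_def)
qed

section \<open>Output of the Weyl channel\<close>

definition tens :: "nat \<Rightarrow> (nat \<Rightarrow> complex) \<Rightarrow> (nat \<Rightarrow> complex) \<Rightarrow> nat \<Rightarrow> complex" where
  "tens K f g x = f (x div K) * g (x mod K)"

lemma ip_tens: "ip (d * K) (tens K f g) (tens K f' g') = ip d f f' * ip K g g'"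
proof -
  have "ip (d * K) (tens K f g) (tens K f' g') = (\<Sum>i<d. \<Sum>a<K. (cnj (f i) * f' i) * (cnj (g a) * g' a))"
    unfolding ip_def tens_def sum_div_mod[where F = "\<lambda>i a. (cnj (f i) * f' i) * (cnj (g a) * g' a)", symmetric]
    by (simp add: mult_ac)
  then show ?thesis by (simp add: ip_def sum_product)
qed

lemma orthonormal_tens:
  assumes f: "orthonormal_upto d d f" and g: "\<And>j. j < d \<Longrightarrow> orthonormal_upto K K (g j)"
  shows "orthonormal_upto (d * K) (d * K) (\<lambda>l. tens K (f (l div K)) (g (l div K) (l mod K)))"
  unfolding orthonormal_upto_def
proof (intro allI impI)
  fix l l' assume l: "l < d * K" "l' < d * K"
  then have K: "0 < K" by (cases K) auto
  have dm: "l div K < d" "l' div K < d" "l mod K < K" "l' mod K < K"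
    using l K by (auto simp: less_mult_imp_div_less)
  have "l = l' \<longleftrightarrow> l div K = l' div K \<and> l mod K = l' mod K"
    by (metis div_mult_mod_eq)
  then show "(\<Sum>x<d * K. cnj (tens K (f (l div K)) (g (l div K) (l mod K)) x) * tens K (f (l' div K)) (g (l' div K) (l' mod K)) x)
    = (if l = l' then 1 else 0)"
    using orthonormal_ip[OF f dm(1,2)] orthonormal_ip[OF g[OF dm(1)] dm(3,4)]
    unfolding ip_def[symmetric] ip_tens by auto
qed

lemma orthonormal_standard: "orthonormal_upto n n (\<lambda>a x. if x = a then 1 else 0)"
  unfolding orthonormal_upto_def
proof (intro allI impI)
    fix i j assume ij: "i < n" "j < n"
    have "(\<Sum>x<n. cnj (if x = i then 1 else 0) * (if x = j then 1 else 0 :: complex))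
      = (\<Sum>x<n. if x = i then (if i = j then 1 else 0) else 0)"
      by (intro sum.cong refl) auto
    then show "(\<Sum>x<n. cnj (if x = i then 1 else 0) * (if x = j then 1 else 0 :: complex)) = (if i = j then 1 else 0)"
      using ij by simp
qed

text \<open>Merges the two sums of the channel into a single one over all pairs
  \<open>(m, n)\<close>.\<close>

definition weyl_wt :: "(nat \<Rightarrow> real) \<Rightarrow> (nat \<Rightarrow> real) \<Rightarrow> nat \<Rightarrow> nat \<Rightarrow> real" where
  "weyl_wt r p m n = (if n = 0 then r m else p n)"

lemma sum_weyl_wt_inner:
  assumes "0 < d" shows "(\<Sum>n<d. weyl_wt r p m n) = r m + (\<Sum>n\<in>{1..<d}. p n)"
proof -
  have split: "{..<d} = insert 0 {1..<d}" using assms by auto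
  show ?thesis unfolding split by (simp add: weyl_wt_def)
qed

lemma weyl_wt_nonneg:
  assumes "\<And>m. m < d \<Longrightarrow> 0 \<le> r m" "\<And>n. n \<in> {1..<d} \<Longrightarrow> 0 \<le> p n" "m < d" "n < d"
  shows "0 \<le> weyl_wt r p m n"
  using assms by (auto simp: weyl_wt_def)

text \<open>The diagonal block of \<open>M\<close> at the Fourier vector \<open>j\<close>. The
  factor \<open>d\<close> gives it trace 1 in the situation of interest, where the bare block has
  trace \<open>1 / d\<close>.\<close>

definition fourier_block :: "nat \<Rightarrow> nat \<Rightarrow> (nat \<Rightarrow> nat \<Rightarrow> complex) \<Rightarrow> nat \<Rightarrow> nat \<Rightarrow> nat \<Rightarrow> complex" where
  "fourier_block d K M j a b = of_nat d * (\<Sum>i<d. \<Sum>i'<d.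
    cnj (fourier d j i) * M (i * K + a) (i' * K + b) * fourier d j i')"

lemma form_tens_fourier_block:
  assumes d: "0 < d"
  shows "mform (d * K) M (tens K (fourier d j) g) (tens K (fourier d j) g')
    = mform K (fourier_block d K M j) g g' / of_nat d"
proof -
  let ?f = "fourier d j"
  have inner: "(\<Sum>y<d * K. c * M x y * tens K ?f g' y) = (\<Sum>i'<d. \<Sum>b<K. c * M x (i' * K + b) * (?f i' * g' b))" for c x
  proof -
    have "(\<Sum>y<d * K. c * M x y * tens K ?f g' y) = (\<Sum>y<d * K. c * M x (y div K * K + y mod K) * (?f (y div K) * g' (y mod K)))"
      by (simp add: tens_def)
    then show ?thesis by (simp only: sum_div_mod[where F = "\<lambda>i' b. c * M x (i' * K + b) * (?f i' * g' b)"])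
  qed
  let ?t = "\<lambda>i a i' b. cnj (?f i * g a) * M (i * K + a) (i' * K + b) * (?f i' * g' b)"
  have "mform (d * K) M (tens K ?f g) (tens K ?f g')
    = (\<Sum>x<d * K. \<Sum>i'<d. \<Sum>b<K. cnj (?f (x div K) * g (x mod K)) * M (x div K * K + x mod K) (i' * K + b) * (?f i' * g' b))"
    unfolding mform_def inner by (simp add: tens_def)
  also have "\<dots> = (\<Sum>i<d. \<Sum>a<K. \<Sum>i'<d. \<Sum>b<K. ?t i a i' b)"
    by (rule sum_div_mod)
  also have "\<dots> = (\<Sum>i<d. \<Sum>a<K. \<Sum>b<K. \<Sum>i'<d. ?t i a i' b)"
    by (intro sum.cong refl sum.swap)
  also have "\<dots> = (\<Sum>a<K. \<Sum>b<K. \<Sum>i<d. \<Sum>i'<d. ?t i a i' b)"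
    by (rule sum_swap3)
  also have "\<dots> = (\<Sum>a<K. \<Sum>b<K. cnj (g a) * (\<Sum>i<d. \<Sum>i'<d. cnj (?f i) * M (i * K + a) (i' * K + b) * ?f i') * g' b)"
    by (simp add: sum_distrib_left sum_distrib_right mult_ac)
  also have "\<dots> = mform K (fourier_block d K M j) g g' / of_nat d"
    unfolding mform_def fourier_block_def using d by (simp add: sum_divide_distrib mult_ac)
  finally show ?thesis .
qed

text \<open>\<open>rp\<close> stands for \<rho>' with its spectral decomposition. In this locale the
  map \<Omega> is hidden in \<open>rp\<close>, and the diagonal marginal is represented by
  \<open>uniform\<close>, which fixes the traces of the Fourier blocks.\<close>

locale weyl_output =
  fixes d K :: nat and r p :: "nat \<Rightarrow> real" and rp u :: "nat \<Rightarrow> nat \<Rightarrow> complex" and \<alpha> :: "nat \<Rightarrow> real"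
  assumes d: "0 < d" and K: "0 < K" and r: "\<And>m. m < d \<Longrightarrow> 0 \<le> r m"
    and p: "\<And>n. n \<in> {1..<d} \<Longrightarrow> 0 \<le> p n"
    and total: "real d * (\<Sum>n\<in>{1..<d}. p n) + (\<Sum>m<d. r m) = 1"
    and rp: "spec (d * K) rp u \<alpha>" and \<alpha>: "\<And>k. k < d * K \<Longrightarrow> 0 \<le> \<alpha> k"
    and uniform: "\<And>j. j < d \<Longrightarrow> (\<Sum>a<K. \<Sum>i<d. \<Sum>i'<d.
      cnj (fourier d j i) * rp (i * K + a) (i' * K + a) * fourier d j i') = 1 / of_nat d"
begin

definition N where "N = d * K"
text \<open>\<open>vv m n k\<close> is the Weyl operator on the first factor applied to the
  eigenvector \<open>u k\<close>, so that \<tau> is the output state. The \<open>lam m\<close> will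
  be the eigenvalues of the channel output at a basis state.\<close>

definition vv where "vv m n k x = (\<Sum>i<d. weyl d m n $$ (x div K, i) * u k (i * K + x mod K))"
definition \<tau> where "\<tau> x y = (\<Sum>m<d. \<Sum>n<d. \<Sum>k<N. of_real (weyl_wt r p m n * \<alpha> k) * vv m n k x * cnj (vv m n k y))"
definition blk where "blk = fourier_block d K rp"
definition lam where "lam m = r m + (\<Sum>n\<in>{1..<d}. p n)"

lemma sum_N: "(\<Sum>l<N. F (l div K) (l mod K)) = (\<Sum>j<d. \<Sum>a<K. F j a)"
  unfolding N_def by (rule sum_div_mod)

lemma ip_tens_u: "ip N (tens K f g) (u k) = (\<Sum>i<d. \<Sum>a<K. cnj (f i) * cnj (g a) * u k (i * K + a))"
proof -
  have "ip N (tens K f g) (u k) = (\<Sum>x<d * K. cnj (f (x div K)) * cnj (g (x mod K)) * u k (x div K * K + x mod K))"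
    by (simp add: ip_def tens_def N_def)
  then show ?thesis by (simp only: sum_div_mod[where F = "\<lambda>i a. cnj (f i) * cnj (g a) * u k (i * K + a)"])
qed

lemma ip_tens_vv:
  assumes "n < d"
  shows "ip N (tens K (fourier d j) g) (vv m n k)
    = cnj (root1 d) ^ (j * m) * ip N (tens K (fourier d (shift d n j)) g) (u k)"
proof -
  let ?f = "fourier d j"
  have "ip N (tens K ?f g) (vv m n k)
     = (\<Sum>x<d * K. cnj (?f (x div K)) * cnj (g (x mod K)) * (\<Sum>i<d. weyl d m n $$ (x div K, i) * u k (i * K + x mod K)))"
    by (simp add: ip_def tens_def N_def vv_def)
  also have "\<dots> = (\<Sum>i'<d. \<Sum>a<K. cnj (?f i') * cnj (g a) * (\<Sum>i<d. weyl d m n $$ (i', i) * u k (i * K + a)))"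
    by (rule sum_div_mod)
  also have "\<dots> = (\<Sum>i'<d. \<Sum>a<K. \<Sum>i<d. cnj (?f i') * weyl d m n $$ (i', i) * (cnj (g a) * u k (i * K + a)))"
    by (simp add: sum_distrib_left mult_ac)
  also have "\<dots> = (\<Sum>i<d. \<Sum>i'<d. \<Sum>a<K. cnj (?f i') * weyl d m n $$ (i', i) * (cnj (g a) * u k (i * K + a)))"
    by (rule sum_swap3[symmetric])
  also have "\<dots> = (\<Sum>i<d. (\<Sum>i'<d. cnj (?f i') * weyl d m n $$ (i', i)) * (\<Sum>a<K. cnj (g a) * u k (i * K + a)))"
    by (simp add: sum_product)
  also have "\<dots> = (\<Sum>i<d. (cnj (root1 d) ^ (j * m) * cnj (fourier d (shift d n j) i)) * (\<Sum>a<K. cnj (g a) * u k (i * K + a)))"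
  proof (intro sum.cong refl arg_cong2[where f = "(*)"])
    fix i assume "i \<in> {..<d}"
    then have i: "i < d" by simp
    have "(\<Sum>i'<d. cnj (?f i') * weyl d m n $$ (i', i))
      = (\<Sum>i'<d. if i' = (i + m) mod d then cnj (?f i') * root1 d ^ (i * n) else 0)"
      by (intro sum.cong refl) (simp add: weyl_entry i)
    also have "\<dots> = cnj (?f ((i + m) mod d)) * root1 d ^ (i * n)" using d by simp
    finally show "(\<Sum>i'<d. cnj (?f i') * weyl d m n $$ (i', i)) = cnj (root1 d) ^ (j * m) * cnj (fourier d (shift d n j) i)"
      unfolding fourier_shift[OF assms] .
  qed
  also have "\<dots> = cnj (root1 d) ^ (j * m) * ip N (tens K (fourier d (shift d n j)) g) (u k)"
    unfolding ip_tens_u by (simp add: sum_distrib_left mult_ac)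
  finally show ?thesis .
qed

lemma root1_unit: "cmod (root1 d) = 1"
  by (simp add: root1_def)

lemma cmod_ip_tens_vv:
  "n < d \<Longrightarrow> cmod (ip N (tens K (fourier d j) g) (vv m n k)) = cmod (ip N (tens K (fourier d (shift d n j)) g) (u k))"
  by (simp add: ip_tens_vv norm_mult norm_power root1_unit)

lemma form_rp_u: "mform N rp f g = (\<Sum>k<N. of_real (\<alpha> k) * ip N f (u k) * cnj (ip N g (u k)))"
  using spec_form[OF rp] by (simp add: N_def)

lemma form_rp_tens: "mform N rp (tens K (fourier d j) g) (tens K (fourier d j) g') = mform K (blk j) g g' / of_nat d"
  unfolding N_def blk_def by (rule form_tens_fourier_block[OF d])

lemma blk_im: "Im (mform K (blk j) g g) = 0" and blk_re: "0 \<le> Re (mform K (blk j) g g)"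
proof -
  have "mform K (blk j) g g = of_nat d * mform N rp (tens K (fourier d j) g) (tens K (fourier d j) g)"
    using d by (simp add: form_rp_tens)
  also have "\<dots> = of_real (d * (\<Sum>i<N. \<alpha> i * cmod2 (ip N (u i) (tens K (fourier d j) g))))"
    using spec_form_re[OF rp] by (simp add: N_def)
  finally have *: "mform K (blk j) g g = of_real (d * (\<Sum>i<N. \<alpha> i * cmod2 (ip N (u i) (tens K (fourier d j) g))))" .
  show "Im (mform K (blk j) g g) = 0" unfolding * by (rule Im_complex_of_real)
  show "0 \<le> Re (mform K (blk j) g g)"
    unfolding * Re_complex_of_real by (intro mult_nonneg_nonneg sum_nonneg) (auto simp: \<alpha> N_def)
qed

lemma trace_blk: "j < d \<Longrightarrow> (\<Sum>a<K. blk j a a) = 1"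
  unfolding blk_def fourier_block_def sum_distrib_left[symmetric] using uniform[of j] d by simp

text \<open>Summing over \<open>m\<close> the phases picked up from the shift annihilates the
  off-diagonal Fourier blocks and multiplies the diagonal ones by \<open>d\<close>, which cancels
  against the normalisation of \<open>blk\<close>. The clock power \<open>n\<close> has moved block
  \<open>shift d n j\<close> into position \<open>j\<close>.\<close>

lemma phase_average:
  assumes j: "j < d" "j' < d" and n: "n < d"
  shows "(\<Sum>m<d. \<Sum>k<N. of_real (\<alpha> k) * ip N (tens K (fourier d j) g) (vv m n k)
      * cnj (ip N (tens K (fourier d j') g') (vv m n k)))
    = (if j = j' then mform K (blk (shift d n j)) g g' else 0)"
proof -
  let ?F = "\<lambda>j g. tens K (fourier d (shift d n j)) g"
  have "(\<Sum>m<d. \<Sum>k<N. of_real (\<alpha> k) * ip N (tens K (fourier d j) g) (vv m n k)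
      * cnj (ip N (tens K (fourier d j') g') (vv m n k)))
    = (\<Sum>m<d. (cnj (root1 d) ^ (j * m) * root1 d ^ (j' * m)) * mform N rp (?F j g) (?F j' g'))"
    unfolding form_rp_u ip_tens_vv[OF n] by (simp add: sum_distrib_left mult_ac)
  also have "\<dots> = (\<Sum>m<d. cnj (root1 d) ^ (j * m) * root1 d ^ (j' * m)) * mform N rp (?F j g) (?F j' g')"
    by (simp add: sum_distrib_right)
  finally show ?thesis using root1_sum[OF j] d by (simp add: form_rp_tens)
qed

lemma trace_rp: "(\<Sum>k<N. \<alpha> k) = 1"
proof -
  obtain s :: "nat \<Rightarrow> nat \<Rightarrow> complex" where s: "orthonormal_upto K K s"
    using orthonormal_standard by blast
  have on: "orthonormal_upto N N (\<lambda>l. tens K (fourier d (l div K)) (s (l mod K)))"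
    unfolding N_def by (rule orthonormal_tens[OF fourier_orthonormal s])
  have "complex_of_real (\<Sum>k<N. \<alpha> k) = (\<Sum>l<N. mform N rp (tens K (fourier d (l div K)) (s (l mod K))) (tens K (fourier d (l div K)) (s (l mod K))))"
    unfolding trace_onb[OF on] using spec_trace[OF rp] by (simp add: N_def)
  also have "\<dots> = (\<Sum>j<d. \<Sum>a<K. mform K (blk j) (s a) (s a) / of_nat d)"
    unfolding form_rp_tens by (rule sum_N)
  also have "\<dots> = (\<Sum>j<d. 1 / of_nat d)"
    by (intro sum.cong refl) (simp add: sum_divide_distrib[symmetric] trace_onb[OF s] trace_blk)
  also have "\<dots> = 1" using d by simp
  finally show ?thesis by (simp only: of_real_eq_1_iff)
qed

text \<open>In the Fourier product basis a Weyl operator permutes the moduli of the coordinates, so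
  Parseval's identity yields the norm of \<open>u k\<close>.\<close>

lemma norm_vv:
  assumes n: "n < d" and k: "k < N"
  shows "(\<Sum>x<N. cmod2 (vv m n k x)) = 1"
proof -
  obtain s :: "nat \<Rightarrow> nat \<Rightarrow> complex" where s: "orthonormal_upto K K s"
    using orthonormal_standard by blast
  let ?G = "\<lambda>l. tens K (fourier d (l div K)) (s (l mod K))"
  have on: "orthonormal_upto N N ?G"
    unfolding N_def by (rule orthonormal_tens[OF fourier_orthonormal s])
  have "(\<Sum>x<N. cmod2 (vv m n k x)) = (\<Sum>l<N. cmod2 (ip N (?G l) (vv m n k)))"
    by (rule parseval_norm[OF on, symmetric])
  also have "\<dots> = (\<Sum>l<N. cmod2 (ip N (tens K (fourier d (shift d n (l div K))) (s (l mod K))) (u k)))"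
    by (intro sum.cong refl) (simp only: cmod_ip_tens_vv[OF n])
  also have "\<dots> = (\<Sum>j<d. \<Sum>a<K. cmod2 (ip N (tens K (fourier d (shift d n j)) (s a)) (u k)))"
    by (rule sum_N[where F = "\<lambda>j a. cmod2 (ip N (tens K (fourier d (shift d n j)) (s a)) (u k))"])
  also have "\<dots> = (\<Sum>j<d. \<Sum>a<K. cmod2 (ip N (tens K (fourier d j) (s a)) (u k)))"
    by (rule sum_shift[OF n, where F = "\<lambda>j. \<Sum>a<K. cmod2 (ip N (tens K (fourier d j) (s a)) (u k))"])
  also have "\<dots> = (\<Sum>l<N. cmod2 (ip N (?G l) (u k)))"
    by (rule sum_N[where F = "\<lambda>j a. cmod2 (ip N (tens K (fourier d j) (s a)) (u k))", symmetric])
  also have "\<dots> = 1" unfolding parseval_norm[OF on]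
    using orthonormal_norm[OF spec_onb[OF rp]] k by (simp add: N_def)
  finally show ?thesis .
qed

end

lemma mform_id: "mform n (\<lambda>x y. if x = y then c else 0) f g = c * ip n f g"
proof -
  have "mform n (\<lambda>x y. if x = y then c else 0) f g = (\<Sum>x<n. \<Sum>y<n. if y = x then c * (cnj (f x) * g y) else 0)"
    unfolding mform_def by (intro sum.cong refl) auto
  then show ?thesis by (simp add: ip_def sum_distrib_left)
qed

lemma eta_tendsto:
  assumes "0 \<le> x"
  shows "(\<lambda>n. eta (x + inverse (real (Suc n)))) \<longlonglongrightarrow> eta x"
proof (cases "x = 0")
  case True
  \<comment> \<open>The lower bound of order \<open>sqrt \<epsilon>\<close> comes from
    \<open>ln x \<le> x - 1\<close> at \<open>x = 1 / sqrt \<epsilon>\<close>; it gives continuity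
    of \<open>x * ln x\<close> at 0.\<close>
  have b: "- (2 * sqrt \<epsilon>) \<le> eta \<epsilon>" "eta \<epsilon> \<le> 0" if "0 < \<epsilon>" "\<epsilon> \<le> 1" for \<epsilon>
  proof -
    have "ln (1 / sqrt \<epsilon>) \<le> 1 / sqrt \<epsilon> - 1" using that by (intro ln_le_minus_one) simp
    then have "ln (1 / sqrt \<epsilon>) \<le> 1 / sqrt \<epsilon>" by simp
    then have "- (ln \<epsilon> / 2) \<le> 1 / sqrt \<epsilon>" using that by (simp add: ln_div ln_sqrt)
    then have "\<epsilon> * (- (ln \<epsilon> / 2)) \<le> \<epsilon> * (1 / sqrt \<epsilon>)" using that by (intro mult_left_mono) auto
    moreover have "\<epsilon> * (1 / sqrt \<epsilon>) = sqrt \<epsilon>" using that by (simp add: real_div_sqrt)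
    ultimately show "- (2 * sqrt \<epsilon>) \<le> eta \<epsilon>" using that by (simp add: eta_eq)
    show "eta \<epsilon> \<le> 0" using that by (simp add: eta_eq mult_nonneg_nonpos)
  qed
  have lim: "(\<lambda>n. - (2 * sqrt (inverse (real (Suc n))))) \<longlonglongrightarrow> - (2 * sqrt 0)"
    by (intro tendsto_minus tendsto_mult tendsto_const tendsto_real_sqrt LIMSEQ_inverse_real_of_nat)
  have "(\<lambda>n. eta (inverse (real (Suc n)))) \<longlonglongrightarrow> 0"
  proof (rule tendsto_sandwich)
    show "(\<lambda>n. - (2 * sqrt (inverse (real (Suc n))))) \<longlonglongrightarrow> 0" using lim by simp
    show "\<forall>\<^sub>F n in sequentially. - (2 * sqrt (inverse (real (Suc n)))) \<le> eta (inverse (real (Suc n)))"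
      by (intro always_eventually allI b(1)) (auto simp: inverse_le_1_iff)
    show "\<forall>\<^sub>F n in sequentially. eta (inverse (real (Suc n))) \<le> 0"
      by (intro always_eventually allI b(2)) (auto simp: inverse_le_1_iff)
  qed (rule tendsto_const)
  then show ?thesis using True by (simp add: eta_def)
next
  case False
  have lim: "(\<lambda>n. x + inverse (real (Suc n))) \<longlonglongrightarrow> x + 0"
    by (intro tendsto_add tendsto_const LIMSEQ_inverse_real_of_nat)
  then have "(\<lambda>n. (x + inverse (real (Suc n))) * ln (x + inverse (real (Suc n)))) \<longlonglongrightarrow> x * ln x"
    using False by (intro tendsto_mult tendsto_ln) auto
  moreover have "eta (x + inverse (real (Suc n))) = (x + inverse (real (Suc n))) * ln (x + inverse (real (Suc n)))" for n
    using assms by (intro eta_eq) simp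
  ultimately show ?thesis using assms by (simp add: eta_eq)
qed

section \<open>Fourier blocks of the output and their entropies\<close>

context weyl_output
begin

sublocale vm: vector_mixture N d \<alpha> "\<lambda>m k. vv m 0 k" r
  by unfold_locales (auto simp: d r \<alpha> N_def)

definition Y0 where "Y0 x y = (\<Sum>n\<in>{1..<d}. \<Sum>m<d. \<Sum>k<N. of_real (p n * \<alpha> k) * vv m n k x * cnj (vv m n k y))"
definition YY where "YY \<epsilon> x y = Y0 x y + (if x = y then of_real \<epsilon> else 0)"
definition sig where "sig \<epsilon> m = (\<lambda>x y. of_real (d * r m) * vm.DD x y + YY \<epsilon> x y)"
text \<open>The diagonal Fourier block \<open>j\<close> of
  \<open>\<kappa> DD + YY \<epsilon>\<close>. Since \<open>blk\<close> contains a factor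
  \<open>d\<close>, the pinched operator \<open>DD\<close> contributes \<open>blk j / d\<close>,
  whereas in \<open>Y0\<close> the sum over \<open>m\<close> supplies this factor.\<close>

definition T where "T \<epsilon> \<kappa> j a b = of_real (\<kappa> / d) * blk j a b + ((\<Sum>n\<in>{1..<d}. of_real (p n) * blk (shift d n j) a b)
   + (if a = b then of_real \<epsilon> else 0))"

lemma \<tau>_eq: "\<tau> x y = vm.AA x y + Y0 x y"
proof -
  have split: "{..<d} = insert 0 {1..<d}" using d by auto
  have "\<tau> x y = (\<Sum>m<d. (\<Sum>k<N. of_real (r m * \<alpha> k) * vv m 0 k x * cnj (vv m 0 k y))
     + (\<Sum>n\<in>{1..<d}. \<Sum>k<N. of_real (p n * \<alpha> k) * vv m n k x * cnj (vv m n k y)))"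
    unfolding \<tau>_def
  proof (rule sum.cong[OF refl])
    fix m
    show "(\<Sum>n<d. \<Sum>k<N. of_real (weyl_wt r p m n * \<alpha> k) * vv m n k x * cnj (vv m n k y))
      = (\<Sum>k<N. of_real (r m * \<alpha> k) * vv m 0 k x * cnj (vv m 0 k y))
       + (\<Sum>n\<in>{1..<d}. \<Sum>k<N. of_real (p n * \<alpha> k) * vv m n k x * cnj (vv m n k y))"
      unfolding split by (simp add: weyl_wt_def)
  qed
  also have "\<dots> = vm.AA x y + (\<Sum>m<d. \<Sum>n\<in>{1..<d}. \<Sum>k<N. of_real (p n * \<alpha> k) * vv m n k x * cnj (vv m n k y))"
    by (simp add: sum.distrib vm.AA_def vm.sum_idx vm.V_def)
  also have "(\<Sum>m<d. \<Sum>n\<in>{1..<d}. \<Sum>k<N. of_real (p n * \<alpha> k) * vv m n k x * cnj (vv m n k y)) = Y0 x y"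
    unfolding Y0_def by (rule sum.swap)
  finally show ?thesis .
qed

lemma form_Y0: "mform N Y0 f g = (\<Sum>n\<in>{1..<d}. of_real (p n) * (\<Sum>m<d. \<Sum>k<N. of_real (\<alpha> k) * ip N f (vv m n k) * cnj (ip N g (vv m n k))))"
proof -
  have "mform N Y0 f g = (\<Sum>z\<in>{1..<d} \<times> {..<d} \<times> {..<N}. of_real (p (fst z) * \<alpha> (snd (snd z)))
     * ip N f (vv (fst (snd z)) (fst z) (snd (snd z))) * cnj (ip N g (vv (fst (snd z)) (fst z) (snd (snd z)))))"
    by (rule mform_rank_one_sum) (simp add: Y0_def sum.cartesian_product case_prod_unfold)
  also have "\<dots> = (\<Sum>n\<in>{1..<d}. \<Sum>m<d. \<Sum>k<N. of_real (p n * \<alpha> k) * ip N f (vv m n k) * cnj (ip N g (vv m n k)))"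
    by (simp add: sum.cartesian_product case_prod_unfold)
  finally show ?thesis by (simp add: sum_distrib_left mult.assoc)
qed

lemma form_YY: "mform N (YY \<epsilon>) f g = mform N Y0 f g + of_real \<epsilon> * ip N f g"
proof -
  have "mform N (YY \<epsilon>) f g = mform N (\<lambda>x y. Y0 x y + (if x = y then of_real \<epsilon> else 0)) f g"
    by (rule mform_cong) (simp add: YY_def)
  then show ?thesis by (simp add: mform_add mform_id)
qed

lemma form_Y0_self: "mform N Y0 f f = of_real (\<Sum>n\<in>{1..<d}. p n * (\<Sum>m<d. \<Sum>k<N. \<alpha> k * cmod2 (ip N f (vv m n k))))"
  unfolding form_Y0 of_real_sum of_real_mult by (simp only: complex_norm_square mult.assoc)

lemma form_Y0_nonneg: "0 \<le> Re (mform N Y0 f f)"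
  unfolding form_Y0_self Re_complex_of_real
  by (intro sum_nonneg mult_nonneg_nonneg p) (auto simp: \<alpha> N_def)

lemma form_Y_tens:
  assumes "j < d" "j' < d"
  shows "mform N Y0 (tens K (fourier d j) g) (tens K (fourier d j') g')
    = (if j = j' then \<Sum>n\<in>{1..<d}. of_real (p n) * mform K (blk (shift d n j)) g g' else 0)"
  unfolding form_Y0 using assms by (simp add: phase_average)

lemma form_DD_tens:
  assumes "j < d" "j' < d"
  shows "mform N vm.DD (tens K (fourier d j) g) (tens K (fourier d j') g')
    = (if j = j' then mform K (blk j) g g' / of_nat d else 0)"
proof -
  have "mform N vm.DD (tens K (fourier d j) g) (tens K (fourier d j') g')
    = (\<Sum>m<d. \<Sum>k<N. of_real (\<alpha> k) * ip N (tens K (fourier d j) g) (vv m 0 k)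
      * cnj (ip N (tens K (fourier d j') g') (vv m 0 k))) / of_nat d"
    unfolding vm.form_DD vm.sum_idx vm.V_def by (simp add: sum_divide_distrib)
  then show ?thesis using assms d by (simp add: phase_average shift_0)
qed

lemma form_T:
  "mform K (T \<epsilon> \<kappa> j) g g' = of_real (\<kappa> / d) * mform K (blk j) g g'
    + ((\<Sum>n\<in>{1..<d}. of_real (p n) * mform K (blk (shift d n j)) g g') + of_real \<epsilon> * ip K g g')"
proof -
  have "mform K (\<lambda>a b. \<Sum>n\<in>I. of_real (p n) * blk (shift d n j) a b) g g'
    = (\<Sum>n\<in>I. of_real (p n) * mform K (blk (shift d n j)) g g')" if "finite I" for I
    using that by (induction) (simp_all add: mform_add mform_scale, simp add: mform_def)
  moreover have "mform K (T \<epsilon> \<kappa> j) g g' = mform K (\<lambda>a b. of_real (\<kappa> / d) * blk j a b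
     + ((\<Sum>n\<in>{1..<d}. of_real (p n) * blk (shift d n j) a b) + (if a = b then of_real \<epsilon> else 0))) g g'"
    by (rule mform_cong) (simp add: T_def)
  ultimately show ?thesis by (simp only: mform_add mform_scale mform_id finite_atLeastLessThan)
qed

lemma ex_T:
  assumes "0 \<le> \<kappa>" "0 < \<epsilon>"
  shows "\<exists>g e. spec K (T \<epsilon> \<kappa> j) g e \<and> (\<forall>a<K. 0 < e a)"
proof -
  have im: "Im (mform K (T \<epsilon> \<kappa> j) g g) = 0" for g
    by (simp add: form_T blk_im ip_self)
  have re: "\<epsilon> * (\<Sum>x<K. cmod2 (g x)) \<le> Re (mform K (T \<epsilon> \<kappa> j) g g)" for g
  proof -
    have "0 \<le> (\<Sum>n\<in>{1..<d}. p n * Re (mform K (blk (shift d n j)) g g))"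
      by (intro sum_nonneg mult_nonneg_nonneg p blk_re)
    then show ?thesis using assms d blk_re[of j g] by (simp add: form_T blk_im ip_self)
  qed
  have "0 \<le> Re (mform K (T \<epsilon> \<kappa> j) g g)" for g
    by (rule order.trans[OF _ re]) (use assms in \<open>simp add: sum_nonneg\<close>)
  from ex_spec[OF im this] obtain g e where s: "spec K (T \<epsilon> \<kappa> j) g e" by blast
  have "0 < e a" if "a < K" for a
    using re[of "g a"] spec_diag[OF s that that] orthonormal_norm[OF spec_onb[OF s] that] assms by simp
  then show ?thesis using s by blast
qed

text \<open>Off-diagonal Fourier blocks vanish, so products of a Fourier vector with eigenvectors of
  the corresponding \<open>T\<close> diagonalise the whole operator.\<close>

lemma spec_blocks:
  assumes s: "\<And>j. j < d \<Longrightarrow> spec K (T \<epsilon> \<kappa> j) (g j) (e j)"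
  shows "spec N (\<lambda>x y. of_real \<kappa> * vm.DD x y + YY \<epsilon> x y)
    (\<lambda>l. tens K (fourier d (l div K)) (g (l div K) (l mod K))) (\<lambda>l. e (l div K) (l mod K))"
proof (rule spec_from_forms)
  show "orthonormal_upto N N (\<lambda>l. tens K (fourier d (l div K)) (g (l div K) (l mod K)))"
    unfolding N_def by (rule orthonormal_tens[OF fourier_orthonormal spec_onb[OF s]])
  fix l l' assume l: "l < N" "l' < N"
  have dm: "l div K < d" "l' div K < d" "l mod K < K" "l' mod K < K"
    using l K by (auto simp: N_def less_mult_imp_div_less)
  have eq: "l = l' \<longleftrightarrow> l div K = l' div K \<and> l mod K = l' mod K"
    by (metis div_mult_mod_eq)
  let ?j = "l div K" and ?j' = "l' div K"
  let ?g = "g ?j (l mod K)" and ?g' = "g ?j' (l' mod K)"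
  have "ip N (tens K (fourier d ?j) ?g) (tens K (fourier d ?j') ?g') = (if ?j = ?j' then ip K ?g ?g' else 0)"
    unfolding N_def ip_tens using orthonormal_ip[OF fourier_orthonormal dm(1,2)] by simp
  then have "mform N (\<lambda>x y. of_real \<kappa> * vm.DD x y + YY \<epsilon> x y) (tens K (fourier d ?j) ?g) (tens K (fourier d ?j') ?g')
    = (if ?j = ?j' then mform K (T \<epsilon> \<kappa> ?j) ?g ?g' else 0)"
    using dm by (simp add: mform_add mform_scale form_YY form_Y_tens form_DD_tens form_T)
  also have "\<dots> = (if l = l' then of_real (e ?j (l mod K)) else 0)"
    using spec_diag[OF s[OF dm(1)] dm(3,4)] unfolding eq by auto
  finally show "mform N (\<lambda>x y. of_real \<kappa> * vm.DD x y + YY \<epsilon> x y) (tens K (fourier d ?j) ?g) (tens K (fourier d ?j') ?g')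
    = (if l = l' then of_real (e ?j (l mod K)) else 0)" .
qed

text \<open>Without a clock factor a Weyl operator only multiplies the overlap with a Fourier vector
  by a phase, and \<open>P\<close> sees the modulus alone.\<close>

lemma adapted_tens:
  assumes "j < d" shows "vm.adapted (tens K (fourier d j) g)"
proof -
  have "vm.P m (tens K (fourier d j) g) = (\<Sum>k<N. \<alpha> k * cmod2 (ip N (tens K (fourier d j) g) (u k)))" for m
    unfolding vm.P_def using assms d by (simp add: cmod_ip_tens_vv shift_0)
  then show ?thesis using d by (simp add: vm.adapted_def vm.form_DD_self)
qed

text \<open>The multiple of the identity in \<open>YY\<close> makes all logarithms finite.\<close>

lemma entropy_regularised:
  assumes \<epsilon>: "0 < \<epsilon>"
  shows "(\<Sum>m<d. ent N (sig \<epsilon> m)) / d \<le> ent N (\<lambda>x y. vm.AA x y + YY \<epsilon> x y)"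
proof -
  let ?M = "\<lambda>\<kappa>. (\<lambda>x y. of_real \<kappa> * vm.DD x y + YY \<epsilon> x y)"
  interpret phase_mixture N d \<alpha> "\<lambda>m k. vv m 0 k" r "YY \<epsilon>" \<epsilon>
  proof
    show "0 < \<epsilon>" by fact
    show "Im (mform N (YY \<epsilon>) f f) = 0" for f
      by (simp add: form_YY form_Y0_self ip_self)
    show "\<epsilon> * (\<Sum>x<N. cmod2 (f x)) \<le> Re (mform N (YY \<epsilon>) f f)" for f
      using form_Y0_nonneg[of f] by (simp add: form_YY ip_self)
    show "(\<Sum>k<N. \<alpha> k * (\<Sum>x<N. cmod2 (vv m 0 k x))) = 1" if "m < d" for m
      using trace_rp d by (simp add: norm_vv)
    fix \<kappa> :: real assume \<kappa>: "0 \<le> \<kappa>"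
    have "\<forall>j. \<exists>g e. spec K (T \<epsilon> \<kappa> j) g e" using ex_T[OF \<kappa> \<epsilon>] by blast
    then obtain g e where "\<And>j. spec K (T \<epsilon> \<kappa> j) (g j) (e j)" by metis
    then have "spec N (?M \<kappa>)
      (\<lambda>l. tens K (fourier d (l div K)) (g (l div K) (l mod K))) (\<lambda>l. e (l div K) (l mod K))"
      by (rule spec_blocks)
    moreover have "vm.adapted (tens K (fourier d (l div K)) (g (l div K) (l mod K)))" if "l < N" for l
      by (rule adapted_tens) (use that in \<open>simp add: N_def less_mult_imp_div_less\<close>)
    ultimately show "\<exists>G e. spec N (?M \<kappa>) G e \<and> (\<forall>l<N. vm.adapted (G l))"
      by blast
  qed
  show ?thesis unfolding sig_def by (rule entropy_phase_mixture)
qed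

lemma lam_wt: "lam m = (\<Sum>n<d. weyl_wt r p m n)"
  unfolding lam_def by (rule sum_weyl_wt_inner[OF d, symmetric])

lemma lam_nonneg: "m < d \<Longrightarrow> 0 \<le> lam m"
  unfolding lam_wt by (intro sum_nonneg) (auto intro!: weyl_wt_nonneg r p)

lemma sum_lam: "(\<Sum>m<d. lam m) = 1"
  using total by (simp add: lam_def sum.distrib)

text \<open>Up to \<open>\<epsilon>\<close>, block \<open>j\<close> of
  \<open>sig \<epsilon> m\<close> is a mixture of the \<open>blk (shift d n j)\<close> with weights
  summing to \<open>lam m\<close>. Klein's inequality compares each component with the normalised
  mixture; the terms carrying \<epsilon> are the price of the regularisation.\<close>

lemma block_entropy_bound:
  fixes \<epsilon> :: real
  assumes m: "m < d" and \<epsilon>: "0 < \<epsilon>"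
  shows "lam m * (\<Sum>j<d. ent K (blk j)) - d * lam m * ln (lam m + \<epsilon> * K) - \<epsilon> * d * (lam m + \<epsilon> * K)
    \<le> ent N (sig \<epsilon> m)"
proof -
  define \<mu> where "\<mu> = lam m + \<epsilon> * K"
  have \<mu>: "0 < \<mu>" using lam_nonneg[OF m] \<epsilon> K by (simp add: \<mu>_def add_nonneg_pos)
  have \<kappa>: "0 \<le> d * r m" using r[OF m] by simp
  have "\<forall>j. \<exists>g e. spec K (T \<epsilon> (d * r m) j) g e \<and> (\<forall>a<K. 0 < e a)" using ex_T[OF \<kappa> \<epsilon>] by blast
  then obtain g e where s: "\<And>j. spec K (T \<epsilon> (d * r m) j) (g j) (e j)" and e: "\<And>j a. a < K \<Longrightarrow> 0 < e j a"
    by metis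
  have split: "{..<d} = insert 0 {1..<d}" using d by auto
  define B where "B j n a = Re (mform K (blk (shift d n j)) (g j a) (g j a))" for j n a
  have eB: "e j a - \<epsilon> = (\<Sum>n<d. weyl_wt r p m n * B j n a)" if "j < d" "a < K" for j a
  proof -
    have "e j a = Re (mform K (T \<epsilon> (d * r m) j) (g j a) (g j a))" using spec_diag[OF s that(2) that(2)] by simp
    also have "\<dots> = r m * B j 0 a + (\<Sum>n\<in>{1..<d}. p n * B j n a) + \<epsilon>"
      using d orthonormal_ip[OF spec_onb[OF s] that(2) that(2)] by (simp add: form_T B_def shift_0 that)
    also have "r m * B j 0 a + (\<Sum>n\<in>{1..<d}. p n * B j n a) = (\<Sum>n<d. weyl_wt r p m n * B j n a)"
      unfolding split by (simp add: weyl_wt_def)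
    finally show ?thesis by simp
  qed
  have trB: "(\<Sum>a<K. B j n a) = 1" if "j < d" for j n
    unfolding B_def Re_sum[symmetric] trace_onb[OF spec_onb[OF s]] using trace_blk[OF shift_less[OF d]] by simp
  have tre: "(\<Sum>a<K. e j a) = \<mu>" if "j < d" for j
  proof -
    have "(\<Sum>a<K. e j a - \<epsilon>) = (\<Sum>n<d. weyl_wt r p m n * (\<Sum>a<K. B j n a))"
      using that by (simp add: eB sum_distrib_left) (rule sum.swap)
    then show ?thesis by (simp add: trB that lam_wt[symmetric] sum_subtractf \<mu>_def mult.commute)
  qed
  \<comment> \<open>\<mu> is the trace of every block of \<open>sig \<epsilon> m\<close>. After
    division by it both operators in Klein's inequality have trace 1, and the trace terms
    cancel.\<close>
  have klein_blk: "ent K (blk (shift d n j)) \<le> - (\<Sum>a<K. B j n a * (ln (e j a) - ln \<mu>))" if "j < d" for j n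
  proof -
    from ex_spec[OF blk_im blk_re] obtain h b where sb: "spec K (blk (shift d n j)) h b" and b: "\<And>i. i < K \<Longrightarrow> 0 \<le> b i"
      by blast
    have "complex_of_real (\<Sum>i<K. b i) = 1" using spec_trace[OF sb] trace_blk[OF shift_less[OF d]] by simp
    then have "(\<Sum>i<K. b i) = 1" by (simp only: of_real_eq_1_iff)
    moreover have "(\<Sum>a<K. e j a / \<mu>) = 1" using tre[OF that] \<mu> by (simp add: sum_divide_distrib[symmetric])
    moreover have "ent K (blk (shift d n j)) \<le> - (\<Sum>a<K. B j n a * ln (e j a / \<mu>)) - (\<Sum>i<K. b i) + (\<Sum>a<K. e j a / \<mu>)"
      unfolding B_def using e \<mu> by (intro klein[OF sb b spec_onb[OF s]]) auto
    moreover have "(\<Sum>a<K. B j n a * ln (e j a / \<mu>)) = (\<Sum>a<K. B j n a * (ln (e j a) - ln \<mu>))"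
    proof (intro sum.cong refl)
      fix a assume "a \<in> {..<K}"
      then have "0 < e j a" using e by simp
      then show "B j n a * ln (e j a / \<mu>) = B j n a * (ln (e j a) - ln \<mu>)" using \<mu> by (simp add: ln_div)
    qed
    ultimately show ?thesis by simp
  qed
  have entN: "ent N (sig \<epsilon> m) = - (\<Sum>j<d. \<Sum>a<K. e j a * ln (e j a))"
  proof -
    have "ent N (sig \<epsilon> m) = - (\<Sum>l<N. e (l div K) (l mod K) * ln (e (l div K) (l mod K)))"
      unfolding sig_def using e K by (intro ent_ref[OF spec_blocks[OF s]]) (simp add: less_imp_le)
    then show ?thesis by (simp only: sum_N[where F = "\<lambda>j a. e j a * ln (e j a)"])
  qed
  \<comment> \<open>For each \<open>n\<close> the map \<open>shift d n\<close> permutes the blocks,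
    so every weight meets the full sum of block entropies.\<close>
  have "lam m * (\<Sum>j<d. ent K (blk j)) = (\<Sum>n<d. weyl_wt r p m n * (\<Sum>j<d. ent K (blk (shift d n j))))"
    unfolding lam_wt sum_distrib_right by (intro sum.cong refl) (simp add: sum_shift[where F = "\<lambda>j. ent K (blk j)"])
  also have "\<dots> \<le> (\<Sum>n<d. weyl_wt r p m n * (\<Sum>j<d. - (\<Sum>a<K. B j n a * (ln (e j a) - ln \<mu>))))"
    by (intro sum_mono mult_left_mono klein_blk) (auto intro!: weyl_wt_nonneg r p m)
  also have "\<dots> = - (\<Sum>n<d. \<Sum>j<d. \<Sum>a<K. weyl_wt r p m n * B j n a * (ln (e j a) - ln \<mu>))"
    by (simp add: sum_distrib_left sum_negf mult.assoc)
  also have "(\<Sum>n<d. \<Sum>j<d. \<Sum>a<K. weyl_wt r p m n * B j n a * (ln (e j a) - ln \<mu>))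
     = (\<Sum>j<d. \<Sum>n<d. \<Sum>a<K. weyl_wt r p m n * B j n a * (ln (e j a) - ln \<mu>))"
    by (rule sum.swap)
  also have "\<dots> = (\<Sum>j<d. \<Sum>a<K. \<Sum>n<d. weyl_wt r p m n * B j n a * (ln (e j a) - ln \<mu>))"
    by (intro sum.cong refl sum.swap)
  also have "\<dots> = (\<Sum>j<d. \<Sum>a<K. (e j a - \<epsilon>) * (ln (e j a) - ln \<mu>))"
    by (intro sum.cong refl) (simp add: eB sum_distrib_right)
  also have "\<dots> = (\<Sum>j<d. \<Sum>a<K. e j a * ln (e j a)) - \<epsilon> * (\<Sum>j<d. \<Sum>a<K. ln (e j a)) - ln \<mu> * (\<Sum>j<d. \<Sum>a<K. e j a - \<epsilon>)"
    unfolding sum_distrib_left sum_subtractf[symmetric] by (intro sum.cong refl) (simp add: algebra_simps)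
  also have "(\<Sum>j<d. \<Sum>a<K. e j a - \<epsilon>) = d * lam m"
    by (simp add: sum_subtractf tre \<mu>_def mult.commute)
  finally have 1: "lam m * (\<Sum>j<d. ent K (blk j)) \<le> - (\<Sum>j<d. \<Sum>a<K. e j a * ln (e j a))
     + \<epsilon> * (\<Sum>j<d. \<Sum>a<K. ln (e j a)) + d * lam m * ln \<mu>"
    by (simp add: mult_ac)
  \<comment> \<open>The error term enters with a plus sign, so only an upper bound on the logarithms
    is required, although they may be very negative.\<close>
  have "(\<Sum>j<d. \<Sum>a<K. ln (e j a)) \<le> (\<Sum>j<d. \<Sum>a<K. e j a)"
  proof (intro sum_mono)
    fix j a assume "a \<in> {..<K}"
    then have "ln (e j a) \<le> e j a - 1" using e by (intro ln_le_minus_one) simp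
    then show "ln (e j a) \<le> e j a" by simp
  qed
  also have "\<dots> = d * \<mu>" by (simp add: tre)
  finally have "\<epsilon> * (\<Sum>j<d. \<Sum>a<K. ln (e j a)) \<le> \<epsilon> * (d * \<mu>)" using \<epsilon> by (intro mult_left_mono) auto
  with 1 show ?thesis unfolding entN \<mu>_def by (simp add: mult.assoc)
qed

text \<open>Averaging \<open>block_entropy_bound\<close> over \<open>m\<close> and using that the
  \<open>lam m\<close> sum to 1 leaves one copy of the mean block entropy plus the entropy of
  \<open>lam\<close>. Adding \<epsilon> times the identity only shifts the eigenvalues of \<tau>, so
  continuity of \<open>eta\<close> allows \<epsilon> to tend to 0.\<close>

lemma output_entropy_bound:
  "- (\<Sum>m<d. eta (lam m)) + (\<Sum>j<d. ent K (blk j)) / d \<le> ent N \<tau>"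
proof -
  let ?S = "(\<Sum>j<d. ent K (blk j))"
  have \<tau>_form: "mform N \<tau> f f = mform N vm.AA f f + mform N Y0 f f" for f
    unfolding mform_add[symmetric] by (rule mform_cong) (simp add: \<tau>_eq)
  have AA0: "0 \<le> Re (mform N vm.AA f f)" for f
    unfolding vm.form_AA_self Re_complex_of_real
    by (intro sum_nonneg mult_nonneg_nonneg vm.P_nonneg) (simp add: r)
  have "Im (mform N \<tau> f f) = 0" "0 \<le> Re (mform N \<tau> f f)" for f
    using AA0[of f] form_Y0_nonneg[of f] by (simp_all add: \<tau>_form) (simp add: vm.form_AA_self form_Y0_self)
  from ex_spec[OF this] obtain E t where sp: "spec N \<tau> E t" and t: "\<And>i. i < N \<Longrightarrow> 0 \<le> t i" by blast
  have ent_\<epsilon>: "ent N (\<lambda>x y. vm.AA x y + YY \<epsilon> x y) = - (\<Sum>i<N. eta (t i + \<epsilon>))" for \<epsilon>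
    using ent_spec[OF spec_shift[OF sp, of \<epsilon>]] by (simp add: \<tau>_eq YY_def add.assoc)
  define L where "L \<epsilon> = ?S / d - (\<Sum>m<d. lam m * ln (lam m + \<epsilon> * K)) - \<epsilon> * (\<Sum>m<d. lam m + \<epsilon> * K)" for \<epsilon> :: real
  have bound: "L \<epsilon> \<le> - (\<Sum>i<N. eta (t i + \<epsilon>))" if \<epsilon>: "0 < \<epsilon>" for \<epsilon>
  proof -
    have "d * L \<epsilon> = (\<Sum>m<d. lam m * ?S - d * lam m * ln (lam m + \<epsilon> * K) - \<epsilon> * d * (lam m + \<epsilon> * K))"
    proof -
      have "(\<Sum>m<d. lam m * ?S - d * lam m * ln (lam m + \<epsilon> * K) - \<epsilon> * d * (lam m + \<epsilon> * K))
        = (\<Sum>m<d. lam m) * ?S - d * (\<Sum>m<d. lam m * ln (lam m + \<epsilon> * K)) - d * (\<epsilon> * (\<Sum>m<d. lam m + \<epsilon> * K))"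
      proof -
        have 1: "(\<Sum>m<d. lam m * ?S) = (\<Sum>m<d. lam m) * ?S" by (rule sum_distrib_right[symmetric])
        have 2: "(\<Sum>m<d. d * lam m * ln (lam m + \<epsilon> * K)) = d * (\<Sum>m<d. lam m * ln (lam m + \<epsilon> * K))"
          by (simp only: sum_distrib_left mult.assoc)
        have 3: "(\<Sum>m<d. \<epsilon> * d * (lam m + \<epsilon> * K)) = d * (\<epsilon> * (\<Sum>m<d. lam m + \<epsilon> * K))"
          unfolding sum_distrib_left[of \<epsilon>] sum_distrib_left[of "real d"] by (simp only: mult_ac)
        show ?thesis unfolding sum_subtractf 1 2 3 ..
      qed
      then show ?thesis using d by (simp only: sum_lam) (simp add: L_def right_diff_distrib)
    qed
    also have "\<dots> \<le> (\<Sum>m<d. ent N (sig \<epsilon> m))"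
      by (intro sum_mono block_entropy_bound \<epsilon>) simp
    finally have "L \<epsilon> \<le> (\<Sum>m<d. ent N (sig \<epsilon> m)) / d"
      using d by (simp add: le_divide_eq mult.commute)
    then show ?thesis using entropy_regularised[OF \<epsilon>] unfolding ent_\<epsilon> by simp
  qed
  have eps: "(\<lambda>n. inverse (real (Suc n))) \<longlonglongrightarrow> 0" by (rule LIMSEQ_inverse_real_of_nat)
  have lim1: "(\<lambda>n. - (\<Sum>i<N. eta (t i + inverse (real (Suc n))))) \<longlonglongrightarrow> - (\<Sum>i<N. eta (t i))"
    by (intro tendsto_minus tendsto_sum eta_tendsto) (simp add: t)
  have lim2: "(\<lambda>n. L (inverse (real (Suc n)))) \<longlonglongrightarrow> ?S / d - (\<Sum>m<d. eta (lam m)) - 0 * (\<Sum>m<d. lam m + 0 * real K)"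
    unfolding L_def
  proof (intro tendsto_diff tendsto_const tendsto_sum tendsto_mult tendsto_add eps)
    fix m assume "m \<in> {..<d}"
    then have l0: "0 \<le> lam m" using lam_nonneg by simp
    have "(\<lambda>n. lam m + inverse (real (Suc n)) * K) \<longlonglongrightarrow> lam m + 0 * real K"
      by (intro tendsto_add tendsto_mult tendsto_const eps)
    then show "(\<lambda>n. lam m * ln (lam m + inverse (real (Suc n)) * K)) \<longlonglongrightarrow> eta (lam m)"
    proof (cases "lam m = 0")
      case False
      then show ?thesis using l0 \<open>(\<lambda>n. lam m + inverse (real (Suc n)) * K) \<longlonglongrightarrow> lam m + 0 * real K\<close>
        unfolding eta_eq[OF l0] by (intro tendsto_mult tendsto_const tendsto_ln) auto
    qed (simp add: eta_def)
  qed
  have "?S / d - (\<Sum>m<d. eta (lam m)) - 0 * (\<Sum>m<d. lam m + 0 * real K) \<le> - (\<Sum>i<N. eta (t i))"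
    by (rule LIMSEQ_le[OF lim2 lim1]) (use bound in auto)
  then show ?thesis unfolding ent_spec[OF sp] by simp
qed

end

section \<open>Channels and decompositions\<close>

lemma mat_entry: "A \<in> carrier_mat n n \<Longrightarrow> mat n n (\<lambda>(x, y). entry A x y) = A"
  by (intro eq_matI) auto

lemma vn_entropy_density_nonneg:
  assumes "density n A" shows "0 \<le> vn_entropy A"
proof -
  from assms have psd: "psd n A" and tr: "ctrace A = 1" by (auto simp: density_def)
  note A = psd_carrier[OF psd]
  from ex_spec[of n "entry A"] psd obtain e a where s: "spec n (entry A) e a" and a: "\<And>i. i < n \<Longrightarrow> 0 \<le> a i"
    unfolding psd_iff by blast
  have "complex_of_real (\<Sum>i<n. a i) = 1"
    using spec_trace[OF s] tr A by (simp add: ctrace_def)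
  then have sum: "(\<Sum>i<n. a i) = 1" by (simp only: of_real_eq_1_iff)
  have "eta (a i) \<le> 0" if "i < n" for i
  proof -
    have "a i \<le> (\<Sum>i<n. a i)" using that a by (intro member_le_sum) auto
    then show ?thesis using a[OF that] sum
      by (cases "a i = 0") (auto simp: eta_eq mult_nonneg_nonpos eta_def)
  qed
  then have "(\<Sum>i<n. eta (a i)) \<le> 0" by (intro sum_nonpos) simp
  then have "0 \<le> ent n (entry A)"
    unfolding ent_spec[OF s] by simp
  then show ?thesis unfolding ent_def mat_entry[OF A] .
qed

text \<open>Any decomposition bounds the infimum from above once the set of values is bounded below;
  this follows from nonnegativity of the entropies of the output states.\<close>

lemma H_chan_le:
  fixes N :: nat
  assumes T: "\<And>s. density n s \<Longrightarrow> density n (T s)"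
    and s: "\<And>j. j < N \<Longrightarrow> 0 \<le> \<pi> j" "\<And>j. j < N \<Longrightarrow> density n (s j)" "(\<Sum>j<N. \<pi> j) = 1"
    and \<sigma>: "\<sigma> = msum n (\<lambda>j. complex_of_real (\<pi> j) \<cdot>\<^sub>m s j) {..<N}"
  shows "H_chan n T \<sigma> \<le> (\<Sum>j<N. \<pi> j * vn_entropy (T (s j)))"
  unfolding H_chan_def
proof (rule cInf_lower)
  let ?S = "{(\<Sum>j<N. \<pi> j * vn_entropy (T (s j))) | (N::nat) \<pi> s.
       (\<forall>j<N. \<pi> j \<ge> 0 \<and> density n (s j)) \<and> (\<Sum>j<N. \<pi> j) = 1 \<and>
       \<sigma> = msum n (\<lambda>j. complex_of_real (\<pi> j) \<cdot>\<^sub>m s j) {..<N}}"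
  show "(\<Sum>j<N. \<pi> j * vn_entropy (T (s j))) \<in> ?S"
    by (intro CollectI exI[of _ N] exI[of _ \<pi>] exI[of _ s]) (use s \<sigma> in auto)
  show "bdd_below ?S"
  proof (rule bdd_belowI)
    fix x assume "x \<in> ?S"
    then obtain N' :: nat and \<pi>' s' where "x = (\<Sum>j<N'. \<pi>' j * vn_entropy (T (s' j)))"
      "\<forall>j<N'. \<pi>' j \<ge> 0 \<and> density n (s' j)" by blast
    then show "0 \<le> x" using T by (auto intro!: sum_nonneg mult_nonneg_nonneg vn_entropy_density_nonneg)
  qed
qed

section \<open>Linear maps and tensor products in matrix units\<close>

lemma munit_carrier: "munit n i j \<in> carrier_mat n n"
  by (simp add: munit_def)

lemma linear_map_expand:
  assumes lin: "linear_map_on n T" and M: "M \<in> carrier_mat n n" and xy: "x < n" "y < n"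
  shows "T M $$ (x, y) = (\<Sum>a<n. \<Sum>b<n. M $$ (a, b) * T (munit n a b) $$ (x, y))"
proof -
  \<comment> \<open>\<open>Ms S\<close> keeps the entries of \<open>M\<close> at positions in
    \<open>S\<close>, so that induction over \<open>S\<close> adds one matrix unit at a
    time.\<close>
  define Ms where "Ms S = mat n n (\<lambda>z. if z \<in> S then M $$ z else 0)" for S
  have car: "T A \<in> carrier_mat n n" if "A \<in> carrier_mat n n" for A
    using lin that by (simp add: linear_map_on_def)
  have MsC: "Ms S \<in> carrier_mat n n" for S by (simp add: Ms_def)
  have "T (Ms S) $$ (x, y) = (\<Sum>(a, b)\<in>S. M $$ (a, b) * T (munit n a b) $$ (x, y))"
    if "finite S" "S \<subseteq> {..<n} \<times> {..<n}" for S
    using that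
  proof (induction S)
    case empty
    have "Ms {} = 0 \<cdot>\<^sub>m Ms {}" by (intro eq_matI) (auto simp: Ms_def)
    then have "T (Ms {}) = 0 \<cdot>\<^sub>m T (Ms {})" using lin MsC unfolding linear_map_on_def by metis
    then have "T (Ms {}) $$ (x, y) = (0 \<cdot>\<^sub>m T (Ms {})) $$ (x, y)" by simp
    also have "\<dots> = 0" using carrier_matD[OF car[OF MsC[of "{}"]]] xy by simp
    finally show ?case by simp
  next
    case (insert z S)
    obtain a b where z: "z = (a, b)" by force
    have ab: "a < n" "b < n" using insert.prems z by auto
    have "Ms (insert z S) = M $$ (a, b) \<cdot>\<^sub>m munit n a b + Ms S"
      using insert.hyps ab by (intro eq_matI) (auto simp: Ms_def munit_def z)
    then have "T (Ms (insert z S)) = M $$ (a, b) \<cdot>\<^sub>m T (munit n a b) + T (Ms S)"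
      using lin MsC munit_carrier[of n a b] unfolding linear_map_on_def by simp
    then show ?case
      using insert carrier_matD[OF car[OF MsC[of S]]] carrier_matD[OF car[OF munit_carrier[of n a b]]] xy
      by (simp add: z)
  qed
  from this[of "{..<n} \<times> {..<n}"] have "T (Ms ({..<n} \<times> {..<n})) $$ (x, y)
    = (\<Sum>a<n. \<Sum>b<n. M $$ (a, b) * T (munit n a b) $$ (x, y))"
    by (simp add: sum.cartesian_product)
  moreover have "Ms ({..<n} \<times> {..<n}) = M" using M by (intro eq_matI) (auto simp: Ms_def)
  ultimately show ?thesis by simp
qed

lemma tensor_map_carrier: "tensor_map n1 n2 A B X \<in> carrier_mat (n1 * n2) (n1 * n2)"
  by (simp add: tensor_map_def msum_def)

lemma tensor_map_entry:
  assumes A: "\<And>i j. i < n1 \<Longrightarrow> j < n1 \<Longrightarrow> A (munit n1 i j) \<in> carrier_mat n1 n1"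
    and B: "\<And>i j. i < n2 \<Longrightarrow> j < n2 \<Longrightarrow> B (munit n2 i j) \<in> carrier_mat n2 n2"
    and xy: "x < n1 * n2" "y < n1 * n2"
  shows "tensor_map n1 n2 A B X $$ (x, y) = (\<Sum>i<n1. \<Sum>j<n1. A (munit n1 i j) $$ (x div n2, y div n2) *
    (\<Sum>a<n2. \<Sum>b<n2. X $$ (i * n2 + a, j * n2 + b) * B (munit n2 a b) $$ (x mod n2, y mod n2)))"
proof -
  have "tensor_map n1 n2 A B X $$ (x, y) = (\<Sum>i<n1. \<Sum>j<n1. \<Sum>a<n2. \<Sum>b<n2.
     (X $$ (i * n2 + a, j * n2 + b) \<cdot>\<^sub>m kron (A (munit n1 i j)) (B (munit n2 a b))) $$ (x, y))"
    using xy by (simp add: tensor_map_def msum_def sum.cartesian_product case_prod_unfold)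
  also have "\<dots> = (\<Sum>i<n1. \<Sum>j<n1. \<Sum>a<n2. \<Sum>b<n2. X $$ (i * n2 + a, j * n2 + b) *
     (A (munit n1 i j) $$ (x div n2, y div n2) * B (munit n2 a b) $$ (x mod n2, y mod n2)))"
  proof (intro sum.cong refl)
    fix i j a b assume "i \<in> {..<n1}" "j \<in> {..<n1}" "a \<in> {..<n2}" "b \<in> {..<n2}"
    then have "A (munit n1 i j) \<in> carrier_mat n1 n1" "B (munit n2 a b) \<in> carrier_mat n2 n2"
      using A B by auto
    then show "(X $$ (i * n2 + a, j * n2 + b) \<cdot>\<^sub>m kron (A (munit n1 i j)) (B (munit n2 a b))) $$ (x, y)
      = X $$ (i * n2 + a, j * n2 + b) * (A (munit n1 i j) $$ (x div n2, y div n2) * B (munit n2 a b) $$ (x mod n2, y mod n2))"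
      using xy by (simp add: kron_def)
  qed
  finally show ?thesis by (simp add: sum_distrib_left mult_ac)
qed

lemma munit_entry: "x < n \<Longrightarrow> y < n \<Longrightarrow> munit n i j $$ (x, y) = (if x = i \<and> y = j then 1 else 0)"
  by (simp add: munit_def)

lemma tensor_map_id_entry:
  assumes B: "\<And>i j. i < n2 \<Longrightarrow> j < n2 \<Longrightarrow> B (munit n2 i j) \<in> carrier_mat n2 n2"
    and xy: "x < n1 * n2" "y < n1 * n2"
  shows "tensor_map n1 n2 (\<lambda>Y. Y) B X $$ (x, y)
    = (\<Sum>a<n2. \<Sum>b<n2. X $$ (x div n2 * n2 + a, y div n2 * n2 + b) * B (munit n2 a b) $$ (x mod n2, y mod n2))"
proof -
  have dv: "x div n2 < n1" "y div n2 < n1" using xy by (auto simp: less_mult_imp_div_less)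
  let ?F = "\<lambda>i j. \<Sum>a<n2. \<Sum>b<n2. X $$ (i * n2 + a, j * n2 + b) * B (munit n2 a b) $$ (x mod n2, y mod n2)"
  have "tensor_map n1 n2 (\<lambda>Y. Y) B X $$ (x, y) = (\<Sum>i<n1. \<Sum>j<n1. munit n1 i j $$ (x div n2, y div n2) * ?F i j)"
    using B xy by (intro tensor_map_entry munit_carrier)
  also have "\<dots> = (\<Sum>i<n1. \<Sum>j<n1. if j = y div n2 then (if i = x div n2 then ?F i j else 0) else 0)"
    using dv by (intro sum.cong refl) (auto simp: munit_entry)
  also have "\<dots> = ?F (x div n2) (y div n2)" using dv by simp
  finally show ?thesis .
qed

text \<open>Positivity is the case \<open>k = 1\<close> of complete positivity: tensoring with the
  identity on a one-dimensional space reproduces the map.\<close>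

lemma channel_density:
  assumes ch: "quantum_channel n T" and "density n s"
  shows "density n (T s)"
proof -
  from assms have lin: "linear_map_on n T" and cp: "completely_positive n T" and tp: "trace_preserving n T"
    and psd: "psd n s" and tr: "ctrace s = 1"
    by (auto simp: quantum_channel_def density_def)
  note sc = psd_carrier[OF psd]
  have car: "T A \<in> carrier_mat n n" if "A \<in> carrier_mat n n" for A
    using lin that by (simp add: linear_map_on_def)
  have "tensor_map 1 n (\<lambda>Y. Y) T s = T s"
  proof (rule eq_matI)
    fix x y assume "x < dim_row (T s)" "y < dim_col (T s)"
    then have xy: "x < n" "y < n" using car[OF sc] by auto
    then have "tensor_map 1 n (\<lambda>Y. Y) T s $$ (x, y) = (\<Sum>a<n. \<Sum>b<n. s $$ (a, b) * T (munit n a b) $$ (x, y))"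
      using tensor_map_id_entry[of n T x 1 y s] car[OF munit_carrier] by simp
    then show "tensor_map 1 n (\<lambda>Y. Y) T s $$ (x, y) = T s $$ (x, y)"
      using linear_map_expand[OF lin sc xy] by simp
  qed (use car[OF sc] tensor_map_carrier[of 1 n] in auto)
  moreover have "psd (1 * n) (tensor_map 1 n (\<lambda>Y. Y) T s)"
    by (rule cp[unfolded completely_positive_def, rule_format]) (simp_all add: psd)
  ultimately have "psd n (T s)" by (simp only: mult_1)
  moreover have "ctrace (T s) = 1" using tp sc tr by (simp add: trace_preserving_def)
  ultimately show ?thesis by (simp add: density_def)
qed

section \<open>The Weyl channel on density operators\<close>

lemma Phi_carrier: "Phi d r p \<sigma> \<in> carrier_mat d d"
  by (simp add: Phi_def msum_def)

lemma Phi_entry: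
  assumes d: "0 < d" and \<sigma>: "\<sigma> \<in> carrier_mat d d" and xy: "x < d" "y < d"
  shows "Phi d r p \<sigma> $$ (x, y) = (\<Sum>m<d. \<Sum>n<d. of_real (weyl_wt r p m n) *
    (\<Sum>i<d. \<Sum>j<d. weyl d m n $$ (x, i) * \<sigma> $$ (i, j) * cnj (weyl d m n $$ (y, j))))"
proof -
  have W: "weyl d m n \<in> carrier_mat d d" for m n by (simp add: weyl_def)
  have aW: "adj (weyl d m n) \<in> carrier_mat d d" for m n by (simp add: weyl_def adj_def)
  define Q where "Q m n = (\<Sum>i<d. \<Sum>j<d. weyl d m n $$ (x, i) * \<sigma> $$ (i, j) * cnj (weyl d m n $$ (y, j)))" for m n
  have Q: "(weyl d m n * \<sigma> * adj (weyl d m n)) $$ (x, y) = Q m n" for m n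
  proof -
    have "(weyl d m n * \<sigma> * adj (weyl d m n)) $$ (x, y)
      = (\<Sum>j<d. (weyl d m n * \<sigma>) $$ (x, j) * adj (weyl d m n) $$ (j, y))"
      by (rule mat_mult_entry[OF mult_carrier_mat[OF W \<sigma>] aW xy])
    also have "\<dots> = (\<Sum>j<d. \<Sum>i<d. weyl d m n $$ (x, i) * \<sigma> $$ (i, j) * cnj (weyl d m n $$ (y, j)))"
    proof (intro sum.cong refl)
      fix j assume "j \<in> {..<d}"
      then have j: "j < d" by simp
      have "adj (weyl d m n) $$ (j, y) = cnj (weyl d m n $$ (y, j))"
        using j xy by (simp add: adj_def weyl_def)
      then show "(weyl d m n * \<sigma>) $$ (x, j) * adj (weyl d m n) $$ (j, y)
        = (\<Sum>i<d. weyl d m n $$ (x, i) * \<sigma> $$ (i, j) * cnj (weyl d m n $$ (y, j)))"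
        by (simp only: mat_mult_entry[OF W \<sigma> xy(1) j] sum_distrib_right)
    qed
    also have "\<dots> = Q m n" unfolding Q_def by (rule sum.swap)
    finally show ?thesis .
  qed
  have dims: "dim_row (weyl d m n * \<sigma> * adj (weyl d m n)) = d" "dim_col (weyl d m n * \<sigma> * adj (weyl d m n)) = d" for m n
    by (simp_all add: adj_def weyl_def)
  have split: "{..<d} = insert 0 {1..<d}" using d by auto
  have "Phi d r p \<sigma> $$ (x, y) = (\<Sum>m<d. of_real (r m) * Q m 0) + (\<Sum>m<d. \<Sum>n\<in>{1..<d}. of_real (p n) * Q m n)"
    using xy dims by (simp add: Phi_def msum_def Q sum.cartesian_product case_prod_unfold)
  also have "\<dots> = (\<Sum>m<d. of_real (r m) * Q m 0 + (\<Sum>n\<in>{1..<d}. of_real (p n) * Q m n))"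
    by (simp add: sum.distrib)
  also have "\<dots> = (\<Sum>m<d. \<Sum>n<d. of_real (weyl_wt r p m n) * Q m n)"
  proof (rule sum.cong[OF refl])
    fix m
    show "of_real (r m) * Q m 0 + (\<Sum>n\<in>{1..<d}. of_real (p n) * Q m n) = (\<Sum>n<d. of_real (weyl_wt r p m n) * Q m n)"
      unfolding split by (simp add: weyl_wt_def)
  qed
  finally show ?thesis by (simp add: Q_def)
qed

lemma weyl_col:
  assumes "i < d" "j < d" "x < d" "y < d"
  shows "weyl d m n $$ (x, i) * cnj (weyl d m n $$ (y, j)) =
    (if x = (i + m) mod d \<and> y = (j + m) mod d then root1 d ^ (i * n) * cnj (root1 d ^ (j * n)) else 0)"
  using assms by (simp add: weyl_entry)

lemma add_mod_inj:
  assumes "(i + m) mod d = (j + m) mod d" "i < d" "j < (d::nat)" shows "i = j"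
proof -
  have "i = j" if "i \<le> j" "(j + m) mod d = (i + m) mod d" "j < d" for i j
  proof -
    have "d dvd (j + m) - (i + m)" using that by (subst mod_eq_dvd_iff_nat[symmetric]) auto
    then have "d dvd j - i" by simp
    then show ?thesis using that by (auto dest: dvd_imp_le)
  qed
  then show ?thesis using assms by (metis nle_le)
qed

lemma weyl_unitary:
  assumes "i < d" "j < d"
  shows "(\<Sum>x<d. weyl d m n $$ (x, i) * cnj (weyl d m n $$ (x, j))) = (if i = j then 1 else 0)"
proof (cases "i = j")
  case True
  have "root1 d ^ (j * n) * cnj (root1 d ^ (j * n)) = 1"
    using root1_cnj_power[of d "j * n"] by (simp add: mult.commute)
  then have "(\<Sum>x<d. weyl d m n $$ (x, i) * cnj (weyl d m n $$ (x, j))) = (\<Sum>x<d. if x = (j + m) mod d then 1 else 0)"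
    using True assms by (intro sum.cong refl) (simp add: weyl_col)
  then show ?thesis using True assms by simp
next
  case False
  then have "(\<Sum>x<d. weyl d m n $$ (x, i) * cnj (weyl d m n $$ (x, j))) = 0"
    using add_mod_inj[of i m d j] assms by (intro sum.neutral) (auto simp: weyl_col)
  then show ?thesis using False by simp
qed

context
  fixes d :: nat and r p :: "nat \<Rightarrow> real"
  assumes d: "0 < d" and p: "\<And>n. n \<in> {1..<d} \<Longrightarrow> 0 \<le> p n" and r: "\<And>m. m < d \<Longrightarrow> 0 \<le> r m"
    and total: "real d * (\<Sum>n\<in>{1..<d}. p n) + (\<Sum>m<d. r m) = 1"
begin

lemma sum_weyl_wt: "(\<Sum>m<d. \<Sum>n<d. weyl_wt r p m n) = 1"
  using total by (simp add: sum_weyl_wt_inner[OF d] sum.distrib)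

text \<open>Inserting the spectral decomposition of \<sigma> exhibits the output as a nonnegative
  combination of rank-one terms, and unitarity of the Weyl operators preserves the trace.\<close>

lemma Phi_density:
  assumes "density d \<sigma>" shows "density d (Phi d r p \<sigma>)"
proof -
  from assms have psd: "psd d \<sigma>" and tr: "ctrace \<sigma> = 1" by (auto simp: density_def)
  note \<sigma> = psd_carrier[OF psd]
  from ex_spec[of d "entry \<sigma>"] psd obtain e a where s: "spec d (entry \<sigma>) e a" and a: "\<And>i. i < d \<Longrightarrow> 0 \<le> a i"
    unfolding psd_iff by blast
  define V where "V m n k x = (\<Sum>i<d. weyl d m n $$ (x, i) * e k i)" for m n k x
  let ?I = "{..<d} \<times> {..<d} \<times> {..<d}"
  have ent: "Phi d r p \<sigma> $$ (x, y) = (\<Sum>z\<in>?I. of_real (weyl_wt r p (fst z) (fst (snd z)) * a (snd (snd z)))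
     * V (fst z) (fst (snd z)) (snd (snd z)) x * cnj (V (fst z) (fst (snd z)) (snd (snd z)) y))"
    if xy: "x < d" "y < d" for x y
  proof -
    have in1: "(\<Sum>i<d. \<Sum>j<d. weyl d m n $$ (x, i) * \<sigma> $$ (i, j) * cnj (weyl d m n $$ (y, j)))
      = (\<Sum>k<d. of_real (a k) * V m n k x * cnj (V m n k y))" for m n
    proof -
      have "(\<Sum>i<d. \<Sum>j<d. weyl d m n $$ (x, i) * \<sigma> $$ (i, j) * cnj (weyl d m n $$ (y, j)))
        = mform d (entry \<sigma>) (\<lambda>i. cnj (weyl d m n $$ (x, i))) (\<lambda>j. cnj (weyl d m n $$ (y, j)))"
        by (simp add: mform_def)
      also have "\<dots> = (\<Sum>k<d. of_real (a k) * V m n k x * cnj (V m n k y))"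
        unfolding spec_form[OF s] ip_def V_def by simp
      finally show ?thesis .
    qed
    show ?thesis
      unfolding Phi_entry[OF d \<sigma> xy] in1
      by (simp add: sum_distrib_left sum.cartesian_product case_prod_unfold mult.assoc)
  qed
  have form: "mform d (entry (Phi d r p \<sigma>)) f f = of_real (\<Sum>z\<in>?I. weyl_wt r p (fst z) (fst (snd z)) * a (snd (snd z))
     * cmod2 (ip d f (V (fst z) (fst (snd z)) (snd (snd z)))))" for f
  proof -
    have "mform d (entry (Phi d r p \<sigma>)) f f = (\<Sum>z\<in>?I. of_real (weyl_wt r p (fst z) (fst (snd z)) * a (snd (snd z)))
      * ip d f (V (fst z) (fst (snd z)) (snd (snd z))) * cnj (ip d f (V (fst z) (fst (snd z)) (snd (snd z)))))"
      by (rule mform_rank_one_sum) (rule ent)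
    then show ?thesis by (simp only: of_real_sum of_real_mult complex_norm_square mult.assoc)
  qed
  have "psd d (Phi d r p \<sigma>)"
    unfolding psd_iff
  proof (intro conjI allI Phi_carrier)
    fix f
    show "Im (mform d (entry (Phi d r p \<sigma>)) f f) = 0" unfolding form by (rule Im_complex_of_real)
    show "0 \<le> Re (mform d (entry (Phi d r p \<sigma>)) f f)"
      unfolding form Re_complex_of_real by (intro sum_nonneg mult_nonneg_nonneg) (auto intro!: weyl_wt_nonneg r p a)
  qed
  moreover have "ctrace (Phi d r p \<sigma>) = 1"
  proof -
    let ?t = "\<lambda>m n x i j. weyl d m n $$ (x, i) * \<sigma> $$ (i, j) * cnj (weyl d m n $$ (x, j))"
    have inner: "(\<Sum>x<d. \<Sum>i<d. \<Sum>j<d. ?t m n x i j) = 1" for m n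
    proof -
      have "(\<Sum>x<d. \<Sum>i<d. \<Sum>j<d. ?t m n x i j)
        = (\<Sum>i<d. \<Sum>x<d. \<Sum>j<d. ?t m n x i j)"
        by (rule sum.swap)
      also have "\<dots> = (\<Sum>i<d. \<Sum>j<d. \<Sum>x<d. ?t m n x i j)"
        by (intro sum.cong refl sum.swap)
      also have "\<dots> = (\<Sum>i<d. \<Sum>j<d. \<sigma> $$ (i, j) * (\<Sum>x<d. weyl d m n $$ (x, i) * cnj (weyl d m n $$ (x, j))))"
        by (simp add: sum_distrib_left mult_ac)
      also have "\<dots> = (\<Sum>i<d. \<Sum>j<d. if j = i then \<sigma> $$ (i, j) else 0)"
        by (intro sum.cong refl) (simp add: weyl_unitary)
      also have "\<dots> = ctrace \<sigma>" using \<sigma> by (simp add: ctrace_def)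
      finally show ?thesis using tr by simp
    qed
    have "ctrace (Phi d r p \<sigma>) = (\<Sum>x<d. \<Sum>m<d. \<Sum>n<d. of_real (weyl_wt r p m n) *
      (\<Sum>i<d. \<Sum>j<d. ?t m n x i j))"
      using Phi_carrier[of d r p \<sigma>] by (simp add: ctrace_def Phi_entry[OF d \<sigma>])
    also have "\<dots> = (\<Sum>m<d. \<Sum>n<d. \<Sum>x<d. of_real (weyl_wt r p m n) *
      (\<Sum>i<d. \<Sum>j<d. ?t m n x i j))"
      by (rule sum_swap3)
    also have "\<dots> = (\<Sum>m<d. \<Sum>n<d. of_real (weyl_wt r p m n))"
      by (simp only: sum_distrib_left[symmetric] inner mult_1_right)
    also have "\<dots> = complex_of_real (\<Sum>m<d. \<Sum>n<d. weyl_wt r p m n)" by simp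
    finally show ?thesis by (simp only: sum_weyl_wt of_real_1)
  qed
  ultimately show ?thesis by (simp add: density_def)
qed

text \<open>On a basis state the phases of the Weyl operators cancel, and \<open>|k>\<close> moves
  to \<open>|k + m>\<close> with the total weight of all \<open>n\<close>. The output is thus
  diagonal with the same list of eigenvalues, rotated by \<open>k\<close>.\<close>

lemma vn_entropy_Phi_munit:
  assumes k: "k < d"
  shows "vn_entropy (Phi d r p (munit d k k)) = - (\<Sum>m<d. eta (r m + (\<Sum>n\<in>{1..<d}. p n)))"
proof -
  define lam where "lam m = r m + (\<Sum>n\<in>{1..<d}. p n)" for m
  define s where "s a x = (if x = a then 1 else 0 :: complex)" for a x :: nat
  have s: "orthonormal_upto d d s" unfolding s_def by (rule orthonormal_standard)
  have shift_iff: "x = (k + m) mod d \<longleftrightarrow> m = shift d k x" if "x < d" "m < d" for x m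
  proof
    assume "x = (k + m) mod d"
    then have "shift d k x = ((k + m) + (d - k)) mod d" unfolding shift_def by (simp add: mod_add_left_eq)
    also have "\<dots> = m" using k that by simp
    finally show "m = shift d k x" by simp
  next
    assume "m = shift d k x"
    then have "(k + m) mod d = (k + (x + (d - k))) mod d" unfolding shift_def by (simp add: mod_add_right_eq)
    also have "\<dots> = x" using k that by simp
    finally show "x = (k + m) mod d" by simp
  qed
  have "Phi d r p (munit d k k) $$ (x, y) = (\<Sum>i<d. of_real (lam (shift d k i)) * s i x * cnj (s i y))"
    if xy: "x < d" "y < d" for x y
  proof -
    have W: "(\<Sum>i<d. \<Sum>j<d. weyl d m n $$ (x, i) * munit d k k $$ (i, j) * cnj (weyl d m n $$ (y, j)))
      = (if x = y \<and> m = shift d k x then 1 else 0)" if m: "m < d" for m n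
    proof -
      have "(\<Sum>i<d. \<Sum>j<d. weyl d m n $$ (x, i) * munit d k k $$ (i, j) * cnj (weyl d m n $$ (y, j)))
        = (\<Sum>i<d. \<Sum>j<d. if j = k then (if i = k then weyl d m n $$ (x, k) * cnj (weyl d m n $$ (y, k)) else 0) else 0)"
        by (intro sum.cong refl) (auto simp: munit_entry)
      also have "\<dots> = weyl d m n $$ (x, k) * cnj (weyl d m n $$ (y, k))" using k by simp
      also have "\<dots> = (if x = y \<and> m = shift d k x then 1 else 0)"
        using k xy m root1_cnj_power[of d "k * n"] shift_iff[OF xy(1) m] shift_iff[OF xy(2) m]
        by (auto simp: weyl_col mult.commute)
      finally show ?thesis .
    qed
    have "Phi d r p (munit d k k) $$ (x, y)
      = (\<Sum>m<d. \<Sum>n<d. of_real (weyl_wt r p m n) * (if x = y \<and> m = shift d k x then 1 else 0))"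
      unfolding Phi_entry[OF d munit_carrier xy] by (intro sum.cong refl) (simp add: W)
    also have "\<dots> = (\<Sum>m<d. if m = shift d k x then (if x = y then of_real (lam m) else 0) else 0)"
    proof (intro sum.cong refl)
      fix m
      show "(\<Sum>n<d. of_real (weyl_wt r p m n) * (if x = y \<and> m = shift d k x then 1 else 0))
        = (if m = shift d k x then (if x = y then of_real (lam m) else 0) else (0::complex))"
        unfolding lam_def sum_weyl_wt_inner[OF d, symmetric] by simp
    qed
    also have "\<dots> = (if x = y then of_real (lam (shift d k x)) else 0)" using shift_less[OF d] by simp
    also have "\<dots> = (\<Sum>i<d. if i = x then (if x = y then of_real (lam (shift d k x)) else 0) else 0)" using xy by simp
    also have "\<dots> = (\<Sum>i<d. of_real (lam (shift d k i)) * s i x * cnj (s i y))"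
      by (intro sum.cong refl) (auto simp: s_def)
    finally show ?thesis .
  qed
  from vn_entropy_spectral[OF Phi_carrier s this]
  have "vn_entropy (Phi d r p (munit d k k)) = - (\<Sum>i<d. eta (lam (shift d k i)))" by simp
  also have "(\<Sum>i<d. eta (lam (shift d k i))) = (\<Sum>i<d. eta (lam i))"
    by (rule sum_shift[OF k, where F = "\<lambda>i. eta (lam i)"])
  finally show ?thesis by (simp add: lam_def)
qed

lemma munit_density: assumes k: "k < d" shows "density d (munit d k k)"
proof -
  have form: "mform d (entry (munit d k k)) f f = of_real (cmod2 (f k))" for f
  proof -
    have "mform d (entry (munit d k k)) f f = (\<Sum>i<d. \<Sum>j<d. if j = k then (if i = k then f k * cnj (f k) else 0) else 0)"
      unfolding mform_def by (intro sum.cong refl) (auto simp: munit_entry)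
    also have "\<dots> = of_real (cmod2 (f k))" unfolding complex_norm_square using k by simp
    finally show ?thesis .
  qed
  have "psd d (munit d k k)" unfolding psd_iff form by (auto simp: munit_carrier)
  moreover have "ctrace (munit d k k) = 1"
    unfolding ctrace_def using k by (simp add: munit_def)
  ultimately show ?thesis by (simp add: density_def)
qed

end

lemma idx_less: "i < d \<Longrightarrow> a < K \<Longrightarrow> i * K + a < d * (K::nat)"
proof -
  assume "i < d" "a < K"
  then have "i * K + a < Suc i * K" by simp
  also have "\<dots> \<le> d * K" using \<open>i < d\<close> by (intro mult_right_mono) auto
  finally show ?thesis .
qed

text \<open>All entries of a Fourier vector have squared modulus \<open>1 / d\<close>, so its
  expectation in a diagonal operator of trace 1 is \<open>1 / d\<close>.\<close>

lemma fourier_diagonal_trace: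
  assumes M: "\<And>i i'. i < d \<Longrightarrow> i' < d \<Longrightarrow> (\<Sum>a<K. M (i * K + a) (i' * K + a)) = (if i = i' then s i else 0)"
    and s: "(\<Sum>i<d. s i) = 1"
  shows "(\<Sum>a<K. \<Sum>i<d. \<Sum>i'<d. cnj (fourier d j i) * M (i * K + a) (i' * K + a) * fourier d j i') = 1 / of_nat d"
proof -
  let ?t = "\<lambda>a i i'. cnj (fourier d j i) * M (i * K + a) (i' * K + a) * fourier d j i'"
  have "(\<Sum>a<K. \<Sum>i<d. \<Sum>i'<d. ?t a i i')
    = (\<Sum>i<d. \<Sum>a<K. \<Sum>i'<d. ?t a i i')"
    by (rule sum.swap)
  also have "\<dots> = (\<Sum>i<d. \<Sum>i'<d. \<Sum>a<K. ?t a i i')"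
    by (intro sum.cong refl sum.swap)
  also have "\<dots> = (\<Sum>i<d. \<Sum>i'<d. cnj (fourier d j i) * (\<Sum>a<K. M (i * K + a) (i' * K + a)) * fourier d j i')"
    by (simp add: sum_distrib_left sum_distrib_right)
  also have "\<dots> = (\<Sum>i<d. \<Sum>i'<d. if i' = i then s i * (fourier d j i * cnj (fourier d j i)) else 0)"
    by (intro sum.cong refl) (auto simp: M)
  also have "\<dots> = (\<Sum>i<d. s i * of_real (cmod2 (fourier d j i)))"
    unfolding complex_norm_square by simp
  also have "\<dots> = (\<Sum>i<d. s i) / of_nat d" by (simp add: fourier_cmod sum_divide_distrib)
  finally show ?thesis using s by simp
qed

lemma psd_diag:
  assumes "psd n A" "x < n" shows "Im (A $$ (x, x)) = 0" "0 \<le> Re (A $$ (x, x))"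
proof -
  have "mform n (entry A) (\<lambda>k. if k = x then 1 else 0) (\<lambda>k. if k = x then 1 else 0)
    = (\<Sum>i<n. \<Sum>j<n. if j = x then (if i = x then A $$ (x, x) else 0) else 0)"
    unfolding mform_def by (intro sum.cong refl) auto
  also have "\<dots> = A $$ (x, x)" using assms by simp
  finally have "A $$ (x, x) = mform n (entry A) (\<lambda>k. if k = x then 1 else 0) (\<lambda>k. if k = x then 1 else 0)" ..
  then show "Im (A $$ (x, x)) = 0" "0 \<le> Re (A $$ (x, x))" using assms(1) unfolding psd_iff by metis+
qed

lemma ctrace_munit: "a < n \<Longrightarrow> b < n \<Longrightarrow> ctrace (munit n a b) = (if a = b then 1 else 0)"
proof -
  assume "a < n" "b < n"
  have "ctrace (munit n a b) = (\<Sum>i<n. if i = a then (if a = b then 1 else 0) else 0)"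
    unfolding ctrace_def by (intro sum.cong) (auto simp: munit_def)
  then show ?thesis using \<open>a < n\<close> by simp
qed

lemma Phi_munit_entry:
  assumes d: "0 < d" and xy: "x < d" "y < d" and ij: "i < d" "j < d"
  shows "Phi d r p (munit d i j) $$ (x, y)
    = (\<Sum>m<d. \<Sum>n<d. of_real (weyl_wt r p m n) * (weyl d m n $$ (x, i) * cnj (weyl d m n $$ (y, j))))"
proof -
  have "(\<Sum>i'<d. \<Sum>j'<d. weyl d m n $$ (x, i') * munit d i j $$ (i', j') * cnj (weyl d m n $$ (y, j')))
    = (\<Sum>i'<d. \<Sum>j'<d. if j' = j then (if i' = i then weyl d m n $$ (x, i) * cnj (weyl d m n $$ (y, j)) else 0) else 0)" for m n
    by (intro sum.cong refl) (auto simp: munit_entry)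
  then show ?thesis unfolding Phi_entry[OF d munit_carrier xy] using ij by simp
qed

theorem theorem3:
  fixes d dK :: nat and r p :: "nat \<Rightarrow> real" and \<rho> :: "complex mat"
    and \<Omega> :: "complex mat \<Rightarrow> complex mat"
  assumes "prime d"
    and "0 < dK"
    and "\<forall>n \<in> {1..<d}. 0 \<le> p n \<and> p n \<le> 1"
    and "\<forall>m < d. 0 \<le> r m \<and> r m \<le> 1"
    and "real d * (\<Sum>n\<in>{1..<d}. p n) + (\<Sum>m<d. r m) = 1"
    and "density (d * dK) \<rho>"
    and "\<forall>i<d. \<forall>j<d. i \<noteq> j \<longrightarrow> ptrace_K d dK \<rho> $$ (i, j) = 0"
    and "quantum_channel dK \<Omega>"
  shows "vn_entropy (tensor_map d dK (Phi d r p) \<Omega> \<rho>)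
           \<ge> H_chan d (Phi d r p) (ptrace_K d dK \<rho>) + H_chan dK \<Omega> (ptrace_H d dK \<rho>)"
proof -
  have d: "0 < d" using assms(1) prime_gt_0_nat by blast
  note K = assms(2)
  have p: "0 \<le> p n" if "n \<in> {1..<d}" for n using assms(3) that by blast
  have r: "0 \<le> r m" if "m < d" for m using assms(4) that by blast
  note total = assms(5)
  have \<rho>_psd: "psd (d * dK) \<rho>" and \<rho>_tr: "ctrace \<rho> = 1" using assms(6) by (auto simp: density_def)
  note \<rho>_car = psd_carrier[OF \<rho>_psd]
  have lin: "linear_map_on dK \<Omega>" and cp: "completely_positive dK \<Omega>" and tp: "trace_preserving dK \<Omega>"
    using assms(8) by (auto simp: quantum_channel_def)
  have \<Omega>_car: "\<Omega> A \<in> carrier_mat dK dK" if "A \<in> carrier_mat dK dK" for A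
    using lin that by (simp add: linear_map_on_def)
  define s where "s i = (\<Sum>a<dK. \<rho> $$ (i * dK + a, i * dK + a))" for i
  have pK: "(\<Sum>a<dK. \<rho> $$ (i * dK + a, i' * dK + a)) = (if i = i' then s i else 0)" if "i < d" "i' < d" for i i'
    using assms(7) that by (auto simp: ptrace_K_def s_def)
  have s_sum: "(\<Sum>i<d. s i) = 1"
  proof -
    have "(\<Sum>i<d. s i) = (\<Sum>x<d * dK. \<rho> $$ (x div dK * dK + x mod dK, x div dK * dK + x mod dK))"
      unfolding s_def by (rule sum_div_mod[symmetric])
    then show ?thesis using \<rho>_tr \<rho>_car by (simp add: ctrace_def)
  qed
  have s_real: "s i = of_real (Re (s i))" "0 \<le> Re (s i)" if "i < d" for i
    using psd_diag[OF \<rho>_psd idx_less[OF that]] by (auto simp: s_def complex_eq_iff intro!: sum_nonneg)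

  define \<rho>' where "\<rho>' = tensor_map d dK (\<lambda>Y. Y) \<Omega> \<rho>"
  have \<rho>'_psd: "psd (d * dK) \<rho>'"
    unfolding \<rho>'_def by (rule cp[unfolded completely_positive_def, rule_format, OF d \<rho>_psd])
  have \<rho>'_entry: "\<rho>' $$ (i * dK + a, i' * dK + b)
      = (\<Sum>a'<dK. \<Sum>b'<dK. \<rho> $$ (i * dK + a', i' * dK + b') * \<Omega> (munit dK a' b') $$ (a, b))"
    if "i < d" "i' < d" "a < dK" "b < dK" for i i' a b
    unfolding \<rho>'_def using that
    by (subst tensor_map_id_entry[where B = \<Omega>]) (simp_all add: idx_less \<Omega>_car munit_carrier)
  from ex_spec[of "d * dK" "entry \<rho>'"] \<rho>'_psd obtain u \<alpha> where sp: "spec (d * dK) (entry \<rho>') u \<alpha>"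
    and \<alpha>: "\<And>k. k < d * dK \<Longrightarrow> 0 \<le> \<alpha> k" unfolding psd_iff by blast
  \<comment> \<open>\<Omega> acts on the second factor and preserves the trace, so \<rho>' has the
    same marginal on the first factor as \<rho>.\<close>
  have \<rho>'_diag: "(\<Sum>a<dK. \<rho>' $$ (i * dK + a, i' * dK + a)) = (if i = i' then s i else 0)"
    if "i < d" "i' < d" for i i'
  proof -
    let ?t = "\<lambda>a a' b'. \<rho> $$ (i * dK + a', i' * dK + b') * \<Omega> (munit dK a' b') $$ (a, a)"
    have "(\<Sum>a<dK. \<rho>' $$ (i * dK + a, i' * dK + a))
      = (\<Sum>a<dK. \<Sum>a'<dK. \<Sum>b'<dK. ?t a a' b')"
      using that by (intro sum.cong refl) (simp add: \<rho>'_entry)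
    also have "\<dots> = (\<Sum>a'<dK. \<Sum>b'<dK. \<Sum>a<dK. ?t a a' b')"
      by (rule sum_swap3)
    also have "\<dots> = (\<Sum>a'<dK. \<Sum>b'<dK. if b' = a' then \<rho> $$ (i * dK + a', i' * dK + a') else 0)"
    proof (intro sum.cong refl)
      fix a' b' assume ab: "a' \<in> {..<dK}" "b' \<in> {..<dK}"
      have "(\<Sum>a<dK. \<Omega> (munit dK a' b') $$ (a, a)) = ctrace (\<Omega> (munit dK a' b'))"
        using \<Omega>_car[OF munit_carrier[of dK a' b']] by (simp add: ctrace_def)
      also have "\<dots> = (if a' = b' then 1 else 0)"
        using tp munit_carrier[of dK a' b'] ab by (simp add: trace_preserving_def ctrace_munit)
      finally show "(\<Sum>a<dK. ?t a a' b')
        = (if b' = a' then \<rho> $$ (i * dK + a', i' * dK + a') else 0)"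
        by (auto simp: sum_distrib_left[symmetric])
    qed
    finally show ?thesis using pK[OF that] by simp
  qed
  interpret W: weyl_output d dK r p "entry \<rho>'" u \<alpha>
  proof
    show "(\<Sum>a<dK. \<Sum>i<d. \<Sum>i'<d. cnj (fourier d j i) * \<rho>' $$ (i * dK + a, i' * dK + a) * fourier d j i') = 1 / of_nat d"
      if "j < d" for j
      by (rule fourier_diagonal_trace[where M = "entry \<rho>'", OF \<rho>'_diag s_sum])
  qed (fact d K r p total sp \<alpha>)+

  have \<tau>: "tensor_map d dK (Phi d r p) \<Omega> \<rho> = mat W.N W.N (\<lambda>(x, y). W.\<tau> x y)"
  proof (rule eq_matI)
    fix x y assume "x < dim_row (mat W.N W.N (\<lambda>(x, y). W.\<tau> x y))" "y < dim_col (mat W.N W.N (\<lambda>(x, y). W.\<tau> x y))"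
    then have xy: "x < d * dK" "y < d * dK" by (auto simp: W.N_def)
    have dm: "x div dK < d" "y div dK < d" "x mod dK < dK" "y mod dK < dK"
      using xy K by (auto simp: less_mult_imp_div_less)
    let ?W = "\<lambda>m n i. weyl d m n $$ (x div dK, i)" and ?W' = "\<lambda>m n j. weyl d m n $$ (y div dK, j)"
    let ?u = "\<lambda>k i. u k (i * dK + x mod dK)" and ?u' = "\<lambda>k j. u k (j * dK + y mod dK)"
    let ?w = "\<lambda>m n. complex_of_real (weyl_wt r p m n)"
    let ?t = "\<lambda>m n k i j. ?w m n * of_real (\<alpha> k) * (?W m n i * ?u k i) * (cnj (?W' m n j * ?u' k j))"
    have "tensor_map d dK (Phi d r p) \<Omega> \<rho> $$ (x, y)
      = (\<Sum>i<d. \<Sum>j<d. Phi d r p (munit d i j) $$ (x div dK, y div dK) * \<rho>' $$ (i * dK + x mod dK, j * dK + y mod dK))"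
      using dm by (subst tensor_map_entry[where B = \<Omega>, OF _ _ xy]) (simp_all add: \<rho>'_entry Phi_carrier \<Omega>_car munit_carrier)
    also have "\<dots> = (\<Sum>i<d. \<Sum>j<d. (\<Sum>m<d. \<Sum>n<d. ?w m n * (?W m n i * cnj (?W' m n j)))
        * (\<Sum>k<W.N. of_real (\<alpha> k) * ?u k i * cnj (?u' k j)))"
      using sp dm by (intro sum.cong refl) (simp add: Phi_munit_entry[OF d] spec_def idx_less W.N_def)
    also have "\<dots> = (\<Sum>i<d. \<Sum>j<d. \<Sum>m<d. \<Sum>n<d. \<Sum>k<W.N. ?t m n k i j)"
      unfolding sum_distrib_right by (simp add: sum_distrib_left mult_ac)
    also have "\<dots> = (\<Sum>m<d. \<Sum>n<d. \<Sum>i<d. \<Sum>j<d. \<Sum>k<W.N. ?t m n k i j)" by (rule sum_swap22)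
    also have "\<dots> = (\<Sum>m<d. \<Sum>n<d. \<Sum>k<W.N. \<Sum>i<d. \<Sum>j<d. ?t m n k i j)"
      by (intro sum.cong refl sum_swap3[symmetric])
    also have "\<dots> = W.\<tau> x y"
      unfolding W.\<tau>_def W.vv_def cnj_sum
    proof (intro sum.cong refl)
      fix m n k
      show "(\<Sum>i<d. \<Sum>j<d. ?t m n k i j)
        = of_real (weyl_wt r p m n * \<alpha> k) * (\<Sum>i<d. ?W m n i * ?u k i) * (\<Sum>j<d. cnj (?W' m n j * ?u' k j))"
        unfolding of_real_mult sum_distrib_left[symmetric] sum_distrib_right[symmetric] ..
    qed
    finally show "tensor_map d dK (Phi d r p) \<Omega> \<rho> $$ (x, y) = mat W.N W.N (\<lambda>(x, y). W.\<tau> x y) $$ (x, y)"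
      using xy by (simp add: W.N_def)
  qed (simp_all add: tensor_map_def msum_def W.N_def)

  \<comment> \<open>The normalised states of the second system after a measurement of the first one
    in the Fourier basis; by linearity \<Omega> sends them to the blocks of \<rho>'.\<close>
  define \<rho>j where "\<rho>j j = mat dK dK (\<lambda>(a, b). fourier_block d dK (entry \<rho>) j a b)" for j
  have \<rho>j_car: "\<rho>j j \<in> carrier_mat dK dK" for j by (simp add: \<rho>j_def)
  have \<rho>j_density: "density dK (\<rho>j j)" if j: "j < d" for j
  proof -
    have form: "mform dK (entry (\<rho>j j)) g g = of_nat d * mform (d * dK) (entry \<rho>) (tens dK (fourier d j) g) (tens dK (fourier d j) g)" for g
    proof -
      have "mform dK (entry (\<rho>j j)) g g = mform dK (fourier_block d dK (entry \<rho>) j) g g"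
        by (rule mform_cong) (simp add: \<rho>j_def)
      then show ?thesis using d by (simp add: form_tens_fourier_block)
    qed
    have "psd dK (\<rho>j j)"
      unfolding psd_iff form using \<rho>_psd \<rho>j_car unfolding psd_iff by simp
    moreover have "ctrace (\<rho>j j) = 1"
    proof -
      have "ctrace (\<rho>j j) = of_nat d * (\<Sum>a<dK. \<Sum>i<d. \<Sum>i'<d. cnj (fourier d j i) * \<rho> $$ (i * dK + a, i' * dK + a) * fourier d j i')"
        by (simp add: ctrace_def \<rho>j_def fourier_block_def sum_distrib_left)
      also have "\<dots> = of_nat d * (1 / of_nat d)"
        by (intro arg_cong2[where f = "(*)"] refl fourier_diagonal_trace[where M = "entry \<rho>", OF pK s_sum])
      finally show ?thesis using d by simp
    qed
    ultimately show ?thesis by (simp add: density_def)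
  qed
  have blk: "W.blk j a b = \<Omega> (\<rho>j j) $$ (a, b)" if ab: "a < dK" "b < dK" for j a b
  proof -
    let ?f = "fourier d j"
    let ?O = "\<lambda>a' b'. \<Omega> (munit dK a' b') $$ (a, b)"
    let ?t = "\<lambda>i i' a' b'. of_nat d * (cnj (?f i) * \<rho> $$ (i * dK + a', i' * dK + b') * ?f i') * ?O a' b'"
    have "W.blk j a b = of_nat d * (\<Sum>i<d. \<Sum>i'<d. cnj (?f i) * (\<Sum>a'<dK. \<Sum>b'<dK. \<rho> $$ (i * dK + a', i' * dK + b') * ?O a' b') * ?f i')"
      unfolding W.blk_def fourier_block_def using ab by (simp add: \<rho>'_entry)
    also have "\<dots> = (\<Sum>i<d. \<Sum>i'<d. \<Sum>a'<dK. \<Sum>b'<dK. ?t i i' a' b')"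
      by (simp add: sum_distrib_left sum_distrib_right mult_ac)
    also have "\<dots> = (\<Sum>a'<dK. \<Sum>b'<dK. \<Sum>i<d. \<Sum>i'<d. ?t i i' a' b')" by (rule sum_swap22)
    also have "\<dots> = (\<Sum>a'<dK. \<Sum>b'<dK. \<rho>j j $$ (a', b') * ?O a' b')"
      by (intro sum.cong refl) (simp add: \<rho>j_def fourier_block_def sum_distrib_left sum_distrib_right)
    also have "\<dots> = \<Omega> (\<rho>j j) $$ (a, b)" by (rule linear_map_expand[OF lin \<rho>j_car ab, symmetric])
    finally show ?thesis .
  qed
  have ent_blk: "ent dK (W.blk j) = vn_entropy (\<Omega> (\<rho>j j))" for j
  proof -
    have "mat dK dK (\<lambda>(a, b). W.blk j a b) = \<Omega> (\<rho>j j)"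
      using carrier_matD[OF \<Omega>_car[OF \<rho>j_car[of j]]] by (intro eq_matI) (simp_all add: blk)
    then show ?thesis by (simp add: ent_def)
  qed

  \<comment> \<open>The diagonal marginal is itself a mixture of basis states, with its diagonal
    entries as weights. All of them have the same output entropy, so the weights drop out.\<close>
  have H1: "H_chan d (Phi d r p) (ptrace_K d dK \<rho>) \<le> - (\<Sum>m<d. eta (W.lam m))"
  proof -
    have "H_chan d (Phi d r p) (ptrace_K d dK \<rho>) \<le> (\<Sum>k<d. Re (s k) * vn_entropy (Phi d r p (munit d k k)))"
    proof (rule H_chan_le)
      show "density d (Phi d r p \<sigma>)" if "density d \<sigma>" for \<sigma>
        by (rule Phi_density[OF d p r total that])
      show "0 \<le> Re (s k)" "density d (munit d k k)" if "k < d" for k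
        using s_real(2)[OF that] munit_density[OF d p r total that] by auto
      show "(\<Sum>k<d. Re (s k)) = 1" using s_sum by (simp add: Re_sum[symmetric])
      show "ptrace_K d dK \<rho> = msum d (\<lambda>k. complex_of_real (Re (s k)) \<cdot>\<^sub>m munit d k k) {..<d}" (is "_ = ?S")
      proof (rule eq_matI)
        fix x y assume "x < dim_row (?S)"
          "y < dim_col (?S)"
        then have xy: "x < d" "y < d" by (auto simp: msum_def)
        have "?S $$ (x, y)
          = (\<Sum>k<d. (complex_of_real (Re (s k)) \<cdot>\<^sub>m munit d k k) $$ (x, y))"
          unfolding msum_def using xy by simp
        also have "\<dots> = (\<Sum>k<d. if k = x then (if x = y then complex_of_real (Re (s x)) else 0) else 0)"
          using xy by (intro sum.cong refl) (auto simp: munit_def)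
        also have "\<dots> = (if x = y then s x else 0)" 
          using xy s_real(1)[OF xy(1), symmetric] by auto
        finally show "ptrace_K d dK \<rho> $$ (x, y) = ?S $$ (x, y)"
          using pK[OF xy] xy by (simp add: ptrace_K_def)
      qed (simp_all add: ptrace_K_def msum_def)
    qed
    also have "\<dots> = (\<Sum>k<d. Re (s k)) * - (\<Sum>m<d. eta (W.lam m))"
      unfolding sum_distrib_right
    proof (intro sum.cong refl arg_cong2[where f = "(*)"])
      fix k assume "k \<in> {..<d}"
      then have "k < d" by simp
      from vn_entropy_Phi_munit[OF d p r total this]
      show "vn_entropy (Phi d r p (munit d k k)) = - (\<Sum>m<d. eta (W.lam m))" by (simp only: W.lam_def)
    qed
    also have "(\<Sum>k<d. Re (s k)) = 1" using s_sum by (simp add: Re_sum[symmetric])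
    finally show ?thesis by simp
  qed
  \<comment> \<open>Completeness of the Fourier basis makes the marginal on the second factor the
    uniform mixture of the states \<open>\<rho>j j\<close>.\<close>
  have H2: "H_chan dK \<Omega> (ptrace_H d dK \<rho>) \<le> (\<Sum>j<d. ent dK (W.blk j)) / d"
  proof -
    have "H_chan dK \<Omega> (ptrace_H d dK \<rho>) \<le> (\<Sum>j<d. 1 / d * vn_entropy (\<Omega> (\<rho>j j)))"
    proof (rule H_chan_le[OF channel_density[OF assms(8)]])
      show "(\<Sum>j<d. 1 / real d) = 1" using d by simp
      show "ptrace_H d dK \<rho> = msum dK (\<lambda>j. complex_of_real (1 / real d) \<cdot>\<^sub>m \<rho>j j) {..<d}" (is "_ = ?S")
      proof (rule eq_matI)
        fix a b assume "a < dim_row (?S)"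
          "b < dim_col (?S)"
        then have ab: "a < dK" "b < dK" by (auto simp: msum_def)
        let ?t = "\<lambda>j i i'. cnj (fourier d j i) * \<rho> $$ (i * dK + a, i' * dK + b) * fourier d j i'"
        have "?S $$ (a, b)
          = (\<Sum>j<d. \<Sum>i<d. \<Sum>i'<d. ?t j i i')"
          unfolding msum_def using ab d by (simp add: \<rho>j_def fourier_block_def)
        also have "\<dots> = (\<Sum>i<d. \<Sum>i'<d. \<Sum>j<d. ?t j i i')"
          by (rule sum_swap3)
        also have "\<dots> = (\<Sum>i<d. \<Sum>i'<d. \<rho> $$ (i * dK + a, i' * dK + b) * (\<Sum>j<d. fourier d j i' * cnj (fourier d j i)))"
          by (simp add: sum_distrib_left mult_ac)
        also have "\<dots> = (\<Sum>i<d. \<Sum>i'<d. if i' = i then \<rho> $$ (i * dK + a, i' * dK + b) else 0)"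
          by (intro sum.cong refl) (simp add: orthonormal_complete[OF fourier_orthonormal])
        also have "\<dots> = ptrace_H d dK \<rho> $$ (a, b)" using ab by (simp add: ptrace_H_def)
        finally show "ptrace_H d dK \<rho> $$ (a, b) = ?S $$ (a, b)" ..
      qed (simp_all add: ptrace_H_def msum_def)
    qed (use \<rho>j_density in auto)
    then show ?thesis by (simp add: ent_blk sum_divide_distrib)
  qed
  have "vn_entropy (tensor_map d dK (Phi d r p) \<Omega> \<rho>) = ent W.N W.\<tau>" by (simp add: \<tau> ent_def)
  then show ?thesis using W.output_entropy_bound H1 H2 by simp
qed

end
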